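(* For any constant $\alpha>0$, there exists a fully explicit (deterministic) algorithm which, for every vector $x\in\mathbb{R}^n$ in the strict turnstile model, finds the $\ell_1$ $\epsilon$-heavy hitters of $x$ (returning a list of $\mathcal{O}(1/\epsilon)$ coordinates containing all $i$ with $|x_i|\geq\epsilon\|x\|_1$), using space $\mathcal{O}((1/\epsilon)^{1+\alpha}(\log(\frac{1}{\epsilon})\log n)^{2+2/\alpha})$. The update time is $\mathcal{O}(\mathrm{poly}(\log n))$ and the query time is $\mathcal{O}(n\cdot\mathrm{poly}(\log n))$.
   Context: Strict turnstile model: a vector $x\in\mathbb{R}^n$, initially $0$, receives updates $(i,\Delta)$ which change $x_i$ to $x_i+\Delta$; insertions and deletions are allowed but $x_i\geq 0$ for all $i$ at all times. Space is measured in machine words.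
   Formalization: Containment of all heavy hitters is claimed only for x ≠ 0 (for x = 0 every coordinate qualifies, so no list of O(1/ε) entries suffices), and the bounds are for n ≥ 2 and 0 < ε ≤ 1/2, since the stated space bound vanishes for n = 1 and as ε → 1. *)

theory Defs
  imports "HOL-Analysis.Analysis"
begin

section \<open>The machine\<close>

text \<open>
  A deterministic unit-cost RAM. One memory bank holds integer words (natural numbers below
  the bound \<open>B\<close>, also used as addresses), the other one holds words containing one real number
  each, since the stream updates and the coordinates of \<open>x\<close> are real. Reals influence control flow
  only through comparisons (there is no rounding from reals to integers), and the only
  constants available in programs are natural numbers.
\<close>

datatype iexp =
    INum nat
  | ICell iexp
  | IAdd iexp iexp
  | ISub iexp iexp
  | IMul iexp iexp
  | IDiv iexp iexp
  | IMod iexp iexp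

datatype rexp =
    ROfInt iexp
  | RCell iexp
  | RAdd rexp rexp
  | RSub rexp rexp
  | RMul rexp rexp
  | RDiv rexp rexp

datatype bexp =
    ILess iexp iexp
  | RLess rexp rexp
  | BNot bexp
  | BAnd bexp bexp

datatype com =
    Skip
  | IAssign iexp iexp
  | RAssign iexp rexp
  | Emit iexp
  | Seq com com
  | Cond bexp com com
  | While bexp com

record state =
  imem :: "nat \<Rightarrow> nat"
  rmem :: "nat \<Rightarrow> real"
  out :: "nat list"

primrec ival :: "state \<Rightarrow> iexp \<Rightarrow> nat" where
  "ival s (INum k) = k"
| "ival s (ICell a) = imem s (ival s a)"
| "ival s (IAdd a b) = ival s a + ival s b"
| "ival s (ISub a b) = ival s a - ival s b"
| "ival s (IMul a b) = ival s a * ival s b"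
| "ival s (IDiv a b) = ival s a div ival s b"
| "ival s (IMod a b) = ival s a mod ival s b"

primrec rval :: "state \<Rightarrow> rexp \<Rightarrow> real" where
  "rval s (ROfInt a) = real (ival s a)"
| "rval s (RCell a) = rmem s (ival s a)"
| "rval s (RAdd a b) = rval s a + rval s b"
| "rval s (RSub a b) = rval s a - rval s b"
| "rval s (RMul a b) = rval s a * rval s b"
| "rval s (RDiv a b) = rval s a / rval s b"

primrec bval :: "state \<Rightarrow> bexp \<Rightarrow> bool" where
  "bval s (ILess a b) \<longleftrightarrow> ival s a < ival s b"
| "bval s (RLess a b) \<longleftrightarrow> rval s a < rval s b"
| "bval s (BNot b) \<longleftrightarrow> \<not> bval s b"
| "bval s (BAnd b c) \<longleftrightarrow> bval s b \<and> bval s c"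

text \<open>
  Legality of an evaluation when each bank has \<open>m\<close> cells: every address is below \<open>m\<close> and every
  integer that occurs, intermediate results included, is below \<open>B\<close>.
\<close>

primrec iok :: "nat \<Rightarrow> nat \<Rightarrow> state \<Rightarrow> iexp \<Rightarrow> bool" where
  "iok m B s (INum k) \<longleftrightarrow> k < B"
| "iok m B s (ICell a) \<longleftrightarrow> iok m B s a \<and> ival s a < m \<and> imem s (ival s a) < B"
| "iok m B s (IAdd a b) \<longleftrightarrow> iok m B s a \<and> iok m B s b \<and> ival s a + ival s b < B"
| "iok m B s (ISub a b) \<longleftrightarrow> iok m B s a \<and> iok m B s b"
| "iok m B s (IMul a b) \<longleftrightarrow> iok m B s a \<and> iok m B s b \<and> ival s a * ival s b < B"
| "iok m B s (IDiv a b) \<longleftrightarrow> iok m B s a \<and> iok m B s b"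
| "iok m B s (IMod a b) \<longleftrightarrow> iok m B s a \<and> iok m B s b"

primrec rok :: "nat \<Rightarrow> nat \<Rightarrow> state \<Rightarrow> rexp \<Rightarrow> bool" where
  "rok m B s (ROfInt a) \<longleftrightarrow> iok m B s a"
| "rok m B s (RCell a) \<longleftrightarrow> iok m B s a \<and> ival s a < m"
| "rok m B s (RAdd a b) \<longleftrightarrow> rok m B s a \<and> rok m B s b"
| "rok m B s (RSub a b) \<longleftrightarrow> rok m B s a \<and> rok m B s b"
| "rok m B s (RMul a b) \<longleftrightarrow> rok m B s a \<and> rok m B s b"
| "rok m B s (RDiv a b) \<longleftrightarrow> rok m B s a \<and> rok m B s b"

primrec bok :: "nat \<Rightarrow> nat \<Rightarrow> state \<Rightarrow> bexp \<Rightarrow> bool" where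
  "bok m B s (ILess a b) \<longleftrightarrow> iok m B s a \<and> iok m B s b"
| "bok m B s (RLess a b) \<longleftrightarrow> rok m B s a \<and> rok m B s b"
| "bok m B s (BNot b) \<longleftrightarrow> bok m B s b"
| "bok m B s (BAnd b c) \<longleftrightarrow> bok m B s b \<and> bok m B s c"

text \<open>
  \<open>exec m B c s t s'\<close>: started in \<open>s\<close>, the program \<open>c\<close> halts in \<open>s'\<close> after \<open>t\<close> steps without any
  illegal evaluation (an illegal evaluation leaves the machine stuck). An assignment, output or
  test costs one step; as the expressions of a fixed program have bounded size, counting
  individual operations would change \<open>t\<close> by at most a constant factor.
\<close>

inductive exec :: "nat \<Rightarrow> nat \<Rightarrow> com \<Rightarrow> state \<Rightarrow> nat \<Rightarrow> state \<Rightarrow> bool"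
  for m B :: nat where
  exec_Skip: "exec m B Skip s 1 s"
| exec_IAssign:
    "iok m B s a \<Longrightarrow> ival s a < m \<Longrightarrow> iok m B s e \<Longrightarrow>
     exec m B (IAssign a e) s 1 (s\<lparr>imem := (imem s)(ival s a := ival s e)\<rparr>)"
| exec_RAssign:
    "iok m B s a \<Longrightarrow> ival s a < m \<Longrightarrow> rok m B s e \<Longrightarrow>
     exec m B (RAssign a e) s 1 (s\<lparr>rmem := (rmem s)(ival s a := rval s e)\<rparr>)"
| exec_Emit:
    "iok m B s e \<Longrightarrow> exec m B (Emit e) s 1 (s\<lparr>out := out s @ [ival s e]\<rparr>)"
| exec_Seq:
    "exec m B c1 s t1 s' \<Longrightarrow> exec m B c2 s' t2 s'' \<Longrightarrow> exec m B (Seq c1 c2) s (t1 + t2) s''"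
| exec_CondTrue:
    "bok m B s b \<Longrightarrow> bval s b \<Longrightarrow> exec m B c1 s t s' \<Longrightarrow> exec m B (Cond b c1 c2) s (t + 1) s'"
| exec_CondFalse:
    "bok m B s b \<Longrightarrow> \<not> bval s b \<Longrightarrow> exec m B c2 s t s' \<Longrightarrow> exec m B (Cond b c1 c2) s (t + 1) s'"
| exec_WhileTrue:
    "bok m B s b \<Longrightarrow> bval s b \<Longrightarrow> exec m B c s t1 s' \<Longrightarrow> exec m B (While b c) s' t2 s'' \<Longrightarrow>
     exec m B (While b c) s (t1 + t2 + 1) s''"
| exec_WhileFalse:
    "bok m B s b \<Longrightarrow> \<not> bval s b \<Longrightarrow> exec m B (While b c) s 1 s"

lemma exec_deterministic:
  "exec m B c s t s' \<Longrightarrow> exec m B c s u s'' \<Longrightarrow> u = t \<and> s'' = s'"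
proof (induction arbitrary: u s'' rule: exec.induct)
  case (exec_Skip s)
  from exec_Skip.prems show ?case by cases simp
next
  case (exec_IAssign s a e)
  from exec_IAssign.prems show ?case by cases simp
next
  case (exec_RAssign s a e)
  from exec_RAssign.prems show ?case by cases simp
next
  case (exec_Emit s e)
  from exec_Emit.prems show ?case by cases simp
next
  case (exec_Seq c1 s t1 s1 c2 t2 s2)
  note IH = exec_Seq.IH
  from exec_Seq.prems show ?case
  proof cases
    case (exec_Seq v1 r v2)
    with IH(1)[of v1 r] IH(2)[of v2 s''] show ?thesis by simp
  qed
next
  case (exec_CondTrue s b c1 t s1 c2)
  from exec_CondTrue.prems show ?case
    by cases (use exec_CondTrue.hyps in \<open>auto dest: exec_CondTrue.IH\<close>)
next
  case (exec_CondFalse s b c2 t s1 c1)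
  from exec_CondFalse.prems show ?case
    by cases (use exec_CondFalse.hyps in \<open>auto dest: exec_CondFalse.IH\<close>)
next
  case (exec_WhileTrue s b c t1 s1 t2 s2)
  note IH = exec_WhileTrue.IH
  from exec_WhileTrue.prems show ?case
  proof cases
    case (exec_WhileTrue v1 r v2)
    with IH(1)[of v1 r] IH(2)[of v2 s''] show ?thesis by simp
  next
    case exec_WhileFalse
    with \<open>bval s b\<close> show ?thesis by simp
  qed
next
  case (exec_WhileFalse s b c)
  from exec_WhileFalse.prems show ?case
    by cases (use exec_WhileFalse.hyps in auto)
qed


section \<open>Streams\<close>

text \<open>An update \<open>(i, \<Delta>)\<close> is a pair; coordinates are numbered \<open>0, \<dots>, n - 1\<close>.\<close>

type_synonym stream = "(nat \<times> real) list"

definition stream_vec :: "stream \<Rightarrow> nat \<Rightarrow> real" where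
  "stream_vec \<sigma> i = (\<Sum>(j, \<Delta>)\<leftarrow>\<sigma>. if j = i then \<Delta> else 0)"

definition strict_turnstile :: "nat \<Rightarrow> stream \<Rightarrow> bool" where
  "strict_turnstile n \<sigma> \<longleftrightarrow>
     (\<forall>(i, \<Delta>) \<in> set \<sigma>. i < n) \<and>
     (\<forall>k \<le> length \<sigma>. \<forall>i < n. stream_vec (take k \<sigma>) i \<ge> 0)"

definition l1_norm :: "nat \<Rightarrow> (nat \<Rightarrow> real) \<Rightarrow> real" where
  "l1_norm n x = (\<Sum>i<n. \<bar>x i\<bar>)"

definition heavy_hitters :: "nat \<Rightarrow> real \<Rightarrow> (nat \<Rightarrow> real) \<Rightarrow> nat set" where
  "heavy_hitters n \<epsilon> x = {i. i < n \<and> \<bar>x i\<bar> \<ge> \<epsilon> * l1_norm n x}"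


section \<open>Running a streaming algorithm\<close>

text \<open>
  There is no preprocessing phase: apart from the parameters, the memory is initially zero.
  All data the algorithm relies on is thus computed by its update and query programs,
  within their time bounds.
\<close>

definition initial_state :: "nat \<Rightarrow> real \<Rightarrow> real \<Rightarrow> state" where
  "initial_state n \<epsilon> \<alpha> =
     \<lparr>imem = (\<lambda>_. 0)(0 := n), rmem = (\<lambda>_. 0)(0 := \<epsilon>, 1 := \<alpha>), out = []\<rparr>"

definition load_update :: "nat \<Rightarrow> real \<Rightarrow> state \<Rightarrow> state" where
  "load_update i \<Delta> s = s\<lparr>imem := (imem s)(1 := i), rmem := (rmem s)(2 := \<Delta>), out := []\<rparr>"

text \<open>
  \<open>processed m B T upd s0 \<sigma> s\<close>: running \<open>upd\<close> once for each update of \<open>\<sigma>\<close>, each time for at most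
  \<open>T\<close> steps, leads from \<open>s0\<close> to \<open>s\<close>. Programs cannot read \<open>out\<close>; clearing it between
  runs only separates the outputs.
\<close>

inductive processed :: "nat \<Rightarrow> nat \<Rightarrow> real \<Rightarrow> com \<Rightarrow> state \<Rightarrow> stream \<Rightarrow> state \<Rightarrow> bool"
  for m B :: nat and T :: real and upd :: com and s0 :: state where
  processed_Nil: "processed m B T upd s0 [] s0"
| processed_snoc:
    "processed m B T upd s0 \<sigma> s \<Longrightarrow> exec m B upd (load_update i \<Delta> s) t s' \<Longrightarrow> real t \<le> T \<Longrightarrow>
     processed m B T upd s0 (\<sigma> @ [(i, \<Delta>)]) s'"

definition query_result :: "nat \<Rightarrow> nat \<Rightarrow> real \<Rightarrow> com \<Rightarrow> state \<Rightarrow> nat list \<Rightarrow> bool" where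
  "query_result m B T qry s xs \<longleftrightarrow>
     (\<exists>t s'. exec m B qry (s\<lparr>out := []\<rparr>) t s' \<and> real t \<le> T \<and> out s' = xs)"

end

theory Submission
  imports Defs "HOL-Computational_Algebra.Computational_Algebra" "HOL-Real_Asymp.Real_Asymp"
begin

text \<open>
  The algorithm is a Count-Min sketch whose hash functions come from an unbalanced expander. Coordinate \<open>i\<close>
  is the polynomial \<open>f\<^sub>i\<close> whose coefficients are the bits of \<open>i\<close>; for a prime \<open>q\<close> and every \<open>y = 1, \<dots>, q - 1\<close>
  it is hashed to the bucket \<open>(y, f\<^sub>i(y), (\<theta> f\<^sub>i)(y), \<dots>, (\<theta>\<^sup>r\<^sup>-\<^sup>1 f\<^sub>i)(y))\<close> over the field with \<open>q\<close> elements, where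
  \<open>\<theta> = X d/dX\<close> (a multiplicity code, as in the expanders of Kalev and Ta-Shma).
  All \<open>i\<close> whose buckets all weigh at least \<open>\<epsilon> \<parallel>x\<parallel>\<^sub>1\<close> are reported. Since \<open>x \<ge> 0\<close>, no heavy hitter is lost;
  the buckets of the reported set \<open>F\<close> number at most \<open>(q - 1) / \<epsilon>\<close>, so it suffices that \<open>F\<close> has at least
  \<open>|F| (q - 1) / 2\<close> buckets.

  For this expansion take a nonzero polynomial \<open>Q(X, Y\<^sub>1, \<dots>, Y\<^sub>r)\<close> of low degree that vanishes on all buckets
  of \<open>F\<close>. Then \<open>Q(X, f, \<theta> f, \<dots>) = 0\<close> for all \<open>f\<close> in \<open>F\<close>. If \<open>Y\<^sub>v\<close> is the last variable of \<open>Q\<close>, then at a point where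
  \<open>\<partial>Q/\<partial>Y\<^sub>v \<noteq> 0\<close> this differential equation determines \<open>f\<close>, so such buckets are private to \<open>f\<close>; those \<open>f\<close> that
  also solve \<open>\<partial>Q/\<partial>Y\<^sub>v = 0\<close> are treated by induction on the degree.

  With suitable \<open>r\<close> and \<open>q\<close> the number of buckets is \<open>O((1/\<epsilon>)\<^sup>1\<^sup>+\<^sup>\<beta> (log (1/\<epsilon>) log n)\<^sup>2\<^sup>+\<^sup>1\<^sup>/\<^sup>\<beta>)\<close> for any fixed rational \<open>\<beta> > 0\<close>,
  and every \<open>\<beta>\<close> in \<open>[\<alpha>/2, \<alpha>]\<close> is good enough. So the machine never handles powers with exponent \<open>\<alpha>\<close>: all
  parameters come from integer arithmetic, fast enough to be recomputed in every run.
\<close>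

section \<open>Primes in linear gaps\<close>

lemma prod_primes_dvd:
  assumes "finite (A :: nat set)" "\<And>p. p \<in> A \<Longrightarrow> prime p \<and> p dvd N"
  shows "\<Prod>A dvd N"
  using assms
proof (induction A)
  case (insert p A)
  have "coprime p (\<Prod>A)"
    using insert by (intro prod_coprime_right) (auto intro!: primes_coprime)
  then show ?case using insert by (simp add: divides_mult)
qed auto

text \<open>Erdos's argument. An even \<open>n > 2\<close> adds no prime to \<open>n - 1\<close>.
  For \<open>n = 2 * m + 1\<close> the primes from \<open>m + 2\<close> to \<open>n\<close> all
  divide \<open>n choose m\<close>, which is at most \<open>4 ^ m\<close> because it occurs twice in
  a row of sum \<open>2 * 4 ^ m\<close>.\<close>

lemma primorial_le: "(\<Prod>p | prime p \<and> p \<le> n. p) \<le> (4::nat) ^ n"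
proof (induction n rule: less_induct)
  case (less n)
  have fin: "finite {p. prime p \<and> p \<le> m}" for m :: nat
    by (rule finite_subset[of _ "{..m}"]) auto
  consider "n = 0" | "n = 1" | "n = 2" | "n > 2" "even n" | "n > 2" "odd n" by linarith
  then show ?case
  proof cases
    case 1
    then have "{p. prime p \<and> p \<le> n} = {}" by (auto dest: prime_gt_0_nat)
    then show ?thesis by (simp only: prod.empty) simp
  next
    case 2
    then have "{p. prime p \<and> p \<le> n} = {}" by (auto dest: prime_gt_1_nat)
    then show ?thesis by (simp only: prod.empty) simp
  next
    case 3
    have "p = 2" if "prime p" "p \<le> 2" for p :: nat
      using prime_gt_1_nat[OF that(1)] that by linarith
    then have "{p. prime p \<and> p \<le> n} = {2}" using 3 by auto
    then show ?thesis using 3 by simp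
  next
    case 4
    then have "\<not> prime n" using primes_dvd_imp_eq two_is_prime_nat by blast
    then have "p \<le> n - 1" if "prime p" "p \<le> n" for p
      using that by (cases "p = n") auto
    then have "{p. prime p \<and> p \<le> n} = {p. prime p \<and> p \<le> n - 1}" by auto
    then have "(\<Prod>p | prime p \<and> p \<le> n. p) \<le> 4 ^ (n - 1)" using less.IH[of "n-1"] 4 by simp
    also have "\<dots> \<le> 4 ^ n" by (rule power_increasing) auto
    finally show ?thesis .
  next
    case 5
    then obtain m where m: "n = 2 * m + 1" "m \<ge> 1" by (auto elim!: oddE)
    let ?A = "{p. prime p \<and> p \<le> m + 1}" and ?B = "{p. prime p \<and> m + 1 < p \<and> p \<le> n}"
    have AB: "{p. prime p \<and> p \<le> n} = ?A \<union> ?B" using m by auto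
    have finB: "finite ?B" by (rule finite_subset[OF _ fin[of n]]) auto
    have dv: "p dvd (n choose m)" if "p \<in> ?B" for p
    proof -
      have "fact m * fact (n - m) * (n choose m) = (fact n :: nat)"
        using m by (intro binomial_fact_lemma) auto
      moreover have "p dvd (fact n :: nat)" using that by (simp add: prime_dvd_fact_iff)
      moreover have "\<not> p dvd fact m" "\<not> p dvd fact (n - m)"
        using that m by (auto simp: prime_dvd_fact_iff simp del: fact_Suc)
      ultimately show ?thesis using that
        by (metis (no_types, lifting) mem_Collect_eq prime_dvd_mult_iff)
    qed
    have "\<Prod>?B \<le> (n choose m)"
      by (rule dvd_imp_le[OF prod_primes_dvd]) (use finB dv m in auto)
    also have "\<dots> \<le> 4 ^ m"
    proof -
      have "(n choose m) + (n choose (m + 1)) = (\<Sum>k\<in>{m, m+1}. n choose k)" by simp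
      also have "\<dots> \<le> (\<Sum>k\<le>n. n choose k)" using m by (intro sum_mono2) auto
      also have "\<dots> = 2 * 4 ^ m" unfolding choose_row_sum by (simp add: m power_mult)
      finally show ?thesis using binomial_symmetric[of m n] m by simp
    qed
    finally have B: "\<Prod>?B \<le> 4 ^ m" .
    have "(\<Prod>p | prime p \<and> p \<le> n. p) = \<Prod>?A * \<Prod>?B"
      unfolding AB by (rule prod.union_disjoint) (use fin finB in auto)
    also have "\<dots> \<le> 4 ^ (m + 1) * 4 ^ m" using less.IH[of "m+1"] m B by (intro mult_mono) auto
    also have "\<dots> = 4 ^ n" by (simp add: m power_add[symmetric] mult_2)
    finally show ?thesis .
  qed
qed

lemma choose_mult_dvd_common_multiple:
  fixes W :: nat
  assumes "\<And>m. 1 \<le> m \<Longrightarrow> m \<le> n \<Longrightarrow> m dvd W" "W > 0" "1 \<le> k" "k \<le> n"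
  shows "k * (n choose k) dvd W"
  using assms(1,3,4)
proof (induction "n - k" arbitrary: k n)
  case 0
  then show ?case by simp
next
  case (Suc j)
  text \<open>Leibniz's triangle: \<open>1 / (k * C(n,k)) = 1 / (k * C(n-1,k)) - 1 / ((k+1) * C(n,k+1))\<close>\<close>
  have a: "k * ((n - 1) choose k) dvd W" using Suc.prems Suc.hyps(2) by (intro Suc.hyps(1)) auto
  have b: "(k + 1) * (n choose (k + 1)) dvd W" using Suc.prems Suc.hyps(2) by (intro Suc.hyps(1)) auto
  obtain u where u: "W = k * ((n - 1) choose k) * u" using a by blast
  obtain v where v: "W = (k + 1) * (n choose (k + 1)) * v" using b by blast
  obtain N where N: "n = Suc N" "k \<le> N" using Suc.prems Suc.hyps(2) by (cases n) auto
  have c1: "(k + 1) * (n choose (k + 1)) = (n - k) * (n choose k)"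
    using binomial_absorb_comp[of n k] times_binomial_minus1_eq[of "k+1" n] N by simp
  have c2: "n * ((n - 1) choose k) = (n - k) * (n choose k)"
    using binomial_absorb_comp[of n k] N by simp
  \<comment> \<open>Multiplied by \<open>W\<close>, the identity of Leibniz's triangle reads
    \<open>W / (k * C(n,k)) = u - v\<close>. It is cleared of denominators and proved over the
    integers, where subtraction does not truncate.\<close>
  have "int W * (int u - int v) * (int k * int (n choose k)) = int W * int W"
  proof -
    have e1: "int W * int n = int u * int k * int ((n - k) * (n choose k))"
      unfolding c2[symmetric] by (subst (1) u) (simp add: algebra_simps)
    have e2: "int W = int v * int ((n - k) * (n choose k))"
      unfolding c1[symmetric] by (subst (1) v) (simp add: algebra_simps)
    have nz: "int (n - k) \<noteq> 0" using N by simp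
    have nk: "int (n - k) = int n - int k" using N by simp
    have "int (n - k) * ((int u - int v) * (int k * int (n choose k)))
       = int u * int k * int ((n - k) * (n choose k)) - int k * (int v * int ((n - k) * (n choose k)))"
      by (simp only: of_nat_mult left_diff_distrib right_diff_distrib mult_ac)
    also have "\<dots> = int (n - k) * int W" unfolding e1[symmetric] e2[symmetric] nk by (simp add: algebra_simps)
    finally have "(int u - int v) * (int k * int (n choose k)) = int W"
      using nz by (simp only: mult_cancel_left) auto
    then show ?thesis by (simp only: mult.assoc)
  qed
  then have "(int u - int v) * (int k * int (n choose k)) = int W" using \<open>W > 0\<close> by simp
  then have "int (k * (n choose k)) dvd int W" by (metis dvd_triv_right of_nat_mult)
  then show ?case by (simp only: int_dvd_int_iff)
qed

text \<open>Nair's lower bound for the least common multiple: \<open>n * C(n-1,k)\<close> equals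
  \<open>(k+1) * C(n,k+1)\<close>, hence is at most \<open>W\<close>, and the sum over
  \<open>k\<close> compares \<open>n * 2 ^ (n-1)\<close> with \<open>n * W\<close>.\<close>

lemma common_multiple_ge:
  fixes W :: nat
  assumes "\<And>m. 1 \<le> m \<Longrightarrow> m \<le> n \<Longrightarrow> m dvd W" "W > 0" "n \<ge> 1"
  shows "2 ^ (n - 1) \<le> W"
proof -
  obtain N where N: "n = Suc N" using assms by (cases n) auto
  have "n * (N choose k) \<le> W" if "k \<le> N" for k
  proof -
    have "Suc k * (n choose Suc k) dvd W"
      by (rule choose_mult_dvd_common_multiple) (use assms N that in auto)
    moreover have "Suc k * (n choose Suc k) = n * (N choose k)"
      using Suc_times_binomial_eq[of N k] N by simp
    ultimately show ?thesis using \<open>W > 0\<close> by (metis dvd_imp_le)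
  qed
  then have "(\<Sum>k\<le>N. n * (N choose k)) \<le> (\<Sum>k\<le>N. W)" by (intro sum_mono) auto
  then have "n * 2 ^ N \<le> n * W"
    using N unfolding sum_distrib_left[symmetric] choose_row_sum by (simp del: mult_Suc)
  then show ?thesis using N by (simp del: mult_Suc)
qed

text \<open>The least common multiple \<open>W\<close> of \<open>1, ..., N\<close> is a product of
  prime powers. Primes up to \<open>sqrt N\<close> contribute at most \<open>N\<close> each. A
  larger prime has exponent one, and without primes between \<open>x\<close> and \<open>N\<close> it
  is at most \<open>x\<close>, so the primorial bound takes care of these.\<close>

lemma prime_gap_ineq:
  assumes "x \<ge> 1" "\<And>p. prime p \<Longrightarrow> x < p \<Longrightarrow> \<not> p \<le> N" "N \<ge> x"
  shows "2 ^ (N - 1) \<le> real N powr sqrt (real N) * 4 ^ x"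
proof -
  define P where "P = {p. prime p \<and> p \<le> N}"
  define ex where "ex p = (GREATEST e. p ^ e \<le> N)" for p :: nat
  define W where "W = (\<Prod>p\<in>P. p ^ ex p)"
  have finP: "finite P" unfolding P_def by (rule finite_subset[of _ "{..N}"]) auto
  have bd: "e \<le> N" if "p ^ e \<le> N" "p \<in> P" for e p
  proof -
    have "p \<ge> 2" using that by (simp add: P_def prime_ge_2_nat)
    then have "e < p ^ e" using less_exp[of e] power_mono[of 2 p e] by linarith
    then show ?thesis using that by simp
  qed
  have ex1: "p ^ ex p \<le> N" if "p \<in> P" for p
    unfolding ex_def by (rule GreatestI_nat[of _ 0 N]) (use bd that assms in auto)
  have ex2: "e \<le> ex p" if "p ^ e \<le> N" "p \<in> P" for e p
    unfolding ex_def by (rule Greatest_le_nat[of _ _ N]) (use bd that in auto)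
  have Wpos: "W > 0" unfolding W_def P_def by (auto intro!: prod_pos simp: prime_gt_0_nat)
  have "m dvd W" if m: "1 \<le> m" "m \<le> N" for m
  proof (rule multiplicity_le_imp_dvd)
    show "m \<noteq> 0" using m by simp
    fix p :: nat assume p: "prime p"
    show "multiplicity p m \<le> multiplicity p W"
    proof (cases "p dvd m")
      case True
      then have pP: "p \<in> P" using p m dvd_imp_le[of p m] by (auto simp: P_def)
      have "p ^ multiplicity p m \<le> N" using dvd_imp_le[OF multiplicity_dvd[of p m]] m by simp
      then have "multiplicity p m \<le> ex p" using ex2 pP by blast
      also have "ex p = multiplicity p W"
        unfolding W_def using finP pP p
        by (subst multiplicity_prod_prime_powers) (auto simp: P_def)
      finally show ?thesis .
    qed (simp add: not_dvd_imp_multiplicity_0)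
  qed
  then have low: "2 ^ (N - 1) \<le> W" using Wpos assms by (intro common_multiple_ge) auto
  define A where "A = {p \<in> P. p ^ 2 \<le> N}"
  have PA: "P = A \<union> (P - A)" by (auto simp: A_def)
  have finA: "finite A" using finP by (simp add: A_def)
  have "card A \<le> card {1..floor_sqrt N}"
    by (intro card_mono) (auto simp: A_def P_def prime_gt_0_nat Suc_leI le_floor_sqrt_iff)
  then have "real (card A) \<le> sqrt (real N)"
    using floor_sqrt_power2_le[of N] real_le_rsqrt
    by (smt (verit, best) card_atLeastAtMost diff_Suc_1 numeral_nat(7) of_nat_mono of_nat_power)
  have "real (\<Prod>p\<in>A. p ^ ex p) \<le> real (N ^ card A)"
    using ex1 assms by (subst of_nat_le_iff, intro prod_le_power) (auto simp: A_def)
  also have "\<dots> = real N powr real (card A)" using assms by (simp add: powr_realpow)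
  also have "\<dots> \<le> real N powr sqrt (real N)" using assms \<open>real (card A) \<le> _\<close> by (intro powr_mono) auto
  finally have b1: "real (\<Prod>p\<in>A. p ^ ex p) \<le> real N powr sqrt (real N)" .
  have "(\<Prod>p\<in>P - A. p ^ ex p) \<le> (\<Prod>p\<in>P - A. p)"
  proof (intro prod_mono conjI)
    fix p assume p: "p \<in> P - A"
    then have "p \<ge> 2" by (simp add: P_def prime_ge_2_nat)
    have "ex p \<le> 1"
    proof (rule ccontr)
      assume "\<not> ex p \<le> 1"
      then have "p ^ 2 \<le> p ^ ex p" using \<open>p \<ge> 2\<close> by (intro power_increasing) auto
      then show False using p ex1[of p] by (auto simp: A_def)
    qed
    then have "p ^ ex p \<le> p ^ 1" using \<open>p \<ge> 2\<close> by (intro power_increasing) auto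
    then show "p ^ ex p \<le> p" by simp
  qed auto
  also have "\<dots> \<le> (\<Prod>p | prime p \<and> p \<le> x. p)"
  proof (rule dvd_imp_le[OF prod_dvd_prod_subset])
    show "finite {p. prime p \<and> p \<le> x}" by (rule finite_subset[of _ "{..x}"]) auto
    show "P - A \<subseteq> {p. prime p \<and> p \<le> x}" using assms(2) by (auto simp: P_def not_less[symmetric])
    show "(\<Prod>p | prime p \<and> p \<le> x. p) > 0" by (auto intro!: prod_pos simp: prime_gt_0_nat)
  qed
  also have "\<dots> \<le> 4 ^ x" by (rule primorial_le)
  finally have b2: "real (\<Prod>p\<in>P - A. p ^ ex p) \<le> 4 ^ x" by (metis of_nat_le_iff of_nat_numeral of_nat_power)
  have "W = (\<Prod>p\<in>A. p ^ ex p) * (\<Prod>p\<in>P - A. p ^ ex p)"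
    unfolding W_def by (subst PA, rule prod.union_disjoint) (use finA finP in auto)
  then have "real W \<le> real N powr sqrt (real N) * 4 ^ x"
    using b1 b2 by (simp only: of_nat_mult) (intro mult_mono, auto intro!: prod_nonneg)
  then show ?thesis using low by (metis of_nat_le_iff of_nat_numeral of_nat_power order_trans)
qed

text \<open>A weak form of Bertrand's postulate. For \<open>N = 4 * x\<close> with \<open>x\<close>
  large the preceding inequality fails, as \<open>2 ^ (4 * x - 1)\<close> outgrows
  \<open>4 ^ x\<close> times a subexponential factor. One prime \<open>P\<close> above the threshold
  \<open>x0\<close> serves all smaller \<open>x\<close>. The result keeps the modulus
  \<open>q\<close> within a constant factor of the size required of it.\<close>

lemma exists_prime_linear_gap:
  "\<exists>C\<ge>1. \<forall>x\<ge>1. \<exists>p. prime p \<and> x < p \<and> p \<le> C * (x :: nat)"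
proof -
  have "eventually (\<lambda>x::nat. 2 ^ (4 * x - 1) > real (4 * x) powr sqrt (real (4 * x)) * 4 ^ x) sequentially"
  proof -
    have "eventually (\<lambda>y::real. 2 powr (4 * y - 1) > (4 * y) powr sqrt (4 * y) * 4 powr y) at_top"
    proof -
      have "eventually (\<lambda>y::real. (2 * y - 1) * ln 2 > sqrt (4 * y) * ln (4 * y)) at_top"
        by real_asymp
      then show ?thesis using eventually_gt_at_top[of 0]
      proof eventually_elim
        case (elim y)
        have "ln 4 = 2 * ln (2 :: real)" using ln_realpow[of "2 :: real" 2] by simp
        with elim show ?case by (simp add: powr_def exp_add[symmetric] algebra_simps)
      qed
    qed
    then have "eventually (\<lambda>x::nat. 2 powr (4 * real x - 1) > (4 * real x) powr sqrt (4 * real x) * 4 powr real x) sequentially"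
      by (rule eventually_compose_filterlim[OF _ filterlim_real_sequentially])
    then show ?thesis using eventually_ge_at_top[of 1]
      by eventually_elim (simp add: powr_realpow[symmetric] of_nat_diff)
  qed
  then obtain x0 where x0: "\<And>x. x \<ge> x0 \<Longrightarrow> 2 ^ (4 * x - 1) > real (4 * x) powr sqrt (real (4 * x)) * 4 ^ x"
    by (auto simp: eventually_sequentially)
  obtain P where P: "prime P" "P > x0" using bigger_prime by blast
  have "\<exists>p. prime p \<and> x < p \<and> p \<le> (P + 4) * x" if "x \<ge> 1" for x
  proof (cases "x \<ge> x0")
    case True
    then have "\<not> 2 ^ (4 * x - 1) \<le> real (4 * x) powr sqrt (real (4 * x)) * 4 ^ x"
      using x0 by (meson not_less)
    then have "\<not> (\<forall>p. prime p \<longrightarrow> x < p \<longrightarrow> \<not> p \<le> 4 * x)"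
      using prime_gap_ineq[of x "4 * x"] that by auto
    then obtain p where "prime p" "x < p" "p \<le> 4 * x" by blast
    then show ?thesis by (auto simp: algebra_simps intro!: exI[of _ p])
  next
    case False
    have "P * 1 \<le> (P + 4) * x" using that by (intro mult_mono) auto
    then show ?thesis using P False by (intro exI[of _ P]) auto
  qed
  then show ?thesis by (intro exI[of _ "P + 4"]) auto
qed

section \<open>Polynomials modulo a prime\<close>

lemma const_dvd_poly_eval:
  assumes "[:c:] dvd p" shows "c dvd poly p (y :: int)"
  using assms by (auto elim!: dvdE)

lemma prime_elem_const: "prime q \<Longrightarrow> prime_elem [:int q:]"
  by (simp add: prime_elem_const_poly_iff)

lemma prime_const_not_dvd_monic_power: 
  assumes "prime q" shows "\<not> [:int q:] dvd [:- y, 1:] ^ k"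
proof
  assume "[:int q:] dvd [:- y, 1:] ^ k"
  then have "[:int q:] dvd [:- y, 1:]" using prime_elem_const[OF assms] prime_elem_dvd_power by blast
  then have "int q dvd coeff [:- y, 1:] 1" unfolding const_poly_dvd_iff by blast
  then show False using assms using prime_gt_1_nat[of q] by simp
qed

text \<open>Lagrange's bound over the field with \<open>q\<close> elements. Polynomials over that
  field are represented by integer ones, and \<open>[:int q:] dvd h\<close> expresses that
  \<open>h\<close> is zero there. A root splits off a linear factor up to a constant divisible by
  \<open>q\<close>; as \<open>q\<close> is prime, every other root is one of the quotient.\<close>

lemma card_roots_mod_prime_le:
  fixes h :: "int poly"
  assumes "prime q" "\<not> [:int q:] dvd h"
  shows "card {y \<in> {0..<q}. int q dvd poly h (int y)} \<le> degree h"
  using assms(2)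
proof (induction "degree h" arbitrary: h rule: less_induct)
  case (less h)
  let ?R = "\<lambda>h. {y \<in> {0..<q}. int q dvd poly h (int y)}"
  show ?case
  proof (cases "?R h = {}")
    case True
    then show ?thesis by (simp only: card.empty)
  next
    case False
    then obtain y where y: "y < q" "int q dvd poly h (int y)" by auto
    define s where "s = synthetic_div h (int y)"
    have h: "h = [:- int y, 1:] * s + [:poly h (int y):]"
      unfolding s_def by (simp only: synthetic_div_correct')
    have nd: "\<not> [:int q:] dvd s"
    proof
      assume "[:int q:] dvd s"
      moreover have "[:int q:] dvd [:poly h (int y):]" using y by (simp add: const_poly_dvd_const_poly_iff)
      ultimately have "[:int q:] dvd [:- int y, 1:] * s + [:poly h (int y):]" by (intro dvd_add dvd_mult)
      then show False using h less.prems by simp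
    qed
    have dpos: "degree h > 0"
    proof (rule ccontr)
      assume "\<not> degree h > 0"
      then have "s = 0" by (simp add: s_def synthetic_div_eq_0_iff)
      then show False using nd by simp
    qed
    have ds: "degree s = degree h - 1" unfolding s_def by (rule degree_synthetic_div)
    have "?R h \<subseteq> insert y (?R s)"
    proof
      fix z assume z: "z \<in> ?R h"
      have "int q dvd (int z - int y) * poly s (int z)"
      proof -
        have "poly h (int z) = (int z - int y) * poly s (int z) + poly h (int y)"
          by (subst (1) h) (simp add: algebra_simps)
        then show ?thesis using z y by (simp add: dvd_add_left_iff)
      qed
      then have "int q dvd int z - int y \<or> int q dvd poly s (int z)"
        using assms by (simp add: prime_dvd_mult_iff)
      then show "z \<in> insert y (?R s)"
      proof
        assume "int q dvd int z - int y"
        then have "int z mod int q = int y mod int q" by (simp add: mod_eq_dvd_iff)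
        then show ?thesis using z y by simp
      qed (use z in auto)
    qed
    then have "card (?R h) \<le> card (insert y (?R s))" by (intro card_mono) auto
    also have "\<dots> \<le> Suc (card (?R s))" by (rule card_insert_le_m1) auto
    also have "\<dots> \<le> Suc (degree s)" using less.hyps[of s] nd ds dpos by simp
    finally show ?thesis using ds dpos by simp
  qed
qed

text \<open>\<open>e\<close> is the exact order of the root \<open>y\<close> modulo
  \<open>q\<close>, possibly 0. The bound by the degree later yields \<open>e < q\<close>, so that
  the factors \<open>e - l\<close> produced by differentiation stay invertible.\<close>

lemma poly_mod_prime_factor_root:
  fixes h :: "int poly"
  assumes "prime q" "\<not> [:int q:] dvd h"
  obtains e u w where "h = [:- y, 1:] ^ e * u + [:int q:] * w" "\<not> int q dvd poly u y" "e \<le> degree h"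
  using assms(2)
proof (induction "degree h" arbitrary: h thesis rule: less_induct)
  case (less h)
  show ?case
  proof (cases "int q dvd poly h y")
    case False
    show ?thesis by (rule less.prems(1)[of 0 h 0]) (use False in auto)
  next
    case True
    define s where "s = synthetic_div h y"
    obtain c where c: "poly h y = int q * c" using True by blast
    have h: "h = [:- y, 1:] * s + [:int q:] * [:c:]"
    proof -
      have "[:int q:] * [:c:] = [:poly h y:]" by (simp add: c)
      then show ?thesis unfolding s_def by (simp only: synthetic_div_correct')
    qed
    have nd: "\<not> [:int q:] dvd s"
    proof
      assume "[:int q:] dvd s"
      then have "[:int q:] dvd [:- y, 1:] * s + [:int q:] * [:c:]" by (intro dvd_add[OF dvd_mult dvd_triv_left])
      then show False using h less.prems by simp
    qed
    have dpos: "degree h > 0"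
    proof (rule ccontr)
      assume "\<not> degree h > 0"
      then have "s = 0" by (simp add: s_def synthetic_div_eq_0_iff)
      then show False using nd by simp
    qed
    have ds: "degree s = degree h - 1" unfolding s_def by (rule degree_synthetic_div)
    obtain e u w where euw: "s = [:- y, 1:] ^ e * u + [:int q:] * w" "\<not> int q dvd poly u y" "e \<le> degree s"
      using less.hyps[of s] ds dpos nd by auto
    show ?thesis
    proof (rule less.prems(1)[of "Suc e" u "[:- y, 1:] * w + [:c:]"])
      show "h = [:- y, 1:] ^ Suc e * u + [:int q:] * ([:- y, 1:] * w + [:c:])"
        by (subst h, subst euw(1)) (simp only: power_Suc ring_distribs mult_ac add_ac)
      show "Suc e \<le> degree h" using euw ds dpos by simp
    qed (use euw in auto)
  qed
qed

section \<open>The Euler operator and its effect on the order of a root\<close>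

definition euler_op :: "int poly \<Rightarrow> int poly" where
  "euler_op p = [:0, 1:] * pderiv p"

lemma euler_op_add: "euler_op (p + p') = euler_op p + euler_op p'"
  by (simp add: euler_op_def pderiv_add ring_distribs del: mult_pCons_left)

lemma euler_op_diff: "euler_op (p - p') = euler_op p - euler_op p'"
  by (simp add: euler_op_def pderiv_diff ring_distribs del: mult_pCons_left)

lemma euler_op_const_mult: "euler_op ([:c:] * p) = [:c:] * euler_op p"
  by (simp add: euler_op_def pderiv_smult)

lemma euler_op_pow_add: "(euler_op ^^ v) (p + p') = (euler_op ^^ v) p + (euler_op ^^ v) p'"
  by (induction v) (simp_all add: euler_op_add)

lemma euler_op_pow_diff: "(euler_op ^^ v) (p - p') = (euler_op ^^ v) p - (euler_op ^^ v) p'"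
  by (induction v) (simp_all add: euler_op_diff)

lemma euler_op_pow_const_mult: "(euler_op ^^ v) ([:c:] * p) = [:c:] * (euler_op ^^ v) p"
  by (induction v) (simp_all only: funpow.simps comp_def id_def euler_op_const_mult)

lemma degree_euler_op: "degree (euler_op p) \<le> degree p"
proof (cases "degree p = 0")
  case True
  then have "pderiv p = 0" by (simp add: pderiv_eq_0_iff)
  then show ?thesis by (simp add: euler_op_def)
next
  case False
  have "degree (euler_op p) \<le> degree [:0, 1::int:] + degree (pderiv p)"
    unfolding euler_op_def by (rule degree_mult_le)
  then show ?thesis using False by (simp add: degree_pderiv)
qed

lemma degree_euler_op_pow: "degree ((euler_op ^^ v) p) \<le> degree p"
  by (induction v) (auto intro: order_trans[OF degree_euler_op])

text \<open>The advantage over the plain derivative: every monomial is an eigenvector, with its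
  exponent as eigenvalue, so hash values are weighted power sums which the machine evaluates
  directly.\<close>

lemma coeff_euler_op_pow: "coeff ((euler_op ^^ v) p) j = int j ^ v * coeff p j"
  by (induction v) (auto simp: euler_op_def coeff_pCons coeff_pderiv split: nat.splits)

text \<open>One application to \<open>(X - y) ^ k * u'\<close> lowers the order by one and
  multiplies the value of the cofactor at \<open>y\<close> by \<open>k * y\<close>; in the induction
  \<open>k = e - v\<close>.\<close>

lemma euler_op_pow_root_power:
  assumes "v \<le> e"
  shows "\<exists>u'. (euler_op ^^ v) ([:- y, 1:] ^ e * u) = [:- y, 1:] ^ (e - v) * u' \<and>
     poly u' y = (\<Prod>l<v. int (e - l)) * y ^ v * poly u y"
  using assms
proof (induction v)
  case 0
  then show ?case by (intro exI[of _ u]) simp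
next
  case (Suc v)
  then obtain u' where u': "(euler_op ^^ v) ([:- y, 1:] ^ e * u) = [:- y, 1:] ^ (e - v) * u'"
     "poly u' y = (\<Prod>l<v. int (e - l)) * y ^ v * poly u y" by auto
  obtain k where k: "e - v = Suc k" using Suc.prems by (cases "e - v") auto
  have "pderiv ([:- y, 1:] ^ Suc k * u') = [:- y, 1:] ^ k * ([:of_nat (Suc k):] * u' + [:- y, 1:] * pderiv u')"
    unfolding pderiv_mult pderiv_power_Suc
    by (simp add: pderiv_pCons algebra_simps)
  then have "euler_op ([:- y, 1:] ^ Suc k * u') = [:- y, 1:] ^ k * ([:0, 1:] * ([:of_nat (Suc k):] * u' + [:- y, 1:] * pderiv u'))"
    unfolding euler_op_def by (simp only: mult_ac)
  moreover have "e - Suc v = k" using k by simp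
  moreover have "poly ([:0, 1:] * ([:of_nat (Suc k):] * u' + [:- y, 1:] * pderiv u')) y
      = (\<Prod>l<Suc v. int (e - l)) * y ^ Suc v * poly u y"
    using u'(2) k by (simp del: of_nat_diff)
  ultimately show ?case using u'(1) k
    by (intro exI[of _ "[:0, 1:] * ([:of_nat (Suc k):] * u' + [:- y, 1:] * pderiv u')"])
      (simp del: mult_pCons_left)
qed

section \<open>Congruence modulo the ideal of two elements, and first-order Taylor expansion\<close>

definition congr_ideal :: "'a::comm_ring_1 \<Rightarrow> 'a \<Rightarrow> 'a \<Rightarrow> 'a \<Rightarrow> bool" where
  "congr_ideal a b x y \<longleftrightarrow> (\<exists>U W. x - y = a * U + b * W)"

lemma congr_ideal_refl: "congr_ideal a b x x"
  unfolding congr_ideal_def by (intro exI[of _ 0]) simp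

lemma congr_ideal_trans: "congr_ideal a b x y \<Longrightarrow> congr_ideal a b y z \<Longrightarrow> congr_ideal a b x z"
proof -
  assume "congr_ideal a b x y" "congr_ideal a b y z"
  then obtain U W U' W' where "x - y = a * U + b * W" "y - z = a * U' + b * W'"
    by (auto simp: congr_ideal_def)
  then have "x - z = a * (U + U') + b * (W + W')" by (simp add: algebra_simps)
  then show ?thesis unfolding congr_ideal_def by blast
qed

lemma congr_ideal_add:
  "congr_ideal a b x y \<Longrightarrow> congr_ideal a b x' y' \<Longrightarrow> congr_ideal a b (x + x') (y + y')"
proof -
  assume "congr_ideal a b x y" "congr_ideal a b x' y'"
  then obtain U W U' W' where "x - y = a * U + b * W" "x' - y' = a * U' + b * W'"
    by (auto simp: congr_ideal_def)
  then have "(x + x') - (y + y') = a * (U + U') + b * (W + W')" by (simp add: algebra_simps)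
  then show ?thesis unfolding congr_ideal_def by blast
qed

lemma congr_ideal_mult:
  "congr_ideal a b x y \<Longrightarrow> congr_ideal a b x' y' \<Longrightarrow> congr_ideal a b (x * x') (y * y')"
proof -
  assume "congr_ideal a b x y" "congr_ideal a b x' y'"
  then obtain U W U' W' where *: "x - y = a * U + b * W" "x' - y' = a * U' + b * W'"
    by (auto simp: congr_ideal_def)
  have "x * x' - y * y' = (x - y) * x' + y * (x' - y')" by (simp add: algebra_simps)
  also have "\<dots> = a * (U * x' + y * U') + b * (W * x' + y * W')" unfolding * by (simp add: algebra_simps)
  finally show ?thesis unfolding congr_ideal_def by blast
qed

lemma congr_ideal_power: "congr_ideal a b x y \<Longrightarrow> congr_ideal a b (x ^ n) (y ^ n)"
  by (induction n) (auto intro: congr_ideal_refl congr_ideal_mult)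

lemma congr_ideal_sum:
  "(\<And>i. i \<in> A \<Longrightarrow> congr_ideal a b (f i) (g i)) \<Longrightarrow> congr_ideal a b (sum f A) (sum g A)"
  by (induction A rule: infinite_finite_induct) (auto intro: congr_ideal_refl congr_ideal_add)

lemma congr_ideal_prod:
  "(\<And>i. i \<in> A \<Longrightarrow> congr_ideal a b (f i) (g i)) \<Longrightarrow> congr_ideal a b (prod f A) (prod g A)"
  by (induction A rule: infinite_finite_induct) (auto intro: congr_ideal_refl congr_ideal_mult)

text \<open>Of the binomial expansion only the terms of order at most one in \<open>\<delta>\<close>
  survive. At \<open>n = 0\<close> the truncated \<open>n - 1\<close> does no harm, its factor
  \<open>of_nat n\<close> being zero.\<close>

lemma congr_ideal_taylor_power:
  assumes "congr_ideal a b (\<delta> * \<delta>) 0"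
  shows "congr_ideal a b ((w + \<delta>) ^ n) (w ^ n + \<delta> * (of_nat n * w ^ (n - 1)))"
proof (induction n)
  case 0
  then show ?case by (simp add: congr_ideal_refl)
next
  case (Suc n)
  have "congr_ideal a b ((w + \<delta>) ^ Suc n) ((w + \<delta>) * (w ^ n + \<delta> * (of_nat n * w ^ (n - 1))))"
    using congr_ideal_mult[OF congr_ideal_refl Suc] by simp
  also have "(w + \<delta>) * (w ^ n + \<delta> * (of_nat n * w ^ (n - 1)))
     = (w ^ Suc n + \<delta> * (of_nat (Suc n) * w ^ (Suc n - 1))) + (\<delta> * \<delta>) * (of_nat n * w ^ (n - 1))"
    by (cases n) (simp_all add: algebra_simps)
  finally have 1: "congr_ideal a b ((w + \<delta>) ^ Suc n) \<dots>" .
  have "congr_ideal a b ((w ^ Suc n + \<delta> * (of_nat (Suc n) * w ^ (Suc n - 1))) + (\<delta> * \<delta>) * (of_nat n * w ^ (n - 1)))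
     ((w ^ Suc n + \<delta> * (of_nat (Suc n) * w ^ (Suc n - 1))) + 0 * (of_nat n * w ^ (n - 1)))"
    by (intro congr_ideal_add congr_ideal_mult assms congr_ideal_refl)
  then show ?case using 1 congr_ideal_trans by fastforce
qed

text \<open>
  A polynomial in \<open>X, Y\<^sub>1, \<dots>, Y\<^sub>r\<close> is a coefficient function on exponent vectors; index \<open>0\<close> is
  the variable \<open>X\<close>.
\<close>

definition exp_box :: "nat \<Rightarrow> nat \<Rightarrow> nat \<Rightarrow> (nat \<Rightarrow> nat) set" where
  "exp_box a d r = (\<Pi>\<^sub>E i\<in>{..r}. {..<if i = 0 then a else d})"

definition mv_eval :: "(nat \<Rightarrow> nat) set \<Rightarrow> nat \<Rightarrow> ((nat \<Rightarrow> nat) \<Rightarrow> int) \<Rightarrow> (nat \<Rightarrow> 'a::comm_ring_1) \<Rightarrow> 'a" where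
  "mv_eval E r c z = (\<Sum>e\<in>E. of_int (c e) * (\<Prod>i\<le>r. z i ^ e i))"

text \<open>The formal partial derivative by variable \<open>v\<close>. An exponent vector pushed
  out of \<open>E\<close> counts as having coefficient zero, so the derivative lives on the same
  box.\<close>

definition mv_deriv :: "(nat \<Rightarrow> nat) set \<Rightarrow> nat \<Rightarrow> ((nat \<Rightarrow> nat) \<Rightarrow> int) \<Rightarrow> (nat \<Rightarrow> nat) \<Rightarrow> int" where
  "mv_deriv E v c e = (if e(v := Suc (e v)) \<in> E then int (Suc (e v)) * c (e(v := Suc (e v))) else 0)"

lemma finite_exp_box: "finite (exp_box a d r)"
  unfolding exp_box_def by (intro finite_PiE) auto

lemma card_exp_box: "card (exp_box a d r) = a * d ^ r"
proof -
  have "card (exp_box a d r) = (\<Prod>i\<le>r. if i = 0 then a else d)"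
    unfolding exp_box_def by (subst card_PiE) (auto intro!: prod.cong)
  also have "\<dots> = a * d ^ r" by (subst prod.atMost_shift) simp
  finally show ?thesis .
qed

lemma exp_box_lower:
  assumes "e \<in> exp_box a d r" "v \<le> r" "k \<le> e v"
  shows "e(v := k) \<in> exp_box a d r"
proof -
  have e: "\<And>i. i \<le> r \<Longrightarrow> e i < (if i = 0 then a else d)" "e \<in> extensional {..r}"
    using assms by (auto simp: exp_box_def PiE_iff simp del: if_split)
  have "(e(v := k)) i < (if i = 0 then a else d)" if "i \<le> r" for i
    using e(1)[OF that] assms(3) by (cases "i = v") auto
  then show ?thesis using e(2) assms(2) by (simp add: exp_box_def PiE_iff extensional_def)
qed

lemma mv_eval_deriv:
  assumes "v \<le> r"
  shows "mv_eval (exp_box a d r) r (mv_deriv (exp_box a d r) v c) w =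
    (\<Sum>e\<in>exp_box a d r. of_int (c e) * (of_nat (e v) * w v ^ (e v - 1) * (\<Prod>i\<in>{..r} - {v}. w i ^ e i)))"
proof -
  let ?E = "exp_box a d r"
  have "(\<Sum>e\<in>?E. of_int (c e) * (of_nat (e v) * w v ^ (e v - 1) * (\<Prod>i\<in>{..r} - {v}. w i ^ e i)))
    = (\<Sum>e\<in>{e\<in>?E. e v \<noteq> 0}. of_int (c e) * (of_nat (e v) * w v ^ (e v - 1) * (\<Prod>i\<in>{..r} - {v}. w i ^ e i)))"
    by (rule sum.mono_neutral_right) (auto simp: finite_exp_box)
  also have "\<dots> = (\<Sum>e\<in>{e\<in>?E. e(v := Suc (e v)) \<in> ?E}. of_int (mv_deriv ?E v c e) * (\<Prod>i\<le>r. w i ^ e i))"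
  proof (rule sum.reindex_bij_witness[of _ "\<lambda>e. e(v := Suc (e v))" "\<lambda>e. e(v := e v - 1)"])
    fix e assume e: "e \<in> {e\<in>?E. e v \<noteq> 0}"
    have pr: "(\<Prod>i\<le>r. w i ^ (e(v := e v - 1)) i) = w v ^ (e v - 1) * (\<Prod>i\<in>{..r} - {v}. w i ^ e i)"
      using assms by (subst prod.remove[of _ v]) auto
    have "(e(v := e v - 1))(v := Suc ((e(v := e v - 1)) v)) = e" using e by auto
    then have dd: "mv_deriv ?E v c (e(v := e v - 1)) = int (e v) * c e"
      using e unfolding mv_deriv_def by simp
    show "of_int (mv_deriv ?E v c (e(v := e v - 1))) * (\<Prod>i\<le>r. w i ^ (e(v := e v - 1)) i) =
      of_int (c e) * (of_nat (e v) * w v ^ (e v - 1) * (\<Prod>i\<in>{..r} - {v}. w i ^ e i))"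
      unfolding dd pr by (simp add: mult_ac)
  qed (use exp_box_lower assms in \<open>auto\<close>)
  also have "\<dots> = mv_eval ?E r (mv_deriv ?E v c) w"
    unfolding mv_eval_def by (rule sum.mono_neutral_left) (auto simp: finite_exp_box mv_deriv_def)
  finally show ?thesis ..
qed

text \<open>Variables below \<open>v\<close> agree modulo the ideal, and those above
  \<open>v\<close> occur only with coefficients divisible by \<open>q\<close>. So passing from
  \<open>w\<close> to \<open>z\<close> changes in effect the variable \<open>v\<close> alone, by a
  \<open>\<delta>\<close> whose square vanishes.\<close>

lemma mv_eval_taylor:
  fixes z w :: "nat \<Rightarrow> int poly"
  assumes v: "v \<le> r"
    and lo: "\<And>i. i < v \<Longrightarrow> congr_ideal [:q:] P (z i) (w i)"
    and at: "z v = w v + \<delta>" "congr_ideal [:q:] P (\<delta> * \<delta>) 0"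
    and hi: "\<And>e i. e \<in> exp_box a d r \<Longrightarrow> v < i \<Longrightarrow> i \<le> r \<Longrightarrow> e i \<noteq> 0 \<Longrightarrow> q dvd c e"
  shows "congr_ideal [:q:] P (mv_eval (exp_box a d r) r c z)
     (mv_eval (exp_box a d r) r c w + \<delta> * mv_eval (exp_box a d r) r (mv_deriv (exp_box a d r) v c) w)"
proof -
  let ?E = "exp_box a d r"
  let ?d = "\<lambda>e. of_nat (e v) * w v ^ (e v - 1) * (\<Prod>i\<in>{..r} - {v}. w i ^ e i)"
  have "congr_ideal [:q:] P (\<Sum>e\<in>?E. of_int (c e) * (\<Prod>i\<le>r. z i ^ e i))
     (\<Sum>e\<in>?E. of_int (c e) * ((\<Prod>i\<le>r. w i ^ e i) + \<delta> * ?d e))"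
  proof (rule congr_ideal_sum)
    fix e assume e: "e \<in> ?E"
    show "congr_ideal [:q:] P (of_int (c e) * (\<Prod>i\<le>r. z i ^ e i))
        (of_int (c e) * ((\<Prod>i\<le>r. w i ^ e i) + \<delta> * ?d e))"
    proof (cases "q dvd c e")
      case True
      then obtain k where "c e = q * k" by blast
      then have "of_int (c e) = [:q:] * [:k:]" by (simp add: of_int_poly)
      then have "of_int (c e) * (\<Prod>i\<le>r. z i ^ e i) - of_int (c e) * ((\<Prod>i\<le>r. w i ^ e i) + \<delta> * ?d e)
        = [:q:] * ([:k:] * ((\<Prod>i\<le>r. z i ^ e i) - ((\<Prod>i\<le>r. w i ^ e i) + \<delta> * ?d e))) + P * 0"
        by (simp only: right_diff_distrib mult_ac mult_zero_left mult_zero_right add_0_right)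
      then show ?thesis unfolding congr_ideal_def by blast
    next
      case False
      have "congr_ideal [:q:] P (z v ^ e v * (\<Prod>i\<in>{..r} - {v}. z i ^ e i))
         ((w v ^ e v + \<delta> * (of_nat (e v) * w v ^ (e v - 1))) * (\<Prod>i\<in>{..r} - {v}. w i ^ e i))"
        unfolding at(1)
      proof (intro congr_ideal_mult congr_ideal_taylor_power at(2) congr_ideal_prod)
        fix i assume i: "i \<in> {..r} - {v}"
        show "congr_ideal [:q:] P (z i ^ e i) (w i ^ e i)"
        proof (cases "i < v")
          case True
          then show ?thesis by (intro congr_ideal_power lo)
        next
          case False
          then have "e i = 0" using hi[OF e, of i] i \<open>\<not> q dvd c e\<close> by auto
          then show ?thesis by (simp add: congr_ideal_refl)
        qed
      qed
      moreover have "(\<Prod>i\<le>r. y i ^ e i) = y v ^ e v * (\<Prod>i\<in>{..r} - {v}. y i ^ e i)" for y :: "nat \<Rightarrow> int poly"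
        using v by (subst prod.remove[of _ v]) auto
      ultimately have "congr_ideal [:q:] P (\<Prod>i\<le>r. z i ^ e i) ((\<Prod>i\<le>r. w i ^ e i) + \<delta> * ?d e)"
        by (simp only: ring_distribs mult_ac)
      then show ?thesis by (intro congr_ideal_mult congr_ideal_refl)
    qed
  qed
  also have "(\<Sum>e\<in>?E. of_int (c e) * ((\<Prod>i\<le>r. w i ^ e i) + \<delta> * ?d e))
     = mv_eval ?E r c w + \<delta> * mv_eval ?E r (mv_deriv ?E v c) w"
    unfolding mv_eval_deriv[OF v] unfolding mv_eval_def
    by (simp only: ring_distribs sum.distrib sum_distrib_left mult_ac)
  finally show ?thesis unfolding mv_eval_def .
qed

section \<open>Expansion of multiplicity codes\<close>

text \<open>Index 0 carries \<open>X\<close>, so index \<open>j >= 1\<close> is the Euler derivative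
  of order \<open>j - 1\<close>. Substituting these coordinates turns a polynomial \<open>Q\<close>
  into a differential expression in \<open>f\<close>.\<close>

definition mult_coords :: "int poly \<Rightarrow> nat \<Rightarrow> int poly" where
  "mult_coords f j = (if j = 0 then [:0, 1:] else (euler_op ^^ (j - 1)) f)"

text \<open>\<open>restrict\<close> fixes the values beyond index \<open>r\<close>, so that points
  are equal as functions as soon as their coordinates agree, and sets of points can be
  counted.\<close>

definition mult_point :: "nat \<Rightarrow> nat \<Rightarrow> int poly \<Rightarrow> nat \<Rightarrow> nat \<Rightarrow> int" where
  "mult_point q r f y = restrict (\<lambda>j. poly (mult_coords f j) (int y) mod int q) {..r}"

lemma poly_mv_eval: "poly (mv_eval E r c z) y = mv_eval E r c (\<lambda>i. poly (z i) y)"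
  by (simp add: mv_eval_def poly_sum poly_prod)

lemma mv_eval_dvd_cong:
  fixes z w :: "nat \<Rightarrow> int"
  assumes "\<And>i. i \<le> r \<Longrightarrow> q dvd z i - w i"
  shows "q dvd mv_eval E r c z - mv_eval E r c w"
proof -
  have "congr_ideal q 0 (mv_eval E r c z) (mv_eval E r c w)"
    unfolding mv_eval_def
    by (intro congr_ideal_sum congr_ideal_mult congr_ideal_prod congr_ideal_power congr_ideal_refl)
      (use assms in \<open>auto simp: congr_ideal_def dvd_def\<close>)
  then show ?thesis by (auto simp: congr_ideal_def)
qed

text \<open>\<open>X\<close> contributes at most \<open>a - 1\<close> and each of the
  \<open>r\<close> other variables at most \<open>(d - 1) * D\<close>, because Euler derivatives do
  not raise degrees. This is how many of the \<open>q - 1\<close> points the expansion may lose per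
  polynomial.\<close>

lemma degree_mv_eval_mult_coords:
  assumes "degree f \<le> D"
  shows "degree (mv_eval (exp_box a d r) r c (mult_coords f)) \<le> (a - 1) + r * ((d - 1) * D)"
  unfolding mv_eval_def
proof (rule degree_sum_le[OF finite_exp_box])
  fix e assume e: "e \<in> exp_box a d r"
  have e0: "e 0 \<le> a - 1" and ei: "\<And>i. 1 \<le> i \<Longrightarrow> i \<le> r \<Longrightarrow> e i \<le> d - 1"
  proof -
    have "\<And>i. i \<le> r \<Longrightarrow> e i < (if i = 0 then a else d)" using e by (auto simp: exp_box_def PiE_iff simp del: if_split)
    then show "e 0 \<le> a - 1" and "\<And>i. 1 \<le> i \<Longrightarrow> i \<le> r \<Longrightarrow> e i \<le> d - 1" by fastforce+
  qed
  have "degree (of_int (c e) * (\<Prod>i\<le>r. mult_coords f i ^ e i)) \<le> degree (of_int (c e) :: int poly) + degree (\<Prod>i\<le>r. mult_coords f i ^ e i)"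
    by (rule degree_mult_le)
  also have "\<dots> = degree (\<Prod>i\<le>r. mult_coords f i ^ e i)" by (simp add: of_int_poly)
  also have "\<dots> \<le> (\<Sum>i\<le>r. degree (mult_coords f i ^ e i))"
    using degree_prod_sum_le[of "{..r}" "\<lambda>i. mult_coords f i ^ e i"] by (simp add: o_def)
  also have "\<dots> \<le> (\<Sum>i\<le>r. if i = 0 then a - 1 else (d - 1) * D)"
  proof (rule sum_mono)
    fix i assume i: "i \<in> {..r}"
    show "degree (mult_coords f i ^ e i) \<le> (if i = 0 then a - 1 else (d - 1) * D)"
    proof (cases "i = 0")
      case True
      then show ?thesis using e0 degree_power_le[of "mult_coords f 0" "e 0"] by (simp add: mult_coords_def)
    next
      case False
      have "degree (mult_coords f i ^ e i) \<le> degree (mult_coords f i) * e i" by (rule degree_power_le)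
      also have "\<dots> \<le> D * (d - 1)"
        using False i ei[of i] order_trans[OF degree_euler_op_pow assms]
        by (intro mult_mono) (auto simp: mult_coords_def)
      finally show ?thesis using False by (simp add: mult.commute)
    qed
  qed
  also have "\<dots> = (a - 1) + r * ((d - 1) * D)" by (subst sum.atMost_shift) simp
  finally show "degree (of_int (c e) * (\<Prod>i\<le>r. mult_coords f i ^ e i)) \<le> (a - 1) + r * ((d - 1) * D)" .
qed

text \<open>
  If \<open>f \<noteq> g\<close>, let \<open>e\<close> be the order of \<open>f - g\<close> at \<open>y\<close>. The first \<open>v\<close> Euler derivatives of \<open>f - g\<close> vanish
  at \<open>y\<close> to the exact orders \<open>e, e - 1, \<dots>, e - v + 1\<close>, so modulo \<open>(X - y) ^ (e - v + 2)\<close> the first-order Taylor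
  expansion of \<open>Q\<close> around the point of \<open>g\<close> has only the term of \<open>Y\<^sub>v\<close>, which does not vanish.
\<close>

lemma solution_determined_by_point:
  fixes f g :: "int poly"
  assumes q: "prime q" and v: "1 \<le> v" "v \<le> r" and y: "\<not> int q dvd y"
    and deg: "degree (f - g) < q"
    and hi: "\<And>e i. e \<in> exp_box a d r \<Longrightarrow> v < i \<Longrightarrow> i \<le> r \<Longrightarrow> e i \<noteq> 0 \<Longrightarrow> int q dvd c e"
    and Qf: "[:int q:] dvd mv_eval (exp_box a d r) r c (mult_coords f)"
    and Qg: "[:int q:] dvd mv_eval (exp_box a d r) r c (mult_coords g)"
    and pt: "\<And>j. j \<le> v \<Longrightarrow> int q dvd poly (mult_coords f j) y - poly (mult_coords g j) y"
    and nz: "\<not> int q dvd poly (mv_eval (exp_box a d r) r (mv_deriv (exp_box a d r) v c) (mult_coords g)) y"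
  shows "[:int q:] dvd f - g"
proof (rule ccontr)
  assume "\<not> [:int q:] dvd f - g"
  then obtain e u w where euw: "f - g = [:- y, 1:] ^ e * u + [:int q:] * w"
    "\<not> int q dvd poly u y" "e \<le> degree (f - g)"
    using poly_mod_prime_factor_root[OF q] by metis
  define pi where "pi = [:- y, 1:]"
  define D where "D = mv_eval (exp_box a d r) r (mv_deriv (exp_box a d r) v c) (mult_coords g)"
  have piy: "poly pi y = 0" by (simp add: pi_def)
  \<comment> \<open>The factors \<open>e - l\<close> lie between 1 and \<open>e < q\<close>, and
    \<open>y\<close> is nonzero modulo \<open>q\<close>; so the cofactors of all Euler derivatives
    up to order \<open>e\<close> are nonzero at \<open>y\<close>.\<close>
  have nzu: "\<not> int q dvd (\<Prod>l<j. int (e - l)) * y ^ j * poly u y" if "j \<le> e" for j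
  proof -
    have "\<not> int q dvd (\<Prod>l<j. int (e - l))"
    proof
      assume "int q dvd (\<Prod>l<j. int (e - l))"
      then obtain l where "l < j" "int q dvd int (e - l)"
        using q by (auto simp: prime_dvd_prod_iff)
      then show False using that euw(3) deg by (auto dest!: zdvd_imp_le)
    qed
    then show ?thesis using q y euw(2) by (simp add: prime_dvd_mult_iff prime_dvd_power_iff)
         (metis prime_dvd_power prime_nat_int_transfer)
  qed
  have ex: "\<exists>u' w'. mult_coords f j - mult_coords g j = pi ^ (e - (j - 1)) * u' + [:int q:] * w' \<and>
      poly u' y = (\<Prod>l<j - 1. int (e - l)) * y ^ (j - 1) * poly u y" if j: "1 \<le> j" "j - 1 \<le> e" for j
  proof -
    obtain u' where "(euler_op ^^ (j - 1)) (pi ^ e * u) = pi ^ (e - (j - 1)) * u'"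
       "poly u' y = (\<Prod>l<j - 1. int (e - l)) * y ^ (j - 1) * poly u y"
      using euler_op_pow_root_power[OF j(2)] unfolding pi_def by blast
    moreover have "mult_coords f j - mult_coords g j = (euler_op ^^ (j - 1)) (f - g)"
      using j by (simp add: mult_coords_def euler_op_pow_diff)
    ultimately show ?thesis
      unfolding euw(1) euler_op_pow_add euler_op_pow_const_mult pi_def by auto
  qed
  \<comment> \<open>Otherwise coordinate \<open>Suc e\<close> is among the first \<open>v\<close>,
    and there the difference has no root at \<open>y\<close> left, against the agreement of the
    points.\<close>
  have ev: "v \<le> e"
  proof (rule ccontr)
    assume "\<not> v \<le> e"
    then have j: "Suc e \<le> v" by simp
    obtain u' w' where *: "mult_coords f (Suc e) - mult_coords g (Suc e) = u' + [:int q:] * w'"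
      "poly u' y = (\<Prod>l<e. int (e - l)) * y ^ e * poly u y"
      using ex[of "Suc e"] by auto
    have "poly (mult_coords f (Suc e)) y - poly (mult_coords g (Suc e)) y = poly u' y + int q * poly w' y"
      using arg_cong[OF *(1), of "\<lambda>p. poly p y"] by simp
    then have "int q dvd poly u' y" using pt[OF j] by (metis dvd_add_left_iff dvd_triv_left)
    then show False using nzu[of e] *(2) by simp
  qed
  define t where "t = e - (v - 1)"
  have t: "t \<ge> 1" using ev v by (simp add: t_def)
  define \<delta> where "\<delta> = mult_coords f v - mult_coords g v"
  obtain u' w' where u': "\<delta> = pi ^ t * u' + [:int q:] * w'"
    "poly u' y = (\<Prod>l<v - 1. int (e - l)) * y ^ (v - 1) * poly u y"
  proof -
    have "v - 1 \<le> e" using ev by simp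
    then show ?thesis using ex[OF v(1)] that unfolding \<delta>_def t_def by blast
  qed
  let ?cg = "congr_ideal [:int q:] (pi ^ Suc t)"
  \<comment> \<open>\<open>t >= 1\<close> gives \<open>t + t >= Suc t\<close>, so the square of
    \<open>\<delta>\<close> is negligible.\<close>
  have dd: "?cg (\<delta> * \<delta>) 0"
  proof -
    obtain k where k: "t + t = Suc t + k" using t by (metis add_Suc le_Suc_ex plus_1_eq_Suc add.assoc add.commute)
    have "pi ^ t * pi ^ t = pi ^ Suc t * pi ^ k" by (simp only: power_add[symmetric] k)
    then have "\<delta> * \<delta> - 0 = [:int q:] * (w' * \<delta> + pi ^ t * u' * w') + pi ^ Suc t * (pi ^ k * u' * u')"
      unfolding u'(1) by (simp add: algebra_simps del: mult_pCons_left mult_pCons_right power_Suc)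
    then show ?thesis unfolding congr_ideal_def by blast
  qed
  have "?cg (mv_eval (exp_box a d r) r c (mult_coords f)) (mv_eval (exp_box a d r) r c (mult_coords g) + \<delta> * D)"
    unfolding D_def
  proof (rule mv_eval_taylor[OF v(2) _ _ dd hi])
    fix i assume i: "i < v"
    show "?cg (mult_coords f i) (mult_coords g i)"
    proof (cases "i = 0")
      case True
      then show ?thesis by (simp add: mult_coords_def congr_ideal_refl)
    next
      case False
      then obtain u1 w1 where *: "mult_coords f i - mult_coords g i = pi ^ (e - (i - 1)) * u1 + [:int q:] * w1"
      proof -
        have "1 \<le> i" "i - 1 \<le> e" using False i ev by auto
        then show ?thesis using ex[of i] that by blast
      qed
      have "Suc t \<le> e - (i - 1)" using i ev False unfolding t_def by linarith
      then obtain k where "e - (i - 1) = Suc t + k" using le_Suc_ex by blast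
      then have "mult_coords f i - mult_coords g i = [:int q:] * w1 + pi ^ Suc t * (pi ^ k * u1)"
        using * by (simp only: power_add mult_ac add_ac)
      then show ?thesis unfolding congr_ideal_def by blast
    qed
  qed (simp add: \<delta>_def)
  then obtain U W where UW: "mv_eval (exp_box a d r) r c (mult_coords f) - (mv_eval (exp_box a d r) r c (mult_coords g) + \<delta> * D)
     = [:int q:] * U + pi ^ Suc t * W" by (auto simp: congr_ideal_def)
  obtain A B where AB: "mv_eval (exp_box a d r) r c (mult_coords f) = [:int q:] * A" "mv_eval (exp_box a d r) r c (mult_coords g) = [:int q:] * B"
    using Qf Qg by (auto elim!: dvdE)
  \<comment> \<open>Both substituted polynomials vanish modulo \<open>q\<close>, which leaves a
    multiple of \<open>pi ^ t\<close>. This power cancels since \<open>[:int q:]\<close> is a prime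
    element, and evaluation at the root \<open>y\<close> of \<open>pi\<close> isolates
    \<open>u' * D\<close>.\<close>
  have "pi ^ t * (u' * D + pi * W) = [:int q:] * (A - B - U - w' * D)"
    using UW unfolding AB u'(1) by (simp add: algebra_simps del: mult_pCons_left mult_pCons_right)
  then have "[:int q:] dvd pi ^ t * (u' * D + pi * W)" by (metis dvd_triv_left)
  then have "[:int q:] dvd u' * D + pi * W"
    using prime_elem_dvd_multD[OF prime_elem_const[OF q]] prime_const_not_dvd_monic_power[OF q]
    unfolding pi_def by blast
  then have "int q dvd poly (u' * D + pi * W) y" by (rule const_dvd_poly_eval)
  then have "int q dvd poly u' y * poly D y" by (simp add: piy)
  then have "int q dvd poly u' y \<or> int q dvd poly D y" using q by (simp add: prime_dvd_mult_iff)
  moreover have "\<not> int q dvd poly u' y" unfolding u'(2) by (rule nzu) (use ev in simp)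
  ultimately show False using nz unfolding D_def by blast
qed

lemma mult_point_eqD:
  assumes "mult_point q r f y = mult_point q r g z" "j \<le> r"
  shows "int q dvd poly (mult_coords f j) (int y) - poly (mult_coords g j) (int z)"
  using fun_cong[OF assms(1), of j] assms(2) by (simp add: mult_point_def mod_eq_dvd_iff)

lemma mult_point_eq_imp_eq:
  assumes "mult_point q r f y = mult_point q r g z" "y < q" "z < q"
  shows "y = z"
  using fun_cong[OF assms(1), of 0] assms(2,3) by (simp add: mult_point_def mult_coords_def)

text \<open>Vanishing of a substituted polynomial at a place depends on the bucket alone. This will
  separate the buckets of the two classes in the induction.\<close>

lemma mult_point_mv_eval_dvd:
  assumes "mult_point q r f y = mult_point q r g z"
  shows "int q dvd poly (mv_eval E r c (mult_coords f)) (int y) \<longleftrightarrow> int q dvd poly (mv_eval E r c (mult_coords g)) (int z)"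
proof -
  have "int q dvd mv_eval E r c (\<lambda>i. poly (mult_coords f i) (int y)) - mv_eval E r c (\<lambda>i. poly (mult_coords g i) (int z))"
    by (rule mv_eval_dvd_cong) (rule mult_point_eqD[OF assms])
  then show ?thesis unfolding poly_mv_eval by (meson dvd_diff_right_iff dvd_diff_left_iff dvd_diff_commute)
qed

lemma card_nonroots_ge:
  assumes "prime q" "\<not> [:int q:] dvd h" "degree h \<le> D"
  shows "q - 1 - D \<le> card {y \<in> {1..<q}. \<not> int q dvd poly h (int y)}"
proof -
  have "{1..<q} = {y \<in> {1..<q}. \<not> int q dvd poly h (int y)} \<union> {y \<in> {1..<q}. int q dvd poly h (int y)}" by auto
  then have "card {1..<q} \<le> card {y \<in> {1..<q}. \<not> int q dvd poly h (int y)} + card {y \<in> {1..<q}. int q dvd poly h (int y)}"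
    by (metis card_Un_le)
  also have "card {y \<in> {1..<q}. int q dvd poly h (int y)} \<le> card {y \<in> {0..<q}. int q dvd poly h (int y)}"
    by (rule card_mono) auto
  also have "\<dots> \<le> D" using card_roots_mod_prime_le[OF assms(1,2)] assms(3) by simp
  finally show ?thesis by simp
qed

text \<open>Strong induction on a bound \<open>N\<close> for the degree in the variables other than
  \<open>X\<close>, where only coefficients nonzero modulo \<open>q\<close> count. With
  \<open>v\<close> the last variable that occurs, \<open>F1\<close> collects the members of
  \<open>F\<close> at which the \<open>v\<close>-derivative is not identically zero; they own their
  buckets at its nonroots. The others, \<open>F2\<close>, solve the equation of the derivative,
  whose degree is smaller.\<close>

lemma card_mult_points_ge:
  fixes f :: "'i \<Rightarrow> int poly"
  assumes q: "prime q" and D: "D < q" and d: "d \<le> q"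
    and "finite F" and "\<And>i. i \<in> F \<Longrightarrow> degree (f i) \<le> D"
    and "\<And>i j. i \<in> F \<Longrightarrow> j \<in> F \<Longrightarrow> [:int q:] dvd f i - f j \<Longrightarrow> i = j"
    and "\<And>i. i \<in> F \<Longrightarrow> [:int q:] dvd mv_eval (exp_box a d r) r c (mult_coords (f i))"
    and "e0 \<in> exp_box a d r" "\<not> int q dvd c e0"
    and "\<And>e. e \<in> exp_box a d r \<Longrightarrow> \<not> int q dvd c e \<Longrightarrow> (\<Sum>i=1..r. e i) \<le> N"
  shows "card F * (q - 1 - ((a - 1) + r * ((d - 1) * D))) \<le> card (\<Union>i\<in>F. mult_point q r (f i) ` {1..<q})"
  using assms(4-)
proof (induction N arbitrary: c F e0 rule: less_induct)
  case (less N c F e0)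
  let ?E = "exp_box a d r"
  let ?G = "\<lambda>F. \<Union>i\<in>F. mult_point q r (f i) ` {1..<q}"
  let ?D = "(a - 1) + r * ((d - 1) * D)"
  define V where "V = {i \<in> {1..r}. \<exists>e\<in>?E. \<not> int q dvd c e \<and> e i \<noteq> 0}"
  show ?case
  proof (cases "V = {}")
    case True
    \<comment> \<open>Only \<open>X\<close> occurs, so substitution of \<open>f i\<close> leaves a
      polynomial with the coefficient \<open>c e0\<close>, which \<open>q\<close> does not divide.
      No \<open>f i\<close> can satisfy the equation.\<close>
    have "F = {}"
    proof (rule ccontr)
      assume "F \<noteq> {}"
      then obtain i where i: "i \<in> F" by blast
      have zero: "e j = 0" if "e \<in> ?E" "\<not> int q dvd c e" "1 \<le> j" "j \<le> r" for e j
        using True that unfolding V_def by (metis (mono_tags, lifting) atLeastAtMost_iff empty_iff mem_Collect_eq)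
      have mono: "(\<Prod>j\<le>r. mult_coords (f i) j ^ e j) = monom 1 (e 0)" if "e \<in> ?E" "\<not> int q dvd c e" for e
      proof -
        have "(\<Prod>j\<le>r. mult_coords (f i) j ^ e j) = mult_coords (f i) 0 ^ e 0 * (\<Prod>j\<in>{..r}-{0}. mult_coords (f i) j ^ e j)"
          by (subst prod.remove[of _ 0]) auto
        also have "(\<Prod>j\<in>{..r}-{0}. mult_coords (f i) j ^ e j) = 1"
          by (rule prod.neutral) (use zero[OF that] in auto)
        finally show ?thesis by (simp add: mult_coords_def monom_altdef)
      qed
      have "coeff (mv_eval ?E r c (mult_coords (f i))) (e0 0)
        = (\<Sum>e\<in>?E. c e * coeff (\<Prod>j\<le>r. mult_coords (f i) j ^ e j) (e0 0))"
        unfolding mv_eval_def by (simp add: coeff_sum of_int_poly)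
      also have "\<dots> = c e0 * coeff (\<Prod>j\<le>r. mult_coords (f i) j ^ e0 j) (e0 0)
         + (\<Sum>e\<in>?E - {e0}. c e * coeff (\<Prod>j\<le>r. mult_coords (f i) j ^ e j) (e0 0))"
        using less.prems(5) by (subst sum.remove[of _ e0]) (auto simp: finite_exp_box)
      also have "c e0 * coeff (\<Prod>j\<le>r. mult_coords (f i) j ^ e0 j) (e0 0) = c e0"
        using mono[OF less.prems(5,6)] by simp
      finally have co: "coeff (mv_eval ?E r c (mult_coords (f i))) (e0 0) = c e0
        + (\<Sum>e\<in>?E - {e0}. c e * coeff (\<Prod>j\<le>r. mult_coords (f i) j ^ e j) (e0 0))" .
      have "int q dvd (\<Sum>e\<in>?E - {e0}. c e * coeff (\<Prod>j\<le>r. mult_coords (f i) j ^ e j) (e0 0))"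
      proof (rule dvd_sum)
        fix e assume e: "e \<in> ?E - {e0}"
        show "int q dvd c e * coeff (\<Prod>j\<le>r. mult_coords (f i) j ^ e j) (e0 0)"
        proof (cases "int q dvd c e")
          case False
          have "e 0 \<noteq> e0 0"
          proof
            assume "e 0 = e0 0"
            then have "e j = e0 j" if "j \<in> {..r}" for j
              using zero[of e j] zero[of e0 j] False e less.prems(5,6) that by (cases "j = 0") auto
            then have "e = e0" using e less.prems(5) unfolding exp_box_def by (intro PiE_ext) auto
            then show False using e by simp
          qed
          then show ?thesis using mono[of e] False e by simp
        qed simp
      qed
      moreover have "int q dvd coeff (mv_eval ?E r c (mult_coords (f i))) (e0 0)"
        using less.prems(4)[OF i] by (simp add: const_poly_dvd_iff)
      ultimately have "int q dvd c e0" unfolding co by (simp add: dvd_add_left_iff)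
      then show False using less.prems(6) by simp
    qed
    then show ?thesis by simp
  next
    case False
    define v where "v = Max V"
    have finV: "finite V" by (simp add: V_def)
    have vV: "v \<in> V" unfolding v_def using finV False by (rule Max_in)
    then have v: "1 \<le> v" "v \<le> r" by (auto simp: V_def)
    have hi: "int q dvd c e" if "e \<in> ?E" "v < i" "i \<le> r" "e i \<noteq> 0" for e i
    proof (rule ccontr)
      assume "\<not> int q dvd c e"
      then have "i \<in> V" using that v by (auto simp: V_def)
      then have "i \<le> v" unfolding v_def using finV by simp
      then show False using that by simp
    qed
    obtain e1 where e1: "e1 \<in> ?E" "\<not> int q dvd c e1" "e1 v \<noteq> 0" using vV by (auto simp: V_def)
    define c' where "c' = mv_deriv ?E v c"
    define e2 where "e2 = e1(v := e1 v - 1)"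
    have e2: "e2 \<in> ?E" unfolding e2_def using e1 v by (intro exp_box_lower) auto
    have up: "e2(v := Suc (e2 v)) = e1" using e1 by (auto simp: e2_def)
    have "c' e2 = int (e1 v) * c e1"
      unfolding c'_def mv_deriv_def up using e1 by (simp add: e2_def)
    \<comment> \<open>Exponents in the box are below \<open>d\<close>, hence below \<open>q\<close>.
      So the factor \<open>e1 v\<close> brought down by differentiation is invertible and the
      derivative stays nonzero modulo \<open>q\<close>.\<close>
    moreover have "e1 v < q"
      using e1 v d by (auto simp: exp_box_def PiE_iff dest!: bspec[of _ _ v])
    then have "\<not> int q dvd int (e1 v)" using e1(3) by (auto dest!: zdvd_imp_le)
    ultimately have e2': "\<not> int q dvd c' e2" using q e1(2) by (simp add: prime_dvd_mult_iff)
    have sum_upd: "(\<Sum>i=1..r. (e(v := Suc (e v))) i) = Suc (\<Sum>i=1..r. e i)" for e :: "nat \<Rightarrow> nat"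
      using v by (simp add: sum.remove[of _ v])
    have Npos: "N > 0"
      using less.prems(7)[OF e1(1,2)] sum_upd[of e2] up by simp
    have bound': "(\<Sum>i=1..r. e i) \<le> N - 1" if "e \<in> ?E" "\<not> int q dvd c' e" for e
    proof -
      have "e(v := Suc (e v)) \<in> ?E" "\<not> int q dvd c (e(v := Suc (e v)))"
        using that by (auto simp: c'_def mv_deriv_def split: if_splits)
      then have "(\<Sum>i=1..r. (e(v := Suc (e v))) i) \<le> N" by (rule less.prems(7))
      then show ?thesis unfolding sum_upd by simp
    qed
    let ?h = "\<lambda>i. mv_eval ?E r c' (mult_coords (f i))"
    define F2 where "F2 = {i \<in> F. [:int q:] dvd ?h i}"
    define F1 where "F1 = F - F2"
    have F12: "F = F1 \<union> F2" "F1 \<inter> F2 = {}" "finite F1" "finite F2"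
      using less.prems(1) by (auto simp: F1_def F2_def)
    have IH: "card F2 * (q - 1 - ?D) \<le> card (?G F2)"
      by (rule less.IH[of "N - 1" F2 c' e2])
        (use Npos less.prems(1-3) e2 e2' bound' in \<open>auto simp: F2_def\<close>)
    define Y where "Y i = {y \<in> {1..<q}. \<not> int q dvd poly (?h i) (int y)}" for i
    have Ycard: "q - 1 - ?D \<le> card (Y i)" if "i \<in> F1" for i
      unfolding Y_def using that less.prems(2)
      by (intro card_nonroots_ge[OF q] degree_mv_eval_mult_coords) (auto simp: F1_def F2_def)
    \<comment> \<open>Equal points have the same \<open>y\<close>, and at a nonroot of the
      derivative the point determines the polynomial.\<close>
    have inj: "inj_on (\<lambda>(i, y). mult_point q r (f i) y) (Sigma F1 Y)"
    proof (rule inj_onI, clarify)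
      fix i y j z assume a: "i \<in> F1" "y \<in> Y i" "j \<in> F1" "z \<in> Y j"
        and eq: "mult_point q r (f i) y = mult_point q r (f j) z"
      have yz: "y = z" using mult_point_eq_imp_eq[OF eq] a by (auto simp: Y_def)
      have iF: "i \<in> F" "j \<in> F" using a by (auto simp: F1_def)
      have "[:int q:] dvd f i - f j"
      proof (rule solution_determined_by_point[OF q v, of "int z"])
        show "\<not> int q dvd int z" using a by (auto simp: Y_def dest!: zdvd_imp_le)
        have "degree (f i - f j) \<le> D" using less.prems(2) iF by (intro degree_diff_le) auto
        then show "degree (f i - f j) < q" using D by simp
        show "int q dvd poly (mult_coords (f i) l) (int z) - poly (mult_coords (f j) l) (int z)" if "l \<le> v" for l
          using mult_point_eqD[OF eq, of l] that v yz by simp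
        show "\<not> int q dvd poly (mv_eval ?E r (mv_deriv ?E v c) (mult_coords (f j))) (int z)"
          using a by (simp add: Y_def c'_def)
      qed (use hi less.prems(4) iF in auto)
      then show "i = j \<and> y = z" using less.prems(3) iF yz by simp
    qed
    define A where "A = (\<lambda>(i, y). mult_point q r (f i) y) ` Sigma F1 Y"
    have finY: "finite (Y i)" for i by (simp add: Y_def)
    have "card F1 * (q - 1 - ?D) = (\<Sum>i\<in>F1. q - 1 - ?D)" by simp
    also have "\<dots> \<le> (\<Sum>i\<in>F1. card (Y i))" by (rule sum_mono) (rule Ycard)
    also have "\<dots> = card (Sigma F1 Y)" using F12 finY by (simp add: card_SigmaI)
    also have "\<dots> = card A" unfolding A_def using inj by (simp add: card_image)
    finally have A: "card F1 * (q - 1 - ?D) \<le> card A" .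
    \<comment> \<open>The derivative vanishes at every bucket of \<open>F2\<close> and at no bucket
      counted in \<open>A\<close>.\<close>
    have disj: "A \<inter> ?G F2 = {}"
    proof (rule ccontr)
      assume "A \<inter> ?G F2 \<noteq> {}"
      then obtain i y j z where a: "i \<in> F1" "y \<in> Y i" "j \<in> F2" "z \<in> {1..<q}"
        "mult_point q r (f i) y = mult_point q r (f j) z" unfolding A_def by fastforce
      have "int q dvd poly (?h j) (int z)" using a(3) by (auto simp: F2_def intro: const_dvd_poly_eval)
      then have "int q dvd poly (?h i) (int y)" using mult_point_mv_eval_dvd[OF a(5)] by blast
      then show False using a(2) by (simp add: Y_def)
    qed
    have "A \<union> ?G F2 \<subseteq> ?G F" unfolding A_def using F12(1) by (auto simp: Y_def)
    moreover have "finite (?G F)" using less.prems(1) by auto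
    moreover have "finite A" "finite (?G F2)" unfolding A_def using F12 finY by auto
    ultimately have "card A + card (?G F2) \<le> card (?G F)"
      using card_Un_disjoint[OF _ _ disj] card_mono[of "?G F" "A \<union> ?G F2"] by simp
    moreover have "card F = card F1 + card F2" using F12 by (simp add: card_Un_disjoint)
    ultimately show ?thesis using A IH by (simp add: add_mult_distrib)
  qed
qed

text \<open>The polynomial for the induction comes from the pigeonhole principle: with fewer than
  \<open>a * d ^ r\<close> points there are more coefficient vectors than vectors of values, so two
  coefficient vectors agree on all points and their difference vanishes there.\<close>

lemma multiplicity_code_expansion:
  fixes f :: "'i \<Rightarrow> int poly"
  assumes q: "prime q" and D: "D < q" and d: "d \<le> q"
    and F: "finite F" "\<And>i. i \<in> F \<Longrightarrow> degree (f i) \<le> D"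
      "\<And>i j. i \<in> F \<Longrightarrow> j \<in> F \<Longrightarrow> [:int q:] dvd f i - f j \<Longrightarrow> i = j"
    and small: "(a - 1) + r * ((d - 1) * D) < q - 1"
    and card: "card (\<Union>i\<in>F. mult_point q r (f i) ` {1..<q}) < a * d ^ r"
  shows "card F * (q - 1 - ((a - 1) + r * ((d - 1) * D))) \<le> card (\<Union>i\<in>F. mult_point q r (f i) ` {1..<q})"
proof -
  let ?E = "exp_box a d r"
  define G where "G = (\<Union>i\<in>F. mult_point q r (f i) ` {1..<q})"
  have finG: "finite G" using F by (auto simp: G_def)
  have q1: "q > 1" using q by (rule prime_gt_1_nat)
  let ?S = "?E \<rightarrow>\<^sub>E {0..<int q}" and ?T = "G \<rightarrow>\<^sub>E {0..<int q}"
  define \<Phi> where "\<Phi> c = restrict (\<lambda>p. mv_eval ?E r c p mod int q) G" for c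
  have "card G < a * d ^ r" using card unfolding G_def .
  then have "card ?T < card ?S"
    using finG finite_exp_box q1 by (simp add: card_PiE card_exp_box power_strict_increasing)
  moreover have "\<Phi> ` ?S \<subseteq> ?T" using q1 by (auto simp: \<Phi>_def)
  moreover have "finite ?T" using finG by (intro finite_PiE) auto
  ultimately have "\<not> inj_on \<Phi> ?S" using card_inj_on_le[of \<Phi> ?S ?T] by linarith
  then obtain c1 c2 where c12: "c1 \<in> ?S" "c2 \<in> ?S" "c1 \<noteq> c2" "\<Phi> c1 = \<Phi> c2" by (auto simp: inj_on_def)
  obtain e0 where e0: "e0 \<in> ?E" "c1 e0 \<noteq> c2 e0" using c12 by (meson PiE_ext)
  define c where "c e = c1 e - c2 e" for e
  have nz: "\<not> int q dvd c e0"
  proof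
    assume "int q dvd c e0"
    then have "c1 e0 mod int q = c2 e0 mod int q" by (simp add: c_def mod_eq_dvd_iff)
    then show False using c12(1,2) e0 by (auto simp: PiE_iff)
  qed
  have lin: "mv_eval ?E r c p = mv_eval ?E r c1 p - mv_eval ?E r c2 p" for p :: "nat \<Rightarrow> int"
    by (simp add: mv_eval_def c_def left_diff_distrib sum_subtractf)
  \<comment> \<open>The substituted polynomial has degree below \<open>q - 1\<close> but vanishes at
    all of \<open>1, ..., q - 1\<close>.\<close>
  have vanish: "[:int q:] dvd mv_eval ?E r c (mult_coords (f i))" if "i \<in> F" for i
  proof (rule ccontr)
    let ?h = "mv_eval ?E r c (mult_coords (f i))"
    assume "\<not> [:int q:] dvd ?h"
    then have "q - 1 - ((a - 1) + r * ((d - 1) * D)) \<le> card {y \<in> {1..<q}. \<not> int q dvd poly ?h (int y)}"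
      by (intro card_nonroots_ge[OF q] degree_mv_eval_mult_coords F that)
    also have "{y \<in> {1..<q}. \<not> int q dvd poly ?h (int y)} = {}"
    proof -
      have "int q dvd poly ?h (int y)" if y: "y \<in> {1..<q}" for y
      proof -
        let ?p = "mult_point q r (f i) y"
        have "?p \<in> G" using \<open>i \<in> F\<close> y unfolding G_def by blast
        then have "mv_eval ?E r c1 ?p mod int q = mv_eval ?E r c2 ?p mod int q"
          using fun_cong[OF c12(4), of ?p] by (simp add: \<Phi>_def)
        then have "int q dvd mv_eval ?E r c ?p" by (simp add: lin mod_eq_dvd_iff)
        moreover have "int q dvd mv_eval ?E r c (\<lambda>j. poly (mult_coords (f i) j) (int y)) - mv_eval ?E r c ?p"
          by (rule mv_eval_dvd_cong) (simp add: mult_point_def dvd_minus_mod)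
        ultimately show ?thesis unfolding poly_mv_eval by (meson dvd_diff_right_iff dvd_diff_left_iff)
      qed
      then show ?thesis by blast
    qed
    finally show False using small by simp
  qed
  \<comment> \<open>A crude bound is enough: \<open>N\<close> only starts the induction and does not
    enter the estimate.\<close>
  define N where "N = (\<Sum>e\<in>?E. \<Sum>i=1..r. e i)"
  have "(\<Sum>i=1..r. e i) \<le> N" if "e \<in> ?E" for e
    unfolding N_def by (rule member_le_sum[OF that]) (auto simp: finite_exp_box)
  then show ?thesis
    by (intro card_mult_points_ge[OF q D d F vanish e0(1) nz])
qed

section \<open>Total correctness with running times\<close>

text \<open>Hoare-style total correctness. \<open>T\<close> is merely an upper bound for the running
  time, so budgets can be rounded up when programs are composed.\<close>

definition runs :: "nat \<Rightarrow> nat \<Rightarrow> com \<Rightarrow> state \<Rightarrow> nat \<Rightarrow> (state \<Rightarrow> bool) \<Rightarrow> bool" where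
  "runs m B p s T Q \<longleftrightarrow> (\<exists>t s'. exec m B p s t s' \<and> t \<le> T \<and> Q s')"

lemma runs_weaken: "runs m B p s T Q \<Longrightarrow> T \<le> T' \<Longrightarrow> (\<And>s'. Q s' \<Longrightarrow> Q' s') \<Longrightarrow> runs m B p s T' Q'"
  unfolding runs_def using order_trans by blast

lemma runs_IAssign:
  assumes "iok m B s x" "ival s x < m" "iok m B s e"
    "Q (s\<lparr>imem := (imem s)(ival s x := ival s e)\<rparr>)"
    "1 \<le> T"
  shows "runs m B (IAssign x e) s T Q"
  unfolding runs_def using exec_IAssign[OF assms(1-3)] assms(4,5) by blast

lemma runs_RAssign:
  assumes "iok m B s x" "ival s x < m" "rok m B s e"
    "Q (s\<lparr>rmem := (rmem s)(ival s x := rval s e)\<rparr>)"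
    "1 \<le> T"
  shows "runs m B (RAssign x e) s T Q"
  unfolding runs_def using exec_RAssign[OF assms(1-3)] assms(4,5) by blast

lemma runs_Emit:
  assumes "iok m B s e" "Q (s\<lparr>out := out s @ [ival s e]\<rparr>)" "1 \<le> T"
  shows "runs m B (Emit e) s T Q"
  unfolding runs_def using exec_Emit[OF assms(1)] assms(2,3) by blast

lemma runs_Skip: "Q s \<Longrightarrow> 1 \<le> T \<Longrightarrow> runs m B Skip s T Q"
  unfolding runs_def using exec_Skip by blast

lemma runs_Seq:
  assumes "runs m B c1 s T1 R" "\<And>s'. R s' \<Longrightarrow> runs m B c2 s' T2 Q" "T1 + T2 \<le> T"
  shows "runs m B (Seq c1 c2) s T Q"
proof -
  obtain t1 s' where 1: "exec m B c1 s t1 s'" "t1 \<le> T1" "R s'" using assms(1) by (auto simp: runs_def)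
  obtain t2 s'' where 2: "exec m B c2 s' t2 s''" "t2 \<le> T2" "Q s''"
    using assms(2)[OF 1(3)] by (auto simp: runs_def)
  show ?thesis unfolding runs_def
    by (intro exI[of _ "t1 + t2"] exI[of _ s''] conjI exec_Seq[OF 1(1) 2(1)]) (use 1 2 assms(3) in auto)
qed

lemma runs_Cond:
  assumes "bok m B s e" "bval s e \<Longrightarrow> runs m B c1 s (T - 1) Q" "\<not> bval s e \<Longrightarrow> runs m B c2 s (T - 1) Q"
    "1 \<le> T"
  shows "runs m B (Cond e c1 c2) s T Q"
proof (cases "bval s e")
  case True
  then obtain t s' where *: "exec m B c1 s t s'" "t \<le> T - 1" "Q s'" using assms(2) by (auto simp: runs_def)
  moreover have "t + 1 \<le> T" using *(2) assms(4) by simp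
  ultimately show ?thesis unfolding runs_def using exec_CondTrue[OF assms(1) True] by blast
next
  case False
  then obtain t s' where *: "exec m B c2 s t s'" "t \<le> T - 1" "Q s'" using assms(3) by (auto simp: runs_def)
  moreover have "t + 1 \<le> T" using *(2) assms(4) by simp
  ultimately show ?thesis unfolding runs_def using exec_CondFalse[OF assms(1) False] by blast
qed

lemma runs_IAssign_Seq:
  assumes "iok m B s x" "ival s x < m" "iok m B s e"
    "runs m B p (s\<lparr>imem := (imem s)(ival s x := ival s e)\<rparr>) (T - 1) Q" "1 \<le> T"
  shows "runs m B (Seq (IAssign x e) p) s T Q"
  by (rule runs_Seq[OF runs_IAssign[OF assms(1-3), of "\<lambda>s'. s' = s\<lparr>imem := (imem s)(ival s x := ival s e)\<rparr>" 1],
      where ?T2.0 = "T - 1"])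
    (use assms(4,5) in auto)

lemma runs_RAssign_Seq:
  assumes "iok m B s x" "ival s x < m" "rok m B s e"
    "runs m B p (s\<lparr>rmem := (rmem s)(ival s x := rval s e)\<rparr>) (T - 1) Q" "1 \<le> T"
  shows "runs m B (Seq (RAssign x e) p) s T Q"
  by (rule runs_Seq[OF runs_RAssign[OF assms(1-3), of "\<lambda>s'. s' = s\<lparr>rmem := (rmem s)(ival s x := rval s e)\<rparr>" 1],
      where ?T2.0 = "T - 1"])
    (use assms(4,5) in auto)

text \<open>For the prime search, whose number of iterations is not known in advance. The initial
  variant bounds that number; each round pays one extra step for its test, and the failing test pays
  the last one.\<close>

lemma runs_While_variant:
  fixes V :: "state \<Rightarrow> nat"
  assumes "I s"
    and "\<And>s. I s \<Longrightarrow> bok m B s e"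
    and "\<And>s. I s \<Longrightarrow> bval s e \<Longrightarrow> runs m B p s Tb (\<lambda>s'. I s' \<and> V s' < V s)"
    and "\<And>s. I s \<Longrightarrow> \<not> bval s e \<Longrightarrow> Q s"
    and "V s * (Tb + 1) + 1 \<le> T"
  shows "runs m B (While e p) s T Q"
proof -
  have "runs m B (While e p) s (V s * (Tb + 1) + 1) Q" using assms(1)
  proof (induction "V s" arbitrary: s rule: less_induct)
    case (less s)
    show ?case
    proof (cases "bval s e")
      case False
      then show ?thesis unfolding runs_def
        using exec_WhileFalse[OF assms(2)[OF less.prems] False] assms(4)[OF less.prems False]
        by (metis le_add2)
    next
      case True
      obtain t1 s1 where 1: "exec m B p s t1 s1" "t1 \<le> Tb" "I s1" "V s1 < V s"
        using assms(3)[OF less.prems True] by (auto simp: runs_def)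
      obtain t2 s2 where 2: "exec m B (While e p) s1 t2 s2" "t2 \<le> V s1 * (Tb + 1) + 1" "Q s2"
        using less.hyps[OF 1(4,3)] by (auto simp: runs_def)
      have "Suc (V s1) * (Tb + 1) \<le> V s * (Tb + 1)" using 1(4) by (intro mult_le_mono1) simp
      then have "t1 + t2 + 1 \<le> V s * (Tb + 1) + 1" using 1(2) 2(2) by simp
      then show ?thesis unfolding runs_def
        using exec_WhileTrue[OF assms(2)[OF less.prems] True 1(1) 2(1)] 2(3) by blast
    qed
  qed
  then show ?thesis using assms(5) by (rule runs_weaken) auto
qed

lemma runs_While_count:
  assumes "I 0 s"
    and "\<And>x s. x < N \<Longrightarrow> I x s \<Longrightarrow> bok m B s e \<and> bval s e \<and> runs m B p s Tb (I (Suc x))"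
    and "\<And>s. I N s \<Longrightarrow> bok m B s e \<and> \<not> bval s e \<and> Q s"
    and "N * (Tb + 1) + 1 \<le> T"
  shows "runs m B (While e p) s T Q"
proof -
  have "runs m B (While e p) s ((N - x) * (Tb + 1) + 1) Q" if "x \<le> N" "I x s" for x s
    using that
  proof (induction "N - x" arbitrary: x s)
    case 0
    then show ?case unfolding runs_def using assms(3)[of s] exec_WhileFalse
      by (metis add_0 diff_is_0_eq' le_antisym mult_0 order_refl diff_diff_cancel diff_zero)
  next
    case (Suc k)
    then have xN: "x < N" by simp
    note step = assms(2)[OF xN Suc.prems(2)]
    obtain t1 s1 where 1: "exec m B p s t1 s1" "t1 \<le> Tb" "I (Suc x) s1"
      using step by (auto simp: runs_def)
    obtain t2 s2 where 2: "exec m B (While e p) s1 t2 s2" "t2 \<le> (N - Suc x) * (Tb + 1) + 1" "Q s2"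
    proof -
      have "runs m B (While e p) s1 ((N - Suc x) * (Tb + 1) + 1) Q"
        by (rule Suc.hyps(1)) (use Suc.hyps(2) xN 1(3) in auto)
      then show ?thesis using that unfolding runs_def by blast
    qed
    have "N - x = Suc (N - Suc x)" using xN by simp
    then have "t1 + t2 + 1 \<le> (N - x) * (Tb + 1) + 1" using 1(2) 2(2) by simp
    then show ?case unfolding runs_def using exec_WhileTrue[OF _ _ 1(1) 2(1)] step 2(3) by blast
  qed
  from this[of 0 s] show ?thesis using assms(1,4) by (auto intro: runs_weaken)
qed

section \<open>Frame conditions for subprograms that change integer cells only\<close>

definition same_except :: "nat set \<Rightarrow> state \<Rightarrow> state \<Rightarrow> bool" where
  "same_except A s s' \<longleftrightarrow> (\<forall>x. x \<notin> A \<longrightarrow> imem s' x = imem s x) \<and> rmem s' = rmem s \<and> out s' = out s"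

lemma same_except_imem: "same_except A s s' \<Longrightarrow> x \<notin> A \<Longrightarrow> imem s' x = imem s x"
  by (auto simp: same_except_def)

lemma same_except_refl: "same_except A s s"
  by (simp add: same_except_def)

text \<open>Stated for an explicit \<open>imem := f\<close> so that it peels off nested updates one
  by one; \<open>same_except_imem_id\<close> closes the chain.\<close>

lemma same_except_upd:
  "x \<in> A \<Longrightarrow> same_except A s (s'\<lparr>imem := f\<rparr>) \<Longrightarrow> same_except A s (s'\<lparr>imem := f(x := v)\<rparr>)"
  by (auto simp: same_except_def)

lemma same_except_imem_id: "same_except A s s' \<Longrightarrow> same_except A s (s'\<lparr>imem := imem s'\<rparr>)"
  by (auto simp: same_except_def)

lemma same_except_trans:
  "same_except A s s' \<Longrightarrow> same_except A' s' s'' \<Longrightarrow> A \<subseteq> C \<Longrightarrow> A' \<subseteq> C \<Longrightarrow> same_except C s s''"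
  unfolding same_except_def by (metis subsetD)

abbreviation reg :: "nat \<Rightarrow> iexp" where "reg x \<equiv> ICell (INum x)"

abbreviation assign :: "nat \<Rightarrow> iexp \<Rightarrow> com" where "assign x e \<equiv> IAssign (INum x) e"

text \<open>
  Integer cells: \<open>0\<close> holds \<open>n\<close>, \<open>1\<close> the coordinate \<open>i\<close>, \<open>2\<close> to \<open>8\<close> the parameters \<open>2 ^ lk, lk, L, sg, r, d, q\<close> of locale
  \<open>sketch\<close> below, \<open>9\<close> the point \<open>y\<close>, \<open>10\<close> the bucket of \<open>(i, y)\<close>, and \<open>11\<close> to \<open>19\<close> are scratch. Real cells: \<open>0\<close> holds \<open>\<epsilon>\<close>,
  \<open>2\<close> the increment \<open>\<Delta>\<close>, \<open>3\<close> the sum of all coordinates, and \<open>4 + p\<close> the weight of bucket \<open>p\<close>.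
\<close>

definition scale_prog :: com where
  "scale_prog = Seq (assign 2 (INum 1)) (Seq (assign 3 (INum 0))
     (While (BAnd (ILess (reg 2) (reg 0)) (RLess (RMul (ROfInt (reg 2)) (RCell (INum 0))) (ROfInt (INum 1))))
       (Seq (assign 2 (IMul (INum 2) (reg 2))) (assign 3 (IAdd (reg 3) (INum 1))))))"

definition log_prog :: "nat \<Rightarrow> iexp \<Rightarrow> com" where
  "log_prog x e = Seq (assign 11 (INum 1)) (Seq (assign x (INum 0))
     (While (ILess (reg 11) e)
       (Seq (assign 11 (IMul (INum 2) (reg 11))) (assign x (IAdd (reg x) (INum 1))))))"

text \<open>Cell 11 adds up multiples of \<open>r\<close> while cell 7 doubles. This finds the least
  \<open>g\<close> with \<open>lk + 2 <= g * r\<close> together with its power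
  \<open>2 ^ g\<close>.\<close>

definition side_prog :: com where
  "side_prog = Seq (assign 7 (INum 1)) (Seq (assign 11 (INum 0))
     (While (ILess (reg 11) (IAdd (reg 3) (INum 2)))
       (Seq (assign 7 (IMul (INum 2) (reg 7))) (assign 11 (IAdd (reg 11) (reg 6))))))"

text \<open>Trial division upwards from \<open>4 * r * d * L + 1\<close>; a divisor that has reached
  the candidate proves it prime. Such a naive search is affordable in every run because
  \<open>q\<close> is polylogarithmic in \<open>n\<close>.\<close>

definition prime_prog :: com where
  "prime_prog = Seq (assign 8 (IAdd (IMul (IMul (IMul (INum 4) (reg 6)) (reg 7)) (reg 4)) (INum 1))) (Seq (assign 11 (INum 2))
     (While (ILess (reg 11) (reg 8))
       (Cond (ILess (IMod (reg 8) (reg 11)) (INum 1))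
         (Seq (assign 8 (IAdd (reg 8) (INum 1))) (assign 11 (INum 2)))
         (assign 11 (IAdd (reg 11) (INum 1))))))"

text \<open>\<open>a\<close>, \<open>b\<close> and \<open>c\<close> are numerals of the program
  text: \<open>a / b\<close> is the rational exponent \<open>\<beta>\<close> that stands in for
  \<open>\<alpha>\<close>, and \<open>c\<close> will absorb the constant of the prime gaps.\<close>

definition setup_prog :: "nat \<Rightarrow> nat \<Rightarrow> nat \<Rightarrow> com" where
  "setup_prog a b c = Seq scale_prog (Seq (log_prog 4 (reg 0))
     (Seq (log_prog 5 (IMul (IMul (INum c) (reg 4)) (reg 3)))
     (Seq (assign 6 (IAdd (IDiv (IMul (INum a) (reg 3)) (IMul (INum b) (reg 5))) (INum 1)))
     (Seq side_prog prime_prog))))"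

definition ceil_log :: "nat \<Rightarrow> nat" where
  "ceil_log x = (LEAST l. x \<le> 2 ^ l)"

lemma le_ceil_log: "x \<le> 2 ^ ceil_log x"
  unfolding ceil_log_def by (rule LeastI[of "\<lambda>l. x \<le> 2 ^ l" x]) (simp add: less_imp_le)

lemma less_ceil_log: "l < ceil_log x \<Longrightarrow> 2 ^ l < x"
  unfolding ceil_log_def using not_less_Least by fastforce

lemma runs_log_prog:
  assumes "x \<noteq> 11" "11 < m" "x < m" "11 < B" "x < B" "2 * N < B" "1 \<le> N"
    and e: "\<And>s'. same_except {11, x} s s' \<Longrightarrow> iok m B s' e \<and> ival s' e = N"
  shows "runs m B (log_prog x e) s (3 * ceil_log N + 3)
     (\<lambda>s'. same_except {11, x} s s' \<and> imem s' x = ceil_log N)"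
proof -
  define I where "I l s' \<longleftrightarrow> same_except {11, x} s s' \<and> imem s' 11 = 2 ^ l \<and> imem s' x = l" for l s'
  have small: "2 ^ l < B \<and> l < B" if "l \<le> ceil_log N" for l
  proof (cases l)
    case (Suc k)
    then have "2 ^ k < N" using that by (intro less_ceil_log) simp
    then show ?thesis using Suc assms less_exp[of l] by simp
  qed (use assms in auto)
  have loop: "runs m B (While (ILess (reg 11) e)
       (Seq (assign 11 (IMul (INum 2) (reg 11))) (assign x (IAdd (reg x) (INum 1))))) s1 (3 * ceil_log N + 1)
     (\<lambda>s'. same_except {11, x} s s' \<and> imem s' x = ceil_log N)" if "I 0 s1" for s1
  proof (rule runs_While_count[where I = I and N = "ceil_log N" and Tb = 2])
    fix l s' assume l: "l < ceil_log N" and I: "I l s'"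
    show "bok m B s' (ILess (reg 11) e) \<and> bval s' (ILess (reg 11) e) \<and>
       runs m B (Seq (assign 11 (IMul (INum 2) (reg 11))) (assign x (IAdd (reg x) (INum 1)))) s' 2 (I (Suc l))"
    proof (intro conjI runs_IAssign_Seq runs_IAssign)
    qed (use I e[of s'] l less_ceil_log[OF l] small[of l] small[of "Suc l"] assms(1-7)
          in \<open>auto simp: I_def intro!: same_except_upd same_except_imem_id\<close>)
  next
    fix s' assume I: "I (ceil_log N) s'"
    then show "bok m B s' (ILess (reg 11) e) \<and> \<not> bval s' (ILess (reg 11) e) \<and>
       same_except {11, x} s s' \<and> imem s' x = ceil_log N"
      using e[of s'] le_ceil_log[of N] small[of "ceil_log N"] assms(1-7) by (auto simp: I_def)
  qed (use that in auto)
  show ?thesis unfolding log_prog_def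
    by (intro runs_IAssign_Seq runs_weaken[OF loop])
      (use assms(1-7) in \<open>auto simp: I_def intro!: same_except_upd same_except_imem_id same_except_refl\<close>)
qed

text \<open>
  \<open>2 ^ lk\<close> is \<open>1/\<epsilon>\<close> up to a factor of two, capped at about \<open>n\<close>. Given \<open>r\<close>, expansion needs \<open>d ^ r \<ge> 4 * 2 ^ lk\<close> and
  \<open>q > 4 r d L\<close>, which leads to \<open>M = q ^ (r + 1)\<close> of order \<open>sz ^ (r + 1) * 2 ^ (lk * (1 + 1/r))\<close>; the choice of \<open>r\<close>
  makes \<open>sz ^ r\<close> about \<open>2 ^ (lk * a / b)\<close>.
\<close>

locale sketch =
  fixes n a b c :: nat and \<epsilon> :: real
  assumes n: "n \<ge> 2" and eps: "0 < \<epsilon>" "\<epsilon> \<le> 1 / 2" and abc: "a \<ge> 1" "b \<ge> 1" "c \<ge> 2"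
begin

definition lk :: nat where "lk = (LEAST l. \<not> (2 ^ l < n \<and> 2 ^ l * \<epsilon> < 1))"
definition L :: nat where "L = ceil_log n"
definition sz :: nat where "sz = c * L * lk"
definition sg :: nat where "sg = ceil_log sz"
definition r :: nat where "r = a * lk div (b * sg) + 1"
definition g :: nat where "g = (LEAST g. lk + 2 \<le> g * r)"
definition d :: nat where "d = 2 ^ g"
definition q :: nat where "q = (LEAST p. 4 * r * d * L + 1 \<le> p \<and> prime p)"
definition M :: nat where "M = q ^ (r + 1)"

lemma lk_stop: "\<not> (2 ^ lk < n \<and> 2 ^ lk * \<epsilon> < 1)"
  unfolding lk_def by (rule LeastI[of "\<lambda>l. \<not> (2 ^ l < n \<and> 2 ^ l * \<epsilon> < 1)" n]) (simp add: less_exp less_imp_le not_less)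

lemma lk_less: "l < lk \<Longrightarrow> 2 ^ l < n \<and> 2 ^ l * \<epsilon> < 1"
  unfolding lk_def using not_less_Least by fastforce

lemma lk_pos: "lk \<ge> 1"
proof (rule ccontr)
  assume "\<not> lk \<ge> 1"
  then have "lk = 0" by simp
  then show False using lk_stop n eps by simp
qed

lemma L_pos: "L \<ge> 1"
proof (rule ccontr)
  assume "\<not> L \<ge> 1"
  then have "L = 0" by simp
  then show False using le_ceil_log[of n] n by (simp add: L_def)
qed

lemma n_le: "n \<le> 2 ^ L" unfolding L_def by (rule le_ceil_log)

lemma lk_le_L: "lk \<le> L"
proof -
  have "2 ^ (lk - 1) < n" using lk_less[of "lk - 1"] lk_pos by simp
  then have "(2::nat) ^ (lk - 1) < 2 ^ L" using n_le by (rule less_le_trans)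
  then have "lk - 1 < L" by (rule power_less_imp_less_exp[rotated]) simp
  then show ?thesis by simp
qed

lemma L_le_n: "L \<le> n"
proof -
  have "2 ^ (L - 1) < n" using less_ceil_log[of "L - 1" n] L_pos by (simp add: L_def)
  then have "L - 1 < n" using less_exp[of "L - 1"] by (rule less_trans[rotated])
  then show ?thesis by simp
qed

lemma sz_ge: "sz \<ge> 2"
  unfolding sz_def using mult_le_mono[OF mult_le_mono[OF abc(3) L_pos] lk_pos] by simp

lemma sg_pos: "sg \<ge> 1"
proof (rule ccontr)
  assume "\<not> sg \<ge> 1"
  then have "sg = 0" by simp
  then show False using le_ceil_log[of sz] sz_ge by (simp add: sg_def)
qed

lemma r_pos: "r \<ge> 1" by (simp add: r_def)

lemma g_ge: "lk + 2 \<le> g * r"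
  unfolding g_def by (rule LeastI[of "\<lambda>g. lk + 2 \<le> g * r" "lk + 2"]) (use mult_le_mono2[OF r_pos, of "lk + 2"] in simp)

lemma g_less: "x < g \<Longrightarrow> x * r < lk + 2"
  unfolding g_def using not_less_Least by fastforce

lemma g_pos: "g \<ge> 1"
  using g_ge by (cases g) auto

lemma q_prime: "prime q" and q_ge: "4 * r * d * L + 1 \<le> q"
proof -
  obtain p where "prime p" "p > 4 * r * d * L" using bigger_prime by blast
  then have "4 * r * d * L + 1 \<le> p \<and> prime p" by simp
  from LeastI[of "\<lambda>p. 4 * r * d * L + 1 \<le> p \<and> prime p", OF this]
  show "prime q" "4 * r * d * L + 1 \<le> q" unfolding q_def by auto
qed

lemma q_least: "4 * r * d * L + 1 \<le> p \<Longrightarrow> p < q \<Longrightarrow> \<not> prime p"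
  unfolding q_def using not_less_Least[of p "\<lambda>p. 4 * r * d * L + 1 \<le> p \<and> prime p"] by auto

lemma d_pos: "d \<ge> 2" unfolding d_def using g_pos power_increasing[of 1 g "2::nat"] by simp

lemma bounds_by_q: "4 * r < q" "4 * d < q" "4 * L < q" "4 * r * d < q"
proof -
  have *: "r \<le> r * d" "d \<le> r * d" "L \<le> (r * d) * L" "r * d \<le> (r * d) * L"
    using r_pos d_pos L_pos by auto
  have "4 * ((r * d) * L) < q" using q_ge by (simp add: mult.assoc)
  then show "4 * r < q" "4 * d < q" "4 * L < q" "4 * r * d < q" using * by linarith+
qed

lemma q_le_M: "q \<le> M" unfolding M_def using bounds_by_q power_increasing[of 1 "r + 1" q] by simp

end

text \<open>Bucket weights occupy the real cells \<open>4\<close> to \<open>M + 3\<close> and the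
  integer cells in use end at \<open>19\<close>, so \<open>M + 20\<close> cells per bank suffice.
  The sum below \<open>B\<close> dominates every integer that occurs in a run.\<close>

locale sketch_machine = sketch +
  fixes m B :: nat
  assumes m: "M + 20 \<le> m"
    and B: "2 * n + 2 * sz + a * lk + b * sg + a + b + c + lk + sg + r + M * q + q + M + 100 < B"
begin

lemma runs_scale_prog:
  assumes "imem s 0 = n" "rmem s 0 = \<epsilon>"
  shows "runs m B scale_prog s (3 * lk + 3) (\<lambda>s'. same_except {2, 3} s s' \<and> imem s' 3 = lk)"
proof -
  define I where "I l s' \<longleftrightarrow> same_except {2, 3} s s' \<and> imem s' 2 = 2 ^ l \<and> imem s' 3 = l" for l s'
  let ?e = "BAnd (ILess (reg 2) (reg 0)) (RLess (RMul (ROfInt (reg 2)) (RCell (INum 0))) (ROfInt (INum 1)))"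
  have mm: "19 < m" "99 < B" using m B by auto
  have small: "2 ^ l < B \<and> l < B" if "l \<le> lk" for l
  proof (cases l)
    case (Suc k)
    then have "2 ^ k < n" using that lk_less[of k] by simp
    then show ?thesis using Suc B less_exp[of l] by simp
  qed (use mm in auto)
  have nB: "n < B" using B by simp
  have loop: "runs m B (While ?e
       (Seq (assign 2 (IMul (INum 2) (reg 2))) (assign 3 (IAdd (reg 3) (INum 1))))) s1 (3 * lk + 1)
     (\<lambda>s'. same_except {2, 3} s s' \<and> imem s' 3 = lk)" if "I 0 s1" for s1
  proof (rule runs_While_count[where I = I and N = lk and Tb = 2])
    fix l s' assume l: "l < lk" and I: "I l s'"
    have s': "imem s' 0 = n" "rmem s' 0 = \<epsilon>" using I assms by (auto simp: I_def same_except_def)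
    show "bok m B s' ?e \<and> bval s' ?e \<and>
       runs m B (Seq (assign 2 (IMul (INum 2) (reg 2))) (assign 3 (IAdd (reg 3) (INum 1)))) s' 2 (I (Suc l))"
    proof (intro conjI runs_IAssign_Seq runs_IAssign)
    qed (use I l s' mm nB lk_less[OF l] small[of l] small[of "Suc l"]
          in \<open>auto simp: I_def intro!: same_except_upd same_except_imem_id\<close>)
  next
    fix s' assume I: "I lk s'"
    have s': "imem s' 0 = n" "rmem s' 0 = \<epsilon>" using I assms by (auto simp: I_def same_except_def)
    show "bok m B s' ?e \<and> \<not> bval s' ?e \<and> same_except {2, 3} s s' \<and> imem s' 3 = lk"
      using I s' mm nB lk_stop small[of lk] by (auto simp: I_def)
  qed (use that in auto)
  show ?thesis unfolding scale_prog_def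
    by (intro runs_IAssign_Seq runs_weaken[OF loop])
      (use mm in \<open>auto simp: I_def intro!: same_except_upd same_except_imem_id same_except_refl\<close>)
qed

lemma runs_side_prog:
  assumes "imem s 3 = lk" "imem s 6 = r"
  shows "runs m B side_prog s (3 * g + 3) (\<lambda>s'. same_except {7, 11} s s' \<and> imem s' 7 = d)"
proof -
  define I where "I l s' \<longleftrightarrow> same_except {7, 11} s s' \<and> imem s' 7 = 2 ^ l \<and> imem s' 11 = l * r" for l s'
  let ?e = "ILess (reg 11) (IAdd (reg 3) (INum 2))"
  have mm: "19 < m" "99 < B" using m B by auto
  have small: "2 ^ l < B \<and> l * r < B" if "l \<le> g" for l
  proof
    have "2 ^ l \<le> d" unfolding d_def using that by (intro power_increasing) auto
    then show "2 ^ l < B" using bounds_by_q B by linarith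
    show "l * r < B"
    proof (cases l)
      case (Suc k)
      then have "k * r < lk + 2" using that g_less[of k] by simp
      then show ?thesis using Suc B by simp
    qed (use mm in auto)
  qed
  have kB: "lk + 2 < B" "r < B" using B by auto
  have loop: "runs m B (While ?e
       (Seq (assign 7 (IMul (INum 2) (reg 7))) (assign 11 (IAdd (reg 11) (reg 6))))) s1 (3 * g + 1)
     (\<lambda>s'. same_except {7, 11} s s' \<and> imem s' 7 = d)" if "I 0 s1" for s1
  proof (rule runs_While_count[where I = I and N = g and Tb = 2])
    fix l s' assume l: "l < g" and I: "I l s'"
    have s': "imem s' 3 = lk" "imem s' 6 = r" using I assms by (auto simp: I_def same_except_def)
    show "bok m B s' ?e \<and> bval s' ?e \<and>
       runs m B (Seq (assign 7 (IMul (INum 2) (reg 7))) (assign 11 (IAdd (reg 11) (reg 6)))) s' 2 (I (Suc l))"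
    proof (intro conjI runs_IAssign_Seq runs_IAssign)
    qed (use I l s' mm kB g_less[OF l] small[of l] small[of "Suc l"]
          in \<open>auto simp: I_def intro!: same_except_upd same_except_imem_id\<close>)
  next
    fix s' assume I: "I g s'"
    have s': "imem s' 3 = lk" "imem s' 6 = r" using I assms by (auto simp: I_def same_except_def)
    show "bok m B s' ?e \<and> \<not> bval s' ?e \<and> same_except {7, 11} s s' \<and> imem s' 7 = d"
      using I s' mm kB g_ge small[of g] by (auto simp: I_def d_def)
  qed (use that in auto)
  show ?thesis unfolding side_prog_def
    by (intro runs_IAssign_Seq runs_weaken[OF loop])
      (use mm in \<open>auto simp: I_def intro!: same_except_upd same_except_imem_id same_except_refl\<close>)
qed

lemma runs_prime_prog:
  assumes "imem s 4 = L" "imem s 6 = r" "imem s 7 = d"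
  shows "runs m B prime_prog s (4 * (q * (q + 1) + q) + 3) (\<lambda>s'. same_except {8, 11} s s' \<and> imem s' 8 = q)"
proof -
  define I where "I s' \<longleftrightarrow> same_except {8, 11} s s' \<and> 4 * r * d * L + 1 \<le> imem s' 8 \<and> imem s' 8 \<le> q \<and>
     2 \<le> imem s' 11 \<and> imem s' 11 \<le> imem s' 8 \<and> (\<forall>j. 2 \<le> j \<longrightarrow> j < imem s' 11 \<longrightarrow> \<not> j dvd imem s' 8)" for s'
  \<comment> \<open>A lexicographic measure in one number: the weight \<open>q + 1\<close> of the
    candidate outweighs the reset of the divisor to 2.\<close>
  define V where "V s' = (q - imem s' 8) * (q + 1) + (q - imem s' 11)" for s' :: state
  let ?e = "ILess (reg 11) (reg 8)"
  let ?p = "Cond (ILess (IMod (reg 8) (reg 11)) (INum 1))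
         (Seq (assign 8 (IAdd (reg 8) (INum 1))) (assign 11 (INum 2)))
         (assign 11 (IAdd (reg 11) (INum 1)))"
  have mm: "19 < m" "99 < B" "q + 1 < B" using m B by auto
  have q0: "4 * r * d * L \<ge> 2" using bounds_by_q(4) mult_le_mono2[OF L_pos, of "4 * r * d"] r_pos d_pos
    by (simp add: Suc_le_eq)
  have loop: "runs m B (While ?e ?p) s1 (4 * (q * (q + 1) + q) + 1)
     (\<lambda>s'. same_except {8, 11} s s' \<and> imem s' 8 = q)" if I1: "I s1" for s1
  proof (rule runs_While_variant[where I = I and V = V and Tb = 3])
    fix s' assume I: "I s'"
    have lt: "imem s' 8 < B" "imem s' 11 < B" using I mm by (auto simp: I_def)
    show "bok m B s' ?e" using lt mm by simp
    show "runs m B ?p s' 3 (\<lambda>s''. I s'' \<and> V s'' < V s')" if "bval s' ?e"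
    proof (rule runs_Cond)
      show "bok m B s' (ILess (IMod (reg 8) (reg 11)) (INum 1))" using lt mm by simp
      have less: "imem s' 11 < imem s' 8" using that by simp
      show "runs m B (Seq (assign 8 (IAdd (reg 8) (INum 1))) (assign 11 (INum 2))) s' (3 - 1) (\<lambda>s''. I s'' \<and> V s'' < V s')"
        if "bval s' (ILess (IMod (reg 8) (reg 11)) (INum 1))"
      proof -
        \<comment> \<open>A proper divisor shows that the candidate is not \<open>q\<close>, so it
          may grow by one without passing \<open>q\<close>.\<close>
        have dv: "imem s' 11 dvd imem s' 8" using that by (simp add: mod_eq_0_iff_dvd)
        then have "\<not> prime (imem s' 8)"
          using less I by (auto simp: I_def prime_nat_iff)
        then have "imem s' 8 \<noteq> q" using q_prime by auto
        then have lq: "imem s' 8 < q" using I by (simp add: I_def)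
        then have "(q - imem s' 8) * (q + 1) = (q - Suc (imem s' 8)) * (q + 1) + (q + 1)"
          by (simp add: Suc_diff_Suc[symmetric] del: Suc_diff_Suc)
        then have V: "(q - Suc (imem s' 8)) * (q + 1) + (q - 2) < V s'" unfolding V_def by simp
        show ?thesis
          by (intro runs_IAssign_Seq runs_IAssign)
            (use I lt mm lq V q0 in \<open>auto simp: I_def V_def intro!: same_except_upd same_except_imem_id\<close>)
      qed
      show "runs m B (assign 11 (IAdd (reg 11) (INum 1))) s' (3 - 1) (\<lambda>s''. I s'' \<and> V s'' < V s')"
        if "\<not> bval s' (ILess (IMod (reg 8) (reg 11)) (INum 1))"
      proof -
        have nd: "\<not> imem s' 11 dvd imem s' 8" using that by (simp add: mod_eq_0_iff_dvd)
        have lq: "imem s' 11 < q" using less I by (simp add: I_def)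
        have "\<not> j dvd imem s' 8" if "2 \<le> j" "j < Suc (imem s' 11)" for j
          using that nd I by (cases "j = imem s' 11") (auto simp: I_def)
        then show ?thesis
          by (intro runs_IAssign)
            (use I lt mm lq less in \<open>auto simp: I_def V_def intro!: same_except_upd same_except_imem_id\<close>)
      qed
    qed simp
    show "same_except {8, 11} s s' \<and> imem s' 8 = q" if "\<not> bval s' ?e"
    proof -
      have eq: "imem s' 11 = imem s' 8" using that I by (simp add: I_def)
      have "prime (imem s' 8)"
      proof (rule ccontr)
        assume np: "\<not> prime (imem s' 8)"
        have "imem s' 8 \<ge> 2" using I eq by (simp add: I_def)
        then obtain p where p: "prime p" "p dvd imem s' 8" using prime_factor_nat[of "imem s' 8"] by auto
        then have "p \<noteq> imem s' 8" using np by auto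
        then have "p < imem s' 8" using p(2) \<open>imem s' 8 \<ge> 2\<close> dvd_imp_le[of p "imem s' 8"] by simp
        then show False using I eq p prime_ge_2_nat[OF p(1)] by (auto simp: I_def)
      qed
      then have "imem s' 8 = q" using I q_least[of "imem s' 8"] by (fastforce simp: I_def)
      then show ?thesis using I by (simp add: I_def)
    qed
  next
    have "(q - imem s1 8) * (q + 1) \<le> q * (q + 1)" by (intro mult_le_mono1) simp
    then have "V s1 \<le> q * (q + 1) + q" unfolding V_def by simp
    then show "V s1 * (3 + 1) + 1 \<le> 4 * (q * (q + 1) + q) + 1" by simp
  qed (rule I1)
  have B4: "4 * r < B" "4 * r * d < B" "4 * r * d * L + 1 < B" "r < B" "d < B" "L < B"
    using bounds_by_q q_ge mm by auto
  show ?thesis unfolding prime_prog_def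
    by (intro runs_IAssign_Seq runs_weaken[OF loop])
      (use mm assms B4 q0 q_ge in \<open>auto simp: I_def intro!: same_except_upd same_except_imem_id same_except_refl\<close>)
qed

definition setup_time :: nat where
  "setup_time = 3 * lk + 3 * L + 3 * sg + 3 * g + 4 * (q * (q + 1) + q) + 16"

lemma runs_setup_prog:
  assumes "imem s 0 = n" "rmem s 0 = \<epsilon>"
  shows "runs m B (setup_prog a b c) s setup_time
     (\<lambda>s'. same_except {2, 3, 4, 5, 6, 7, 8, 11} s s' \<and> imem s' 4 = L \<and> imem s' 6 = r \<and> imem s' 8 = q)"
proof -
  have mm: "19 < m" "99 < B" "2 * n < B" "2 * sz < B" "c < B" "lk < B" "a < B" "b < B" "a * lk + 1 < B"
      "b * sg < B" "sg < B" using m B by auto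
  have cL: "c * L \<le> sz" unfolding sz_def using lk_pos by simp
  have LB: "L < B" "c * L < B" using L_le_n mm cL by linarith+
  have divB: "a * lk div (b * sg) + 1 < B"
    using div_le_dividend[of "a * lk" "b * sg"] mm by linarith
  let ?A = "{2, 3, 4, 5, 6, 7, 8, 11}"
  define P1 where "P1 s' \<longleftrightarrow> same_except ?A s s' \<and> imem s' 3 = lk" for s'
  define P2 where "P2 s' \<longleftrightarrow> P1 s' \<and> imem s' 4 = L" for s'
  define P3 where "P3 s' \<longleftrightarrow> P2 s' \<and> imem s' 5 = sg" for s'
  define P4 where "P4 s' \<longleftrightarrow> P2 s' \<and> imem s' 6 = r" for s'
  define P5 where "P5 s' \<longleftrightarrow> P4 s' \<and> imem s' 7 = d" for s'
  have 1: "runs m B scale_prog s (3 * lk + 3) P1"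
    by (rule runs_weaken[OF runs_scale_prog[OF assms]])
      (auto simp: P1_def intro: same_except_trans[OF same_except_refl])
  have 2: "runs m B (log_prog 4 (reg 0)) s' (3 * L + 3) P2" if "P1 s'" for s'
    unfolding L_def
  proof (rule runs_weaken[OF runs_log_prog])
    fix s'' assume "same_except {11, 4} s' s''"
    then show "iok m B s'' (reg 0) \<and> ival s'' (reg 0) = n"
      using that mm assms by (auto simp: P1_def same_except_def)
  qed (use mm n that in \<open>auto simp: P1_def P2_def L_def same_except_imem intro: same_except_trans\<close>)
  have 3: "runs m B (log_prog 5 (IMul (IMul (INum c) (reg 4)) (reg 3))) s' (3 * sg + 3) P3" if "P2 s'" for s'
    unfolding sg_def
  proof (rule runs_weaken[OF runs_log_prog])
    fix s'' assume "same_except {11, 5} s' s''"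
    then show "iok m B s'' (IMul (IMul (INum c) (reg 4)) (reg 3)) \<and> ival s'' (IMul (IMul (INum c) (reg 4)) (reg 3)) = sz"
      using that mm LB by (auto simp: P1_def P2_def same_except_def sz_def)
  qed (use mm sz_ge that in \<open>auto simp: P1_def P2_def P3_def sg_def same_except_imem intro: same_except_trans\<close>)
  have 4: "runs m B (assign 6 (IAdd (IDiv (IMul (INum a) (reg 3)) (IMul (INum b) (reg 5))) (INum 1))) s' 1 P4" if "P3 s'" for s'
    by (rule runs_IAssign) (use that mm divB in \<open>auto simp: P1_def P2_def P3_def P4_def r_def intro!: same_except_upd same_except_imem_id\<close>)
  have 5: "runs m B side_prog s' (3 * g + 3) P5" if "P4 s'" for s'
    by (rule runs_weaken[OF runs_side_prog])
      (use that in \<open>auto simp: P1_def P2_def P4_def P5_def same_except_imem intro: same_except_trans\<close>)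
  have 6: "runs m B prime_prog s' (4 * (q * (q + 1) + q) + 3)
      (\<lambda>s'. same_except ?A s s' \<and> imem s' 4 = L \<and> imem s' 6 = r \<and> imem s' 8 = q)" if "P5 s'" for s'
    by (rule runs_weaken[OF runs_prime_prog])
      (use that in \<open>auto simp: P1_def P2_def P4_def P5_def same_except_imem intro: same_except_trans\<close>)
  show ?thesis unfolding setup_prog_def
    by (rule runs_Seq[OF 1 runs_Seq[OF 2 runs_Seq[OF 3 runs_Seq[OF 4 runs_Seq[OF 5 6]]]]], (assumption | rule order_refl)+)
      (simp add: setup_time_def)
qed

end

section \<open>Programs for hashing, updates and queries\<close>

definition power_prog :: com where
  "power_prog = Seq (assign 17 (INum 1)) (Seq (assign 18 (INum 0))
     (While (ILess (reg 18) (reg 12))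
       (Seq (assign 17 (IMul (reg 17) (reg 16))) (assign 18 (IAdd (reg 18) (INum 1))))))"

text \<open>Cell 14 holds the unread bits of \<open>i\<close>, cell 15 the power of \<open>y\<close>
  modulo \<open>q\<close>, cell 17 the eigenvalue \<open>j ^ v\<close> of the Euler operator and
  cell 13 the partial sum. The eigenvalue is not reduced modulo \<open>q\<close>; it still fits into
  a word.\<close>

definition eval_prog :: com where
  "eval_prog = Seq (assign 13 (INum 0)) (Seq (assign 14 (reg 1)) (Seq (assign 15 (INum 1)) (Seq (assign 16 (INum 0))
     (While (ILess (reg 16) (reg 4))
       (Seq power_prog
       (Seq (assign 13 (IMod (IAdd (reg 13) (IMul (IMul (IMod (reg 14) (INum 2)) (reg 17)) (reg 15))) (reg 8)))
       (Seq (assign 15 (IMod (IMul (reg 15) (reg 9)) (reg 8)))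
       (Seq (assign 14 (IDiv (reg 14) (INum 2)))
         (assign 16 (IAdd (reg 16) (INum 1)))))))))))"

definition bucket_prog :: com where
  "bucket_prog = Seq (assign 10 (reg 9)) (Seq (assign 12 (INum 0))
     (While (ILess (reg 12) (reg 6))
       (Seq eval_prog
       (Seq (assign 10 (IAdd (IMul (reg 10) (reg 8)) (reg 13)))
         (assign 12 (IAdd (reg 12) (INum 1)))))))"

text \<open>The place \<open>y = 0\<close> is left out because all Euler derivatives of positive
  order vanish there.\<close>

definition update_prog :: "nat \<Rightarrow> nat \<Rightarrow> nat \<Rightarrow> com" where
  "update_prog a b c = Seq (setup_prog a b c)
     (Seq (RAssign (INum 3) (RAdd (RCell (INum 3)) (RCell (INum 2))))
     (Seq (assign 9 (INum 1))
     (While (ILess (reg 9) (reg 8))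
       (Seq bucket_prog
       (Seq (RAssign (IAdd (INum 4) (reg 10)) (RAdd (RCell (IAdd (INum 4) (reg 10))) (RCell (INum 2))))
         (assign 9 (IAdd (reg 9) (INum 1))))))))"

definition test_prog :: com where
  "test_prog = Seq (assign 19 (INum 1)) (Seq (assign 9 (INum 1))
     (While (ILess (reg 9) (reg 8))
       (Seq bucket_prog
       (Seq (Cond (RLess (RCell (IAdd (INum 4) (reg 10))) (RMul (RCell (INum 0)) (RCell (INum 3))))
              (assign 19 (INum 0)) Skip)
         (assign 9 (IAdd (reg 9) (INum 1)))))))"

text \<open>If \<open>x = 0\<close>, every coordinate passes the test; the additional condition on
  the total weight in cell 3 keeps the list empty then.\<close>

definition query_prog :: "nat \<Rightarrow> nat \<Rightarrow> nat \<Rightarrow> com" where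
  "query_prog a b c = Seq (setup_prog a b c) (Seq (assign 1 (INum 0))
     (While (ILess (reg 1) (reg 0))
       (Seq test_prog
       (Seq (Cond (BAnd (ILess (INum 0) (reg 19)) (RLess (ROfInt (INum 0)) (RCell (INum 3))))
              (Emit (reg 1)) Skip)
         (assign 1 (IAdd (reg 1) (INum 1)))))))"

section \<open>Hash values and bucket numbers\<close>

context sketch
begin

text \<open>The Euler derivative of order \<open>v\<close> of the bit polynomial of
  \<open>i\<close>, evaluated at \<open>y\<close> modulo \<open>q\<close>.\<close>

definition hval :: "nat \<Rightarrow> nat \<Rightarrow> nat \<Rightarrow> nat" where
  "hval i y v = (\<Sum>j<L. (i div 2 ^ j mod 2) * j ^ v * y ^ j) mod q"

text \<open>The point of the multiplicity code read as digits in base \<open>q\<close>, with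
  \<open>y\<close> in front; with all \<open>r + 1\<close> digits this is an address below
  \<open>M\<close>.\<close>

primrec bucket_upto :: "nat \<Rightarrow> nat \<Rightarrow> nat \<Rightarrow> nat" where
  "bucket_upto i y 0 = y"
| "bucket_upto i y (Suc v) = bucket_upto i y v * q + hval i y v"

definition bucket :: "nat \<Rightarrow> nat \<Rightarrow> nat" where
  "bucket i y = bucket_upto i y r"

lemma q_pos: "q > 1" using q_prime by (rule prime_gt_1_nat)

lemma hval_less: "hval i y v < q"
  unfolding hval_def using q_pos by simp

lemma bucket_upto_less: "y < q \<Longrightarrow> bucket_upto i y v < q ^ (v + 1)"
proof (induction v)
  case (Suc v)
  then have "(bucket_upto i y v + 1) * q \<le> q ^ (v + 1) * q" by (intro mult_le_mono1) simp
  then show ?case using hval_less[of i y v] by (simp add: mult.commute mult.left_commute)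
qed simp

lemma bucket_upto_less_M:
  assumes "y < q" "v \<le> r" shows "bucket_upto i y v < M"
proof -
  have "q ^ (v + 1) \<le> M" unfolding M_def using q_pos assms by (intro power_increasing) auto
  then show ?thesis using bucket_upto_less[OF assms(1), of i v] by simp
qed

lemma bucket_less: "y < q \<Longrightarrow> bucket i y < M"
  unfolding bucket_def by (rule bucket_upto_less_M) auto

lemma power_le_M:
  assumes "j \<le> q" "v \<le> r" shows "j ^ v * q \<le> M"
proof -
  have "j ^ v \<le> q ^ v" using assms by (intro power_mono) auto
  also have "\<dots> \<le> q ^ r" using q_pos assms by (intro power_increasing) auto
  finally have "j ^ v * q \<le> q ^ r * q" by (rule mult_le_mono1)
  then show ?thesis by (simp add: M_def mult.commute)
qed

end

context sketch_machine
begin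

lemma machine_bounds: "19 < m" "99 < B" "n < B" "q < B" "r < B" "L < B" "M < B" "M * q + q < B" "M + 4 < B"
  "M + 3 < m"
  using m B L_le_n by auto

lemma runs_power_prog:
  assumes "imem s 12 = v" "imem s 16 = j" "v \<le> r" "j < L"
  shows "runs m B power_prog s (3 * v + 3) (\<lambda>s'. same_except {17, 18} s s' \<and> imem s' 17 = j ^ v)"
proof -
  define I where "I u s' \<longleftrightarrow> same_except {17, 18} s s' \<and> imem s' 17 = j ^ u \<and> imem s' 18 = u" for u s'
  let ?e = "ILess (reg 18) (reg 12)"
  note mm = machine_bounds
  have jq: "j \<le> q" using assms bounds_by_q by linarith
  have small: "j ^ u < B" if "u \<le> v" for u
  proof -
    have "j ^ u * 1 \<le> j ^ u * q" using q_pos by (intro mult_le_mono2) simp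
    then show ?thesis using power_le_M[OF jq, of u] that assms mm by linarith
  qed
  have vB: "v < B" "j < B" "19 < m" "99 < B" using assms mm by auto
  have loop: "runs m B (While ?e (Seq (assign 17 (IMul (reg 17) (reg 16))) (assign 18 (IAdd (reg 18) (INum 1))))) s1 (3 * v + 1)
     (\<lambda>s'. same_except {17, 18} s s' \<and> imem s' 17 = j ^ v)" if "I 0 s1" for s1
  proof (rule runs_While_count[where I = I and N = v and Tb = 2])
    fix u s' assume u: "u < v" and I: "I u s'"
    have s': "imem s' 12 = v" "imem s' 16 = j" using I assms by (auto simp: I_def same_except_def)
    show "bok m B s' ?e \<and> bval s' ?e \<and>
       runs m B (Seq (assign 17 (IMul (reg 17) (reg 16))) (assign 18 (IAdd (reg 18) (INum 1)))) s' 2 (I (Suc u))"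
    proof (intro conjI runs_IAssign_Seq runs_IAssign)
    qed (use I u s' vB small[of u] small[of "Suc u"]
          in \<open>auto simp: I_def mult.commute intro!: same_except_upd same_except_imem_id\<close>)
  next
    fix s' assume I: "I v s'"
    have s': "imem s' 12 = v" using I assms by (auto simp: I_def same_except_def)
    show "bok m B s' ?e \<and> \<not> bval s' ?e \<and> same_except {17, 18} s s' \<and> imem s' 17 = j ^ v"
      using I s' vB by (auto simp: I_def)
  qed (use that in auto)
  show ?thesis unfolding power_prog_def
    by (intro runs_IAssign_Seq runs_weaken[OF loop])
      (use vB in \<open>auto simp: I_def intro!: same_except_upd same_except_imem_id same_except_refl\<close>)
qed

lemma runs_eval_prog:
  assumes s: "imem s 1 = i" "imem s 4 = L" "imem s 8 = q" "imem s 9 = y" "imem s 12 = v"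
    and iyv: "i < n" "y < q" "v < r"
  shows "runs m B eval_prog s (L * (3 * r + 8) + 5)
     (\<lambda>s'. same_except {13, 14, 15, 16, 17, 18} s s' \<and> imem s' 13 = hval i y v)"
proof -
  let ?A = "{13, 14, 15, 16, 17, 18}"
  define acc where "acc j = (\<Sum>j<j. (i div 2 ^ j mod 2) * j ^ v * y ^ j) mod q" for j
  define I where "I j s' \<longleftrightarrow> same_except ?A s s' \<and> imem s' 13 = acc j \<and> imem s' 14 = i div 2 ^ j \<and>
     imem s' 15 = y ^ j mod q \<and> imem s' 16 = j" for j s'
  let ?e = "ILess (reg 16) (reg 4)"
  let ?p = "Seq (assign 13 (IMod (IAdd (reg 13) (IMul (IMul (IMod (reg 14) (INum 2)) (reg 17)) (reg 15))) (reg 8)))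
       (Seq (assign 15 (IMod (IMul (reg 15) (reg 9)) (reg 8)))
       (Seq (assign 14 (IDiv (reg 14) (INum 2)))
         (assign 16 (IAdd (reg 16) (INum 1)))))"
  have mm: "19 < m" "99 < B" "q < B" "L < B" using machine_bounds by auto
  have acc_less: "acc j < q" for j unfolding acc_def using q_pos by simp
  have acc_Suc: "(acc j + i div 2 ^ j mod 2 * j ^ v * (y ^ j mod q)) mod q = acc (Suc j)" for j
  proof -
    have "(x mod q + z * (y ^ j mod q)) mod q = (x + z * y ^ j) mod q" for x z
      unfolding mod_add_left_eq by (subst (1 2) mod_add_right_eq[symmetric]) (simp only: mod_mult_right_eq)
    then show ?thesis unfolding acc_def by simp
  qed
  have yp: "y ^ j mod q * y mod q = y ^ Suc j mod q" for j by (simp add: mod_simps mult.commute)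
  have idiv: "i div 2 ^ j < B" for j using iyv machine_bounds(3) div_le_dividend[of i "2 ^ j"] by linarith
  have loop: "runs m B (While ?e (Seq power_prog ?p)) s1 (L * (3 * r + 8) + 1)
     (\<lambda>s'. same_except ?A s s' \<and> imem s' 13 = hval i y v)" if "I 0 s1" for s1
  proof (rule runs_While_count[where I = I and N = L and Tb = "3 * r + 7"])
    fix j s' assume j: "j < L" and I: "I j s'"
    have s': "imem s' 4 = L" "imem s' 12 = v" "imem s' 16 = j" using I s by (auto simp: I_def same_except_def)
    have jq: "j \<le> q" using j bounds_by_q by linarith
    have jv: "j ^ v * q \<le> M" using power_le_M[OF jq, of v] iyv by simp
    have jv1: "j ^ v * 1 \<le> j ^ v * q" using q_pos by (intro mult_le_mono2) simp
    have yq: "y ^ j mod q < q" using q_pos by simp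
    have bit: "i div 2 ^ j mod 2 \<le> 1" by simp
    have b1: "i div 2 ^ j mod 2 * j ^ v \<le> j ^ v" using mult_le_mono1[OF bit, of "j ^ v"] by simp
    have b2: "i div 2 ^ j mod 2 * j ^ v * (y ^ j mod q) \<le> j ^ v * q"
      using mult_le_mono[OF b1, of "y ^ j mod q" q] yq by simp
    have qq: "y ^ j mod q * y \<le> q * q" using yq iyv by (intro mult_le_mono) auto
    have qM: "q * q \<le> M * q" using q_le_M by (intro mult_le_mono1)
    have MMq: "M \<le> M * q" using q_pos by simp
    have ok: "i div 2 ^ j mod 2 * j ^ v < B" "i div 2 ^ j mod 2 * j ^ v * (y ^ j mod q) < B"
      "acc j + i div 2 ^ j mod 2 * j ^ v * (y ^ j mod q) < B" "y ^ j mod q * y < B" "j ^ v < B"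
      "y ^ j mod q < B" "acc j < B" "j < B" "Suc j < B" "y < B"
      using b1 b2 qq qM jv jv1 MMq acc_less[of j] machine_bounds yq j iyv by linarith+
    have body: "runs m B ?p s2 4 (I (Suc j))"
      if "same_except {17, 18} s' s2" "imem s2 17 = j ^ v" for s2
    proof -
      have s2: "imem s2 13 = acc j" "imem s2 14 = i div 2 ^ j" "imem s2 15 = y ^ j mod q" "imem s2 16 = j"
        "imem s2 8 = q" "imem s2 9 = y" "imem s2 17 = j ^ v" "same_except ?A s s2"
        using that I s by (auto simp: I_def same_except_def)
      show ?thesis
      proof (intro runs_IAssign_Seq runs_IAssign)
      qed (use s2 ok mm idiv acc_Suc[of j] yp[of j]
          in \<open>auto simp: I_def div_mult2_eq mult.commute[of 2] intro!: same_except_upd same_except_imem_id\<close>)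
    qed
    have "runs m B (Seq power_prog ?p) s' (3 * r + 7) (I (Suc j))"
      by (rule runs_Seq[OF runs_power_prog[OF s'(2,3)] body]) (use iyv j in auto)
    then show "bok m B s' ?e \<and> bval s' ?e \<and> runs m B (Seq power_prog ?p) s' (3 * r + 7) (I (Suc j))"
      using s' j mm by simp
  next
    fix s' assume I: "I L s'"
    have s': "imem s' 4 = L" using I s by (auto simp: I_def same_except_def)
    show "bok m B s' ?e \<and> \<not> bval s' ?e \<and> same_except ?A s s' \<and> imem s' 13 = hval i y v"
      using I s' mm by (auto simp: I_def acc_def hval_def)
  qed (use that in auto)
  have iB: "i < B" using iyv machine_bounds by simp
  show ?thesis unfolding eval_prog_def
    by (intro runs_IAssign_Seq runs_weaken[OF loop])
      (use mm s iB q_pos in \<open>auto simp: I_def acc_def intro!: same_except_upd same_except_imem_id same_except_refl\<close>)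
qed

definition bucket_time :: nat where
  "bucket_time = r * (L * (3 * r + 8) + 8) + 3"

lemma runs_bucket_prog:
  assumes s: "imem s 1 = i" "imem s 4 = L" "imem s 6 = r" "imem s 8 = q" "imem s 9 = y"
    and iy: "i < n" "y < q"
  shows "runs m B bucket_prog s bucket_time
     (\<lambda>s'. same_except {10, 12, 13, 14, 15, 16, 17, 18} s s' \<and> imem s' 10 = bucket i y)"
proof -
  let ?A = "{10, 12, 13, 14, 15, 16, 17, 18}"
  define I where "I v s' \<longleftrightarrow> same_except ?A s s' \<and> imem s' 10 = bucket_upto i y v \<and> imem s' 12 = v" for v s'
  let ?e = "ILess (reg 12) (reg 6)"
  let ?p = "Seq (assign 10 (IAdd (IMul (reg 10) (reg 8)) (reg 13))) (assign 12 (IAdd (reg 12) (INum 1)))"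
  have mm: "19 < m" "99 < B" "q < B" "r < B" using machine_bounds by auto
  have loop: "runs m B (While ?e (Seq eval_prog ?p)) s1 (r * (L * (3 * r + 8) + 8) + 1)
     (\<lambda>s'. same_except ?A s s' \<and> imem s' 10 = bucket i y)" if "I 0 s1" for s1
  proof (rule runs_While_count[where I = I and N = r and Tb = "L * (3 * r + 8) + 7"])
    fix v s' assume v: "v < r" and I: "I v s'"
    have s': "imem s' 1 = i" "imem s' 4 = L" "imem s' 6 = r" "imem s' 8 = q" "imem s' 9 = y" "imem s' 12 = v"
      using I s by (auto simp: I_def same_except_def)
    have "bucket_upto i y (Suc v) < M" "bucket_upto i y v < M" "hval i y v < q"
      using iy v by (auto intro!: bucket_upto_less_M hval_less simp del: bucket_upto.simps)
    then have ok: "bucket_upto i y v * q + hval i y v < B" "bucket_upto i y v * q < B" "bucket_upto i y v < B"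
      "hval i y v < B" "v < B" "Suc v < B"
      using machine_bounds v by auto
    have body: "runs m B ?p s2 2 (I (Suc v))"
      if "same_except {13, 14, 15, 16, 17, 18} s' s2 \<and> imem s2 13 = hval i y v" for s2
    proof -
      have s2: "imem s2 8 = q" "imem s2 10 = bucket_upto i y v" "imem s2 12 = v" "imem s2 13 = hval i y v"
        "same_except ?A s s2"
        using that I s by (auto simp: I_def same_except_def)
      show ?thesis
      proof (intro runs_IAssign_Seq runs_IAssign)
      qed (use s2 ok mm in \<open>auto simp: I_def intro!: same_except_upd same_except_imem_id\<close>)
    qed
    have "runs m B (Seq eval_prog ?p) s' (L * (3 * r + 8) + 7) (I (Suc v))"
      by (rule runs_Seq[OF runs_eval_prog[OF s'(1,2,4,5,6) iy v] body]) auto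
    then show "bok m B s' ?e \<and> bval s' ?e \<and> runs m B (Seq eval_prog ?p) s' (L * (3 * r + 8) + 7) (I (Suc v))"
      using s' v mm by simp
  next
    fix s' assume I: "I r s'"
    have s': "imem s' 6 = r" using I s by (auto simp: I_def same_except_def)
    show "bok m B s' ?e \<and> \<not> bval s' ?e \<and> same_except ?A s s' \<and> imem s' 10 = bucket i y"
      using I s' mm by (auto simp: I_def bucket_def)
  qed (use that in auto)
  have yB: "y < B" using iy mm by simp
  show ?thesis unfolding bucket_prog_def
    by (intro runs_IAssign_Seq runs_weaken[OF loop])
      (use mm s yB in \<open>auto simp: I_def bucket_time_def intro!: same_except_upd same_except_imem_id same_except_refl\<close>)
qed

definition update_time :: nat where
  "update_time = setup_time + q * (bucket_time + 3) + 3"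

lemma runs_update_prog:
  assumes s: "imem s 0 = n" "rmem s 0 = \<epsilon>" "imem s 1 = i" and i: "i < n"
  shows "runs m B (update_prog a b c) s update_time
     (\<lambda>s'. imem s' 0 = n \<and> rmem s' 0 = \<epsilon> \<and> rmem s' 3 = rmem s 3 + rmem s 2 \<and>
       (\<forall>p. rmem s' (4 + p) = rmem s (4 + p) + (\<Sum>y\<in>{1..<q}. if bucket i y = p then rmem s 2 else 0)))"
proof -
  \<comment> \<open>\<open>x\<close> counts the finished places \<open>1, ..., x\<close>, so cell 9
    holds the next one, \<open>Suc x\<close>.\<close>
  define I where "I x s' \<longleftrightarrow> imem s' 0 = n \<and> imem s' 1 = i \<and> imem s' 4 = L \<and> imem s' 6 = r \<and> imem s' 8 = q \<and>
     imem s' 9 = Suc x \<and> rmem s' 0 = \<epsilon> \<and> rmem s' 2 = rmem s 2 \<and> rmem s' 3 = rmem s 3 + rmem s 2 \<and>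
     (\<forall>p. rmem s' (4 + p) = rmem s (4 + p) + (\<Sum>y\<in>{1..<Suc x}. if bucket i y = p then rmem s 2 else 0))" for x and s' :: state
  let ?Q = "\<lambda>s'. imem s' 0 = n \<and> rmem s' 0 = \<epsilon> \<and> rmem s' 3 = rmem s 3 + rmem s 2 \<and>
       (\<forall>p. rmem s' (4 + p) = rmem s (4 + p) + (\<Sum>y\<in>{1..<q}. if bucket i y = p then rmem s 2 else 0))"
  let ?e = "ILess (reg 9) (reg 8)"
  let ?p = "Seq (RAssign (IAdd (INum 4) (reg 10)) (RAdd (RCell (IAdd (INum 4) (reg 10))) (RCell (INum 2))))
         (assign 9 (IAdd (reg 9) (INum 1)))"
  have mm: "19 < m" "99 < B" "q < B" using machine_bounds by auto
  have loop: "runs m B (While ?e (Seq bucket_prog ?p)) s1 (q * (bucket_time + 3) + 1) ?Q" if "I 0 s1" for s1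
  proof (rule runs_While_count[where I = I and N = "q - 1" and Tb = "bucket_time + 2"])
    fix x s' assume x: "x < q - 1" and I: "I x s'"
    have xq: "Suc x < q" using x by simp
    have bl: "bucket i (Suc x) < M" using bucket_less[OF xq] .
    then have ok: "4 + bucket i (Suc x) < B" "4 + bucket i (Suc x) < m" "bucket i (Suc x) < B" "Suc x < B" "Suc (Suc x) < B"
      using machine_bounds xq by auto
    have body: "runs m B ?p s2 2 (I (Suc x))"
      if "same_except {10, 12, 13, 14, 15, 16, 17, 18} s' s2 \<and> imem s2 10 = bucket i (Suc x)" for s2
    proof -
      have s2: "imem s2 0 = n" "imem s2 1 = i" "imem s2 4 = L" "imem s2 6 = r" "imem s2 8 = q" "imem s2 9 = Suc x"
        "imem s2 10 = bucket i (Suc x)" "rmem s2 = rmem s'"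
        using that I by (auto simp: I_def same_except_def)
      have upd: "I (Suc x) (s2\<lparr>rmem := (rmem s2)(4 + bucket i (Suc x) := rmem s2 (4 + bucket i (Suc x)) + rmem s2 2),
         imem := (imem s2)(9 := Suc (Suc x))\<rparr>)"
        using I s2 by (auto simp: I_def)
      show ?thesis
      proof (intro runs_RAssign_Seq runs_IAssign)
      qed (use s2 ok mm upd in auto)
    qed
    have s': "imem s' 1 = i" "imem s' 4 = L" "imem s' 6 = r" "imem s' 8 = q" "imem s' 9 = Suc x"
      using I by (auto simp: I_def)
    have "runs m B (Seq bucket_prog ?p) s' (bucket_time + 2) (I (Suc x))"
      by (rule runs_Seq[OF runs_bucket_prog[OF s' i xq] body]) auto
    then show "bok m B s' ?e \<and> bval s' ?e \<and> runs m B (Seq bucket_prog ?p) s' (bucket_time + 2) (I (Suc x))"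
      using s' xq mm by simp
  next
    fix s' assume I: "I (q - 1) s'"
    then show "bok m B s' ?e \<and> \<not> bval s' ?e \<and> ?Q s'"
      using mm q_pos by (auto simp: I_def)
  next
    have "bucket_time + 2 + 1 = bucket_time + 3" by simp
    then show "(q - 1) * (bucket_time + 2 + 1) + 1 \<le> q * (bucket_time + 3) + 1"
      by (simp only:) (intro add_le_mono1 mult_le_mono1, simp)
  qed (use that in auto)
  show ?thesis unfolding update_prog_def
  proof (rule runs_Seq[OF runs_setup_prog[OF s(1,2)]])
    fix s' assume a: "same_except {2, 3, 4, 5, 6, 7, 8, 11} s s' \<and> imem s' 4 = L \<and> imem s' 6 = r \<and> imem s' 8 = q"
    show "runs m B (Seq (RAssign (INum 3) (RAdd (RCell (INum 3)) (RCell (INum 2)))) (Seq (assign 9 (INum 1))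
         (While ?e (Seq bucket_prog ?p)))) s' (q * (bucket_time + 3) + 3) ?Q"
      by (intro runs_RAssign_Seq runs_IAssign_Seq runs_weaken[OF loop])
        (use mm s a in \<open>auto simp: I_def same_except_def\<close>)
  qed (simp add: update_time_def)
qed

definition passes :: "state \<Rightarrow> nat \<Rightarrow> bool" where
  "passes s i \<longleftrightarrow> (\<forall>y\<in>{1..<q}. \<epsilon> * rmem s 3 \<le> rmem s (4 + bucket i y))"

lemma runs_test_prog:
  assumes s: "imem s 1 = i" "imem s 4 = L" "imem s 6 = r" "imem s 8 = q" "rmem s 0 = \<epsilon>"
    and i: "i < n"
  shows "runs m B test_prog s (q * (bucket_time + 4) + 3)
     (\<lambda>s'. same_except {9, 10, 12, 13, 14, 15, 16, 17, 18, 19} s s' \<and> imem s' 19 = (if passes s i then 1 else 0))"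
proof -
  let ?A = "{9, 10, 12, 13, 14, 15, 16, 17, 18, 19}"
  define ps where "ps x \<longleftrightarrow> (\<forall>y\<in>{1..<Suc x}. \<epsilon> * rmem s 3 \<le> rmem s (4 + bucket i y))" for x
  have ps_Suc: "ps (Suc x) \<longleftrightarrow> ps x \<and> \<epsilon> * rmem s 3 \<le> rmem s (4 + bucket i (Suc x))" for x
    unfolding ps_def by (auto simp: less_Suc_eq)
  define I where "I x s' \<longleftrightarrow> same_except ?A s s' \<and> imem s' 9 = Suc x \<and> imem s' 19 = (if ps x then 1 else 0)" for x s'
  let ?Q = "\<lambda>s'. same_except ?A s s' \<and> imem s' 19 = (if passes s i then 1 else 0)"
  let ?e = "ILess (reg 9) (reg 8)"
  let ?p = "Seq (Cond (RLess (RCell (IAdd (INum 4) (reg 10))) (RMul (RCell (INum 0)) (RCell (INum 3))))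
              (assign 19 (INum 0)) Skip)
         (assign 9 (IAdd (reg 9) (INum 1)))"
  have mm: "19 < m" "99 < B" "q < B" using machine_bounds by auto
  have loop: "runs m B (While ?e (Seq bucket_prog ?p)) s1 (q * (bucket_time + 4) + 1) ?Q" if "I 0 s1" for s1
  proof (rule runs_While_count[where I = I and N = "q - 1" and Tb = "bucket_time + 3"])
    fix x s' assume x: "x < q - 1" and I: "I x s'"
    have xq: "Suc x < q" using x by simp
    have bl: "bucket i (Suc x) < M" using bucket_less[OF xq] .
    then have ok: "4 + bucket i (Suc x) < B" "4 + bucket i (Suc x) < m" "bucket i (Suc x) < B" "Suc x < B" "Suc (Suc x) < B"
      using machine_bounds xq by auto
    have body: "runs m B ?p s2 3 (I (Suc x))"
      if "same_except {10, 12, 13, 14, 15, 16, 17, 18} s' s2 \<and> imem s2 10 = bucket i (Suc x)" for s2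
    proof -
      have s2: "imem s2 9 = Suc x" "imem s2 10 = bucket i (Suc x)" "rmem s2 = rmem s" "same_except ?A s s2"
        "imem s2 19 = (if ps x then 1 else 0)"
        using that I by (auto simp: I_def same_except_def)
      define J where "J s' \<longleftrightarrow> same_except ?A s s' \<and> imem s' 9 = Suc x \<and> imem s' 19 = (if ps (Suc x) then 1 else 0)" for s'
      show ?thesis
      proof (rule runs_Seq[where R = J and ?T1.0 = 2 and ?T2.0 = 1])
        show "runs m B (Cond (RLess (RCell (IAdd (INum 4) (reg 10))) (RMul (RCell (INum 0)) (RCell (INum 3))))
              (assign 19 (INum 0)) Skip) s2 2 J"
        proof (intro runs_Cond runs_IAssign runs_Skip)
        qed (use s2 ok mm s ps_Suc[of x] in \<open>auto simp: J_def intro!: same_except_upd same_except_imem_id\<close>)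
        fix s3 assume "J s3"
        then show "runs m B (assign 9 (IAdd (reg 9) (INum 1))) s3 1 (I (Suc x))"
          by (intro runs_IAssign) (use ok mm in \<open>auto simp: I_def J_def intro!: same_except_upd same_except_imem_id\<close>)
      qed simp
    qed
    have s': "imem s' 1 = i" "imem s' 4 = L" "imem s' 6 = r" "imem s' 8 = q" "imem s' 9 = Suc x"
      using I s by (auto simp: I_def same_except_def)
    have "runs m B (Seq bucket_prog ?p) s' (bucket_time + 3) (I (Suc x))"
      by (rule runs_Seq[OF runs_bucket_prog[OF s' i xq] body]) auto
    then show "bok m B s' ?e \<and> bval s' ?e \<and> runs m B (Seq bucket_prog ?p) s' (bucket_time + 3) (I (Suc x))"
      using s' xq mm by simp
  next
    fix s' assume I: "I (q - 1) s'"
    have s': "imem s' 8 = q" using I s by (auto simp: I_def same_except_def)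
    have "Suc (q - 1) = q" using q_pos by simp
    then have "ps (q - 1) = passes s i" unfolding ps_def passes_def by simp
    then show "bok m B s' ?e \<and> \<not> bval s' ?e \<and> ?Q s'"
      using I s' mm q_pos by (auto simp: I_def)
  next
    have "bucket_time + 3 + 1 = bucket_time + 4" by simp
    then show "(q - 1) * (bucket_time + 3 + 1) + 1 \<le> q * (bucket_time + 4) + 1"
      by (simp only:) (intro add_le_mono1 mult_le_mono1, simp)
  qed (use that in auto)
  show ?thesis unfolding test_prog_def
    by (intro runs_IAssign_Seq runs_weaken[OF loop])
      (use mm in \<open>auto simp: I_def ps_def intro!: same_except_upd same_except_imem_id same_except_refl\<close>)
qed

definition query_time :: nat where
  "query_time = setup_time + n * (q * (bucket_time + 4) + 7) + 2"

lemma runs_query_prog: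
  assumes s: "imem s 0 = n" "rmem s 0 = \<epsilon>" "out s = []"
  shows "runs m B (query_prog a b c) s query_time
     (\<lambda>s'. out s' = filter (\<lambda>i. 0 < rmem s 3 \<and> passes s i) [0..<n])"
proof -
  define P where "P i \<longleftrightarrow> 0 < rmem s 3 \<and> passes s i" for i
  define I where "I x s' \<longleftrightarrow> imem s' 0 = n \<and> imem s' 1 = x \<and> imem s' 4 = L \<and> imem s' 6 = r \<and> imem s' 8 = q \<and>
     rmem s' = rmem s \<and> out s' = filter P [0..<x]" for x and s' :: state
  let ?e = "ILess (reg 1) (reg 0)"
  let ?p = "Seq (Cond (BAnd (ILess (INum 0) (reg 19)) (RLess (ROfInt (INum 0)) (RCell (INum 3))))
              (Emit (reg 1)) Skip)
         (assign 1 (IAdd (reg 1) (INum 1)))"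
  have mm: "19 < m" "99 < B" "q < B" "n < B" using machine_bounds by auto
  have loop: "runs m B (While ?e (Seq test_prog ?p)) s1 (n * (q * (bucket_time + 4) + 7) + 1)
     (\<lambda>s'. out s' = filter P [0..<n])" if "I 0 s1" for s1
  proof (rule runs_While_count[where I = I and N = n and Tb = "q * (bucket_time + 4) + 6"])
    fix x s' assume x: "x < n" and I: "I x s'"
    have xB: "x < B" "Suc x < B" using x mm by auto
    have body: "runs m B ?p s2 3 (I (Suc x))"
      if "same_except {9, 10, 12, 13, 14, 15, 16, 17, 18, 19} s' s2 \<and> imem s2 19 = (if passes s' x then 1 else 0)" for s2
    proof -
      have ps: "passes s' x = passes s x" using I by (simp add: passes_def I_def)
      have s2: "imem s2 0 = n" "imem s2 1 = x" "imem s2 4 = L" "imem s2 6 = r" "imem s2 8 = q" "rmem s2 = rmem s"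
        "out s2 = filter P [0..<x]" "imem s2 19 = (if passes s x then 1 else 0)"
        using that I ps by (auto simp: I_def same_except_def)
      define J where "J s' \<longleftrightarrow> imem s' 0 = n \<and> imem s' 1 = x \<and> imem s' 4 = L \<and> imem s' 6 = r \<and> imem s' 8 = q \<and>
        rmem s' = rmem s \<and> out s' = filter P [0..<Suc x]" for s' :: state
      show ?thesis
      proof (rule runs_Seq[where R = J and ?T1.0 = 2 and ?T2.0 = 1])
        show "runs m B (Cond (BAnd (ILess (INum 0) (reg 19)) (RLess (ROfInt (INum 0)) (RCell (INum 3))))
              (Emit (reg 1)) Skip) s2 2 J"
        proof (intro runs_Cond runs_Emit runs_Skip)
        qed (use s2 mm xB in \<open>auto simp: J_def P_def split: if_splits\<close>)
        fix s3 assume "J s3"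
        then show "runs m B (assign 1 (IAdd (reg 1) (INum 1))) s3 1 (I (Suc x))"
          by (intro runs_IAssign) (use xB mm in \<open>auto simp: I_def J_def\<close>)
      qed simp
    qed
    have s': "imem s' 1 = x" "imem s' 4 = L" "imem s' 6 = r" "imem s' 8 = q" "rmem s' 0 = \<epsilon>"
      using I s by (auto simp: I_def)
    have "runs m B (Seq test_prog ?p) s' (q * (bucket_time + 4) + 6) (I (Suc x))"
      by (rule runs_Seq[OF runs_test_prog[OF s' x] body]) auto
    then show "bok m B s' ?e \<and> bval s' ?e \<and> runs m B (Seq test_prog ?p) s' (q * (bucket_time + 4) + 6) (I (Suc x))"
      using I x mm xB by (simp add: I_def)
  next
    fix s' assume I: "I n s'"
    then show "bok m B s' ?e \<and> \<not> bval s' ?e \<and> out s' = filter P [0..<n]"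
      using mm by (auto simp: I_def)
  qed (use that in auto)
  have "runs m B (query_prog a b c) s query_time (\<lambda>s'. out s' = filter P [0..<n])"
    unfolding query_prog_def
  proof (rule runs_Seq[OF runs_setup_prog[OF s(1,2)]])
    fix s' assume a: "same_except {2, 3, 4, 5, 6, 7, 8, 11} s s' \<and> imem s' 4 = L \<and> imem s' 6 = r \<and> imem s' 8 = q"
    show "runs m B (Seq (assign 1 (INum 0)) (While ?e (Seq test_prog ?p))) s' (n * (q * (bucket_time + 4) + 7) + 2)
         (\<lambda>s'. out s' = filter P [0..<n])"
      by (intro runs_IAssign_Seq runs_weaken[OF loop])
        (use mm s a in \<open>auto simp: I_def same_except_def\<close>)
  qed (simp add: query_time_def)
  then show ?thesis unfolding P_def .
qed

end

section \<open>Correctness of the sketch\<close>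

context sketch
begin

definition bit_poly :: "nat \<Rightarrow> int poly" where
  "bit_poly i = (\<Sum>j<L. monom (int (i div 2 ^ j mod 2)) j)"

lemma coeff_bit_poly: "coeff (bit_poly i) j = (if j < L then int (i div 2 ^ j mod 2) else 0)"
  unfolding bit_poly_def by (simp add: coeff_sum)

lemma degree_bit_poly: "degree (bit_poly i) \<le> L - 1"
  by (rule degree_le) (use L_pos in \<open>auto simp: coeff_bit_poly\<close>)

lemma poly_euler_op_bit_poly:
  "poly ((euler_op ^^ v) (bit_poly i)) y = (\<Sum>j<L. int (i div 2 ^ j mod 2) * int j ^ v * y ^ j)"
proof -
  have "(euler_op ^^ v) (bit_poly i) = (\<Sum>j<L. monom (int (i div 2 ^ j mod 2) * int j ^ v) j)"
    by (rule poly_eqI) (auto simp: coeff_euler_op_pow coeff_bit_poly coeff_sum)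
  then show ?thesis by (simp add: poly_sum poly_monom)
qed

text \<open>Two bits differ by at most 1, which is less than \<open>q\<close>, so congruent bits are
  equal; and \<open>L\<close> bits determine a number below \<open>n\<close>.\<close>

lemma bit_poly_cong_imp_eq:
  assumes "[:int q:] dvd bit_poly i - bit_poly j" "i < n" "j < n"
  shows "i = j"
proof -
  have eq: "i div 2 ^ k mod 2 = j div 2 ^ k mod 2" if "k < L" for k
  proof -
    have "int q dvd coeff (bit_poly i - bit_poly j) k" using assms(1) by (simp add: const_poly_dvd_iff)
    then have "int q dvd int (i div 2 ^ k mod 2) - int (j div 2 ^ k mod 2)" using that by (simp add: coeff_bit_poly)
    moreover have "\<bar>int (i div 2 ^ k mod 2) - int (j div 2 ^ k mod 2)\<bar> < int q"
      using q_pos by (cases "even (i div 2 ^ k)"; cases "even (j div 2 ^ k)") (auto simp: even_iff_mod_2_eq_zero odd_iff_mod_2_eq_one)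
    ultimately have "int (i div 2 ^ k mod 2) - int (j div 2 ^ k mod 2) = 0"
      using dvd_imp_le_int[of "int (i div 2 ^ k mod 2) - int (j div 2 ^ k mod 2)" "int q"] by auto
    then show ?thesis by simp
  qed
  have "take_bit L i = i" "take_bit L j = j" using assms n_le by (auto intro!: take_bit_nat_eq_self)
  moreover have "bit i k \<longleftrightarrow> bit j k" if "k < L" for k
    using eq[OF that] by (simp add: bit_iff_odd odd_iff_mod_2_eq_one)
  then have "take_bit L i = take_bit L j"
    by (intro bit_eqI) (auto simp: bit_take_bit_iff)
  ultimately show ?thesis by metis
qed

text \<open>Uniqueness of digits in base \<open>q\<close>: hash values are below
  \<open>q\<close>.\<close>

lemma bucket_upto_eqD:
  assumes "bucket_upto i y v = bucket_upto i' y' v"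
  shows "y = y' \<and> (\<forall>u<v. hval i y u = hval i' y' u)"
  using assms
proof (induction v)
  case (Suc v)
  have "(bucket_upto i y v * q + hval i y v) div q = bucket_upto i y v" for i y
    using hval_less[of i y v] by simp
  moreover have "(bucket_upto i y v * q + hval i y v) mod q = hval i y v" for i y
    using hval_less[of i y v] by simp
  ultimately have "bucket_upto i y v = bucket_upto i' y' v" "hval i y v = hval i' y' v"
    using Suc.prems by (metis bucket_upto.simps(2))+
  then show ?case using Suc.IH by (auto simp: less_Suc_eq)
qed simp

lemma mult_point_bit_poly_Suc:
  "poly (mult_coords (bit_poly i) (Suc v)) (int y) mod int q = int (hval i y v)"
  by (simp add: mult_coords_def poly_euler_op_bit_poly hval_def of_nat_mod)

lemma bucket_eq_imp_mult_point_eq: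
  assumes "bucket i y = bucket i' y'"
  shows "mult_point q r (bit_poly i) y = mult_point q r (bit_poly i') y'"
proof -
  have *: "y = y'" "\<And>u. u < r \<Longrightarrow> hval i y u = hval i' y' u"
    using bucket_upto_eqD assms unfolding bucket_def by blast+
  show ?thesis unfolding mult_point_def
  proof (rule restrict_ext)
    fix j assume j: "j \<in> {..r}"
    show "poly (mult_coords (bit_poly i) j) (int y) mod int q = poly (mult_coords (bit_poly i') j) (int y') mod int q"
    proof (cases j)
      case 0
      then show ?thesis using * by (simp add: mult_coords_def)
    next
      case (Suc v)
      then show ?thesis using * j by (simp only: mult_point_bit_poly_Suc) simp
    qed
  qed
qed

text \<open>Expansion gives every member of \<open>F\<close> at least \<open>(q - 1) / 2\<close>
  buckets on average, so \<open>(q - 1) * 2 ^ lk\<close> buckets leave room for only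
  \<open>2 * 2 ^ lk\<close> members.\<close>

lemma card_le_of_few_buckets:
  assumes F: "F \<subseteq> {..<n}"
    and few: "card (\<Union>i\<in>F. bucket i ` {1..<q}) \<le> (q - 1) * 2 ^ lk"
  shows "card F \<le> 2 * 2 ^ lk"
proof -
  let ?GB = "\<Union>i\<in>F. bucket i ` {1..<q}"
  let ?GP = "\<Union>i\<in>F. mult_point q r (bit_poly i) ` {1..<q}"
  \<comment> \<open>\<open>a0\<close> exceeds \<open>(q - 1) / 4\<close>, so together with
    \<open>d ^ r >= 4 * 2 ^ lk\<close> there are more monomials than points; yet the degree
    \<open>a0 - 1\<close> in \<open>X\<close> costs at most a quarter of the places.\<close>
  define a0 where "a0 = (q - 1) div 4 + 1"
  have finF: "finite F" using F finite_subset by blast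
  \<comment> \<open>A decoding map from bucket numbers to points: it bounds the number of points by
    the number of buckets.\<close>
  obtain h where h: "\<And>i y. h (bucket i y) = mult_point q r (bit_poly i) y"
  proof
    fix i y
    have "(SOME p. \<exists>i' y'. bucket i' y' = bucket i y \<and> p = mult_point q r (bit_poly i') y') = mult_point q r (bit_poly i) y"
      by (rule some_equality) (use bucket_eq_imp_mult_point_eq in blast)+
    then show "(\<lambda>b. SOME p. \<exists>i' y'. bucket i' y' = b \<and> p = mult_point q r (bit_poly i') y') (bucket i y) = mult_point q r (bit_poly i) y" .
  qed
  have "?GP = h ` ?GB" by (simp add: image_UN image_image h)
  then have GPB: "card ?GP \<le> card ?GB" using finF by (metis card_image_le finite_UN_I finite_atLeastLessThan finite_imageI)
  have dr: "4 * 2 ^ lk \<le> d ^ r"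
  proof -
    have "(2::nat) ^ (lk + 2) \<le> 2 ^ (g * r)" using g_ge by (intro power_increasing) auto
    then show ?thesis by (simp add: d_def power_mult)
  qed
  have a4: "q - 1 < 4 * a0" "4 * (a0 - 1) \<le> q - 1" using div_mult_mod_eq[of "q - 1" 4] mod_less_divisor[of 4 "q - 1"]
    by (auto simp: a0_def)
  have "(q - 1) * 2 ^ lk < 4 * a0 * 2 ^ lk" using a4 by simp
  also have "\<dots> \<le> a0 * d ^ r" using mult_le_mono2[OF dr, of a0] by (simp add: mult_ac)
  finally have lt: "card ?GP < a0 * d ^ r" using few GPB by linarith
  \<comment> \<open>The degree bound of the expansion. Both summands are at most
    \<open>(q - 1) / 4\<close>, the second one by the lower bound for \<open>q\<close>.\<close>
  define Dg where "Dg = (a0 - 1) + r * ((d - 1) * (L - 1))"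
  have Dg: "2 * Dg \<le> q - 1"
  proof -
    define u where "u = r * ((d - 1) * (L - 1))"
    have "u \<le> r * (d * L)" unfolding u_def by (intro mult_le_mono) auto
    moreover have "4 * (r * (d * L)) \<le> q - 1" using q_ge by (simp add: mult.assoc)
    ultimately have "4 * u \<le> q - 1" by linarith
    moreover have "2 * (v + u) \<le> x" if "4 * u \<le> x" "4 * v \<le> x" for v x :: nat using that by simp
    ultimately show ?thesis unfolding Dg_def u_def[symmetric] using a4(2) by blast
  qed
  have "card F * (q - 1 - Dg) \<le> card ?GP"
    unfolding Dg_def
  proof (rule multiplicity_code_expansion[OF q_prime _ _ finF degree_bit_poly])
    show "L - 1 < q" "d \<le> q" using bounds_by_q by linarith+
    have "Dg < q - 1" using Dg q_pos by linarith
    then show "(a0 - 1) + r * ((d - 1) * (L - 1)) < q - 1" unfolding Dg_def .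
    show "i = j" if "i \<in> F" "j \<in> F" "[:int q:] dvd bit_poly i - bit_poly j" for i j
      using bit_poly_cong_imp_eq[OF that(3)] that(1,2) F by auto
    show "card ?GP < a0 * d ^ r" by (rule lt)
  qed
  then have "card F * (q - 1 - Dg) \<le> (q - 1) * 2 ^ lk" using GPB few by linarith
  then have "2 * (card F * (q - 1 - Dg)) \<le> (q - 1) * (2 * 2 ^ lk)" by simp
  moreover have "card F * (q - 1) \<le> card F * (2 * (q - 1 - Dg))" using Dg by (intro mult_le_mono2) linarith
  moreover have "card F * (2 * (q - 1 - Dg)) = 2 * (card F * (q - 1 - Dg))" by (simp only: mult_ac)
  ultimately have "card F * (q - 1) \<le> (q - 1) * (2 * 2 ^ lk)" by (simp only:)
  then have "(q - 1) * card F \<le> (q - 1) * (2 * 2 ^ lk)" by (simp only: mult.commute)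
  moreover have "0 < q - 1" using q_pos by simp
  ultimately show ?thesis by (simp only: mult_le_cancel1)
qed

section \<open>Weights of buckets and the size of the reported set\<close>

definition load :: "(nat \<Rightarrow> real) \<Rightarrow> nat \<Rightarrow> real" where
  "load x p = (\<Sum>i<n. \<Sum>y\<in>{1..<q}. if bucket i y = p then x i else 0)"

definition candidates :: "(nat \<Rightarrow> real) \<Rightarrow> nat set" where
  "candidates x = {i. i < n \<and> (\<forall>y\<in>{1..<q}. \<epsilon> * (\<Sum>j<n. x j) \<le> load x (bucket i y))}"

text \<open>This is where the strict turnstile model is needed: other coordinates in the bucket
  cannot cancel \<open>x i\<close>.\<close>

lemma load_ge:
  assumes "\<And>i. i < n \<Longrightarrow> 0 \<le> x i" "i < n" "y \<in> {1..<q}"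
  shows "x i \<le> load x (bucket i y)"
proof -
  have "x i = (\<Sum>y'\<in>{y}. if bucket i y' = bucket i y then x i else 0)" by simp
  also have "\<dots> \<le> (\<Sum>y'\<in>{1..<q}. if bucket i y' = bucket i y then x i else 0)"
    using assms by (intro sum_mono2) auto
  also have "\<dots> \<le> load x (bucket i y)"
    unfolding load_def using assms
    by (intro member_le_sum[where f = "\<lambda>i'. \<Sum>y'\<in>{1..<q}. if bucket i' y' = bucket i y then x i' else 0"])
      (auto intro!: sum_nonneg)
  finally show ?thesis .
qed

lemma heavy_subset_candidates:
  assumes "\<And>i. i < n \<Longrightarrow> 0 \<le> x i"
  shows "heavy_hitters n \<epsilon> x \<subseteq> candidates x"
proof
  fix i assume i: "i \<in> heavy_hitters n \<epsilon> x"
  have "l1_norm n x = (\<Sum>j<n. x j)" unfolding l1_norm_def using assms by (intro sum.cong) auto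
  then have "i < n" "\<epsilon> * (\<Sum>j<n. x j) \<le> x i" using i assms by (auto simp: heavy_hitters_def)
  then show "i \<in> candidates x" unfolding candidates_def using load_ge[of x i] assms order_trans by blast
qed

text \<open>For each of the \<open>q - 1\<close> places \<open>y\<close>, a coordinate falls into at
  most one bucket of \<open>G\<close>.\<close>

lemma sum_load_le:
  assumes "\<And>i. i < n \<Longrightarrow> 0 \<le> x i" "finite G"
  shows "(\<Sum>p\<in>G. load x p) \<le> real (q - 1) * (\<Sum>i<n. x i)"
proof -
  have "(\<Sum>p\<in>G. load x p) = (\<Sum>i<n. \<Sum>y\<in>{1..<q}. \<Sum>p\<in>G. if bucket i y = p then x i else 0)"
    unfolding load_def by (subst sum.swap, rule sum.cong[OF refl], subst sum.swap, rule refl)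
  also have "\<dots> \<le> (\<Sum>i<n. \<Sum>y\<in>{1..<q}. x i)"
    using assms by (intro sum_mono) auto
  also have "\<dots> = real (q - 1) * (\<Sum>i<n. x i)" by (simp add: sum_distrib_left)
  finally show ?thesis .
qed

text \<open>If \<open>lk\<close> stopped at the cap \<open>n\<close>, the bound is trivial.
  Otherwise \<open>2 ^ lk >= 1 / \<epsilon>\<close>, and since each bucket of a candidate carries an
  \<open>\<epsilon>\<close>-fraction of the total, there are at most \<open>(q - 1) * 2 ^ lk\<close>
  such buckets.\<close>

lemma card_candidates_le:
  assumes nn: "\<And>i. i < n \<Longrightarrow> 0 \<le> x i" and pos: "0 < (\<Sum>j<n. x j)"
  shows "card (candidates x) \<le> 2 * 2 ^ lk"
proof (cases "2 ^ lk < n")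
  case False
  have "card (candidates x) \<le> card {..<n}" by (rule card_mono) (auto simp: candidates_def)
  then show ?thesis using False by simp
next
  case True
  then have k: "1 \<le> 2 ^ lk * \<epsilon>" using lk_stop by simp
  let ?t = "\<Sum>j<n. x j"
  let ?G = "\<Union>i\<in>candidates x. bucket i ` {1..<q}"
  have fin: "finite (candidates x)" by (rule finite_subset[of _ "{..<n}"]) (auto simp: candidates_def)
  have "real (card ?G) * (\<epsilon> * ?t) = (\<Sum>p\<in>?G. \<epsilon> * ?t)" by simp
  also have "\<dots> \<le> (\<Sum>p\<in>?G. load x p)" by (rule sum_mono) (auto simp: candidates_def)
  also have "\<dots> \<le> real (q - 1) * ?t" using fin by (intro sum_load_le nn) auto
  finally have "(real (card ?G) * \<epsilon>) * ?t \<le> real (q - 1) * ?t" by (simp only: mult_ac)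
  then have "real (card ?G) * \<epsilon> \<le> real (q - 1)" using pos by simp
  then have "(real (card ?G) * \<epsilon>) * 2 ^ lk \<le> real (q - 1) * 2 ^ lk" by (intro mult_right_mono) auto
  moreover have "real (card ?G) * 1 \<le> real (card ?G) * (2 ^ lk * \<epsilon>)" using k by (intro mult_left_mono) auto
  moreover have "real (card ?G) * (2 ^ lk * \<epsilon>) = (real (card ?G) * \<epsilon>) * 2 ^ lk" by (simp only: mult_ac)
  ultimately have "real (card ?G) \<le> real (q - 1) * 2 ^ lk" by linarith
  then have "real (card ?G) \<le> real ((q - 1) * 2 ^ lk)" by simp
  then have "card ?G \<le> (q - 1) * 2 ^ lk" by (simp only: of_nat_le_iff)
  then show ?thesis by (intro card_le_of_few_buckets) (auto simp: candidates_def)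
qed

end

section \<open>The memory invariant along a stream\<close>

lemma stream_vec_snoc: "stream_vec (\<sigma> @ [(i, \<Delta>)]) j = stream_vec \<sigma> j + (if i = j then \<Delta> else 0)"
  by (simp add: stream_vec_def)

lemma strict_turnstile_snocD:
  assumes "strict_turnstile n (\<sigma> @ [(i, \<Delta>)])"
  shows "strict_turnstile n \<sigma>" "i < n"
proof -
  have "stream_vec (take k \<sigma>) j \<ge> 0" if "k \<le> length \<sigma>" "j < n" for k j
  proof -
    have "stream_vec (take k (\<sigma> @ [(i, \<Delta>)])) j \<ge> 0"
      using assms that unfolding strict_turnstile_def by (metis le_SucI length_append_singleton)
    then show ?thesis using that by simp
  qed
  then show "strict_turnstile n \<sigma>" "i < n" using assms by (auto simp: strict_turnstile_def)
qed

lemma strict_turnstile_nonneg: "strict_turnstile n \<sigma> \<Longrightarrow> i < n \<Longrightarrow> 0 \<le> stream_vec \<sigma> i"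
  unfolding strict_turnstile_def by (metis order_refl take_all)

context sketch_machine
begin

lemma load_snoc:
  assumes "i < n"
  shows "load (stream_vec (\<sigma> @ [(i, \<Delta>)])) p =
    load (stream_vec \<sigma>) p + (\<Sum>y\<in>{1..<q}. if bucket i y = p then \<Delta> else 0)"
proof -
  have "load (stream_vec (\<sigma> @ [(i, \<Delta>)])) p =
    (\<Sum>j<n. (\<Sum>y\<in>{1..<q}. if bucket j y = p then stream_vec \<sigma> j else 0) +
       (if i = j then \<Sum>y\<in>{1..<q}. if bucket i y = p then \<Delta> else 0 else 0))"
    unfolding load_def
  proof (rule sum.cong[OF refl])
    fix j assume "j \<in> {..<n}"
    show "(\<Sum>y\<in>{1..<q}. if bucket j y = p then stream_vec (\<sigma> @ [(i, \<Delta>)]) j else 0) =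
      (\<Sum>y\<in>{1..<q}. if bucket j y = p then stream_vec \<sigma> j else 0) +
       (if i = j then \<Sum>y\<in>{1..<q}. if bucket i y = p then \<Delta> else 0 else 0)"
      by (cases "i = j") (auto simp: stream_vec_snoc sum.distrib[symmetric] intro!: sum.cong)
  qed
  also have "\<dots> = load (stream_vec \<sigma>) p + (\<Sum>y\<in>{1..<q}. if bucket i y = p then \<Delta> else 0)"
    unfolding load_def sum.distrib using assms by simp
  finally show ?thesis .
qed

text \<open>All that has to survive between runs; the remaining cells may contain leftovers, as the
  parameters are recomputed each time.\<close>

definition represents :: "state \<Rightarrow> (nat \<Rightarrow> real) \<Rightarrow> bool" where
  "represents s x \<longleftrightarrow> imem s 0 = n \<and> rmem s 0 = \<epsilon> \<and> rmem s 3 = (\<Sum>j<n. x j) \<and> (\<forall>p. rmem s (4 + p) = load x p)"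

lemma processed_update_prog:
  assumes "strict_turnstile n \<sigma>" "real update_time \<le> T"
  shows "\<exists>s. processed m B T (update_prog a b c) (initial_state n \<epsilon> \<alpha>) \<sigma> s \<and> represents s (stream_vec \<sigma>)"
  using assms(1)
proof (induction \<sigma> rule: rev_induct)
  case Nil
  have "represents (initial_state n \<epsilon> \<alpha>) (stream_vec [])"
    by (auto simp: represents_def initial_state_def load_def stream_vec_def intro!: sum.neutral)
  then show ?case using processed_Nil by blast
next
  case (snoc u \<sigma>)
  obtain i \<Delta> where u: "u = (i, \<Delta>)" by (cases u)
  note st = strict_turnstile_snocD[OF snoc.prems[unfolded u]]
  obtain s where s: "processed m B T (update_prog a b c) (initial_state n \<epsilon> \<alpha>) \<sigma> s" "represents s (stream_vec \<sigma>)"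
    using snoc.IH st by blast
  let ?s = "load_update i \<Delta> s"
  have l: "imem ?s 0 = n" "rmem ?s 0 = \<epsilon>" "imem ?s 1 = i" "rmem ?s 2 = \<Delta>" "rmem ?s 3 = rmem s 3"
     "\<And>p. rmem ?s (4 + p) = rmem s (4 + p)"
    using s(2) by (auto simp: load_update_def represents_def)
  obtain t s' where s': "exec m B (update_prog a b c) ?s t s'" "t \<le> update_time"
    "imem s' 0 = n" "rmem s' 0 = \<epsilon>" "rmem s' 3 = rmem s 3 + \<Delta>"
    "\<And>p. rmem s' (4 + p) = rmem s (4 + p) + (\<Sum>y\<in>{1..<q}. if bucket i y = p then \<Delta> else 0)"
    using runs_update_prog[OF l(1-3) st(2)] unfolding runs_def l(4-6) by blast
  have "represents s' (stream_vec (\<sigma> @ [(i, \<Delta>)]))"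
    using s' s(2) st(2) by (simp add: represents_def load_snoc stream_vec_snoc sum.distrib)
  moreover have "processed m B T (update_prog a b c) (initial_state n \<epsilon> \<alpha>) (\<sigma> @ [(i, \<Delta>)]) s'"
    using processed_snoc[OF s(1) s'(1)] s'(2) assms(2) by simp
  ultimately show ?case unfolding u by blast
qed

lemma query_result_query_prog:
  assumes "represents s x" "real query_time \<le> T"
  shows "query_result m B T (query_prog a b c) s (filter (\<lambda>i. 0 < (\<Sum>j<n. x j) \<and> i \<in> candidates x) [0..<n])"
proof -
  let ?s = "s\<lparr>out := []\<rparr>"
  have l: "imem ?s 0 = n" "rmem ?s 0 = \<epsilon>" "out ?s = []" "rmem ?s 3 = (\<Sum>j<n. x j)" "\<And>p. rmem ?s (4 + p) = load x p"
    using assms(1) by (auto simp: represents_def)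
  have "passes ?s i \<longleftrightarrow> i \<in> candidates x" if "i < n" for i
    using that unfolding passes_def candidates_def l(4,5) by simp
  then have "filter (\<lambda>i. 0 < rmem ?s 3 \<and> passes ?s i) [0..<n] = filter (\<lambda>i. 0 < (\<Sum>j<n. x j) \<and> i \<in> candidates x) [0..<n]"
    unfolding l(4) by (intro filter_cong) auto
  moreover obtain t s' where "exec m B (query_prog a b c) ?s t s'" "t \<le> query_time"
    "out s' = filter (\<lambda>i. 0 < rmem ?s 3 \<and> passes ?s i) [0..<n]"
    using runs_query_prog[OF l(1-3)] unfolding runs_def by blast
  moreover from this(2) have "real t \<le> T" using assms(2) by simp
  ultimately show ?thesis unfolding query_result_def by metis
qed

end

section \<open>Space, time and word size\<close>

text \<open>Since \<open>ln 2 >= 2 / 3\<close>, both \<open>l - 1\<close> and \<open>1\<close> are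
  at most \<open>3 / 2 * ln y\<close>.\<close>

lemma exponent_le_ln:
  assumes "2 ^ (l - 1) < y" "2 \<le> y" shows "real l \<le> 3 * ln y"
proof -
  have l2: "ln 2 \<ge> (2 / 3 :: real)" by (rule ln2_ge_two_thirds)
  have ly: "ln y \<ge> ln 2" using assms by simp
  have "ln (2 ^ (l - 1)) < ln y" using assms by (subst ln_less_cancel_iff) auto
  then have "real (l - 1) * ln 2 < ln y" by (simp add: ln_realpow)
  moreover have "real (l - 1) * (2 / 3) \<le> real (l - 1) * ln 2" using l2 by (intro mult_left_mono) auto
  moreover have "real l \<le> real (l - 1) + 1" by simp
  ultimately show ?thesis using l2 ly by linarith
qed

text \<open>The first bracket is the exponent of a power of \<open>n\<close> above \<open>M\<close>;
  it is doubled for \<open>M * q\<close>, and the rest pays for the small summands of the word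
  bound.\<close>

definition word_exp :: "nat \<Rightarrow> nat \<Rightarrow> nat \<Rightarrow> nat" where
  "word_exp a b c = 2 * (2 + 2 * (a + 1) + (c + 3) * (b + 2)) + (a + b + c + 10)"

section \<open>The number of buckets\<close>

locale sketch_gap = sketch +
  fixes C0 :: nat
  assumes gap: "\<And>x. x \<ge> 1 \<Longrightarrow> \<exists>p. prime p \<and> x < p \<and> p \<le> C0 * x"
    and c_eq: "c = 16 * a * C0"
begin

lemma r_le: "r \<le> 2 * a * lk"
proof -
  have "r \<le> a * lk + 1" unfolding r_def by simp
  moreover have "1 \<le> a * lk" using mult_le_mono[OF abc(1) lk_pos] by simp
  moreover have "2 * a * lk = a * lk + a * lk" by simp
  ultimately show ?thesis by linarith
qed

text \<open>The constant \<open>c = 16 * a * C0\<close> is made for this: 4 comes from the lower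
  bound for \<open>q\<close>, \<open>2 * a\<close> from \<open>r_le\<close>, 2 from
  \<open>d = 2 * 2 ^ (g - 1)\<close>, and \<open>C0\<close> from the prime gap.\<close>

lemma q_le: "q \<le> 2 ^ (sg + (g - 1))"
proof -
  have x1: "4 * r * d * L \<ge> 1" using r_pos d_pos L_pos by (simp add: Suc_le_eq)
  obtain p where p: "prime p" "4 * r * d * L < p" "p \<le> C0 * (4 * r * d * L)" using gap[OF x1] by blast
  have "q \<le> p" unfolding q_def by (rule Least_le) (use p in simp)
  also note p(3)
  also have "C0 * (4 * r * d * L) \<le> C0 * (4 * (2 * a * lk) * d * L)"
    using r_le by (intro mult_le_mono) auto
  also have "d = 2 * 2 ^ (g - 1)" unfolding d_def using g_pos by (simp add: power_eq_if)
  also have "C0 * (4 * (2 * a * lk) * (2 * 2 ^ (g - 1)) * L) = sz * 2 ^ (g - 1)"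
  proof -
    have "sz = 16 * a * C0 * L * lk" unfolding sz_def by (simp only: c_eq[symmetric])
    then show ?thesis by simp
  qed
  also have "\<dots> \<le> 2 ^ sg * 2 ^ (g - 1)" unfolding sg_def by (intro mult_le_mono1 le_ceil_log)
  finally show ?thesis by (simp add: power_add)
qed

text \<open>Minimality of \<open>g\<close> gives \<open>(g - 1) * r <= lk + 1\<close>, and the
  \<open>+ 1\<close> in \<open>r\<close> gives \<open>a * lk < r * (b * sg)\<close>; eliminating
  \<open>lk\<close> leaves a common factor \<open>r\<close>. The opposite rounding of
  \<open>r\<close> is used in \<open>r_sg_le\<close>.\<close>

lemma g_le: "a * (g - 1) \<le> b * sg + a"
proof -
  have "(g - 1) * r < lk + 2" using g_less[of "g - 1"] g_pos by simp
  then have "(g - 1) * r \<le> lk + 1" by simp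
  then have "a * ((g - 1) * r) \<le> a * (lk + 1)" by (rule mult_le_mono2)
  moreover have "a * lk < r * (b * sg)"
    unfolding r_def using abc sg_pos dividend_less_div_times[of "b * sg" "a * lk"] by simp
  moreover have "a \<le> r * a" using r_pos by simp
  moreover have "a * ((g - 1) * r) = r * (a * (g - 1))" by (simp only: mult_ac)
  ultimately have "r * (a * (g - 1)) \<le> r * (b * sg + a)"
    unfolding add_mult_distrib2 by linarith
  then show ?thesis using r_pos by simp
qed

lemma g_r_le: "(g - 1) * r \<le> lk + 1"
  using g_less[of "g - 1"] g_pos by simp

lemma r_sg_le: "b * ((r - 1) * sg) \<le> a * lk"
proof -
  have "(r - 1) * (b * sg) \<le> a * lk" unfolding r_def by simp
  then show ?thesis by (simp only: mult_ac)
qed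

text \<open>Arranged so that \<open>r_sg_le\<close>, \<open>g_r_le\<close> and \<open>g_le\<close>
  each bound one summand.\<close>

lemma exponent_split: "(sg + (g - 1)) * (r + 1) = (r - 1) * sg + 2 * sg + (g - 1) * r + (g - 1)"
proof -
  obtain r' where "r = Suc r'" using r_pos by (cases r) auto
  then show ?thesis by (simp only: add_mult_distrib add_mult_distrib2 mult_Suc_right mult_2 diff_Suc_1 mult_1_right) (simp add: mult.commute)
qed

lemma M_le: "M \<le> 2 ^ ((sg + (g - 1)) * (r + 1))"
  unfolding M_def power_mult by (rule power_mono[OF q_le]) simp

lemma two_pow_sg: "2 ^ sg \<le> 2 * sz"
proof -
  have "2 ^ (sg - 1) < sz" using less_ceil_log[of "sg - 1" sz] sg_pos by (simp add: sg_def)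
  then show ?thesis using sg_pos by (cases sg) auto
qed

lemma two_pow_lk: "2 ^ lk \<le> 2 * n" "2 ^ lk * \<epsilon> \<le> 2" "2 ^ (lk - 1) < 1 / \<epsilon>"
proof -
  have *: "2 ^ (lk - 1) < n" "2 ^ (lk - 1) * \<epsilon> < 1" using lk_less[of "lk - 1"] lk_pos by auto
  then show "2 ^ lk \<le> 2 * n" "2 ^ lk * \<epsilon> \<le> 2" using lk_pos by (cases lk; auto)+
  show "2 ^ (lk - 1) < 1 / \<epsilon>" using *(2) eps by (simp add: pos_less_divide_eq)
qed

lemma M_le_powr:
  "real M \<le> 4 * (2 ^ lk) powr (1 + a / b) * (2 ^ sg) powr (2 + b / a)"
proof -
  have ab: "real a > 0" "real b > 0" using abc by auto
  have 1: "real ((r - 1) * sg) \<le> a / b * lk"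
  proof -
    have "real (b * ((r - 1) * sg)) \<le> real (a * lk)" using r_sg_le by (simp only: of_nat_le_iff)
    then show ?thesis using ab by (simp add: field_simps)
  qed
  have 2: "real (g - 1) \<le> b / a * sg + 1"
  proof -
    have "real (a * (g - 1)) \<le> real (b * sg + a)" using g_le by (simp only: of_nat_le_iff)
    then show ?thesis using ab by (simp add: field_simps)
  qed
  have 3: "real ((g - 1) * r) \<le> lk + 1" using g_r_le by (metis of_nat_1 of_nat_add of_nat_le_iff)
  have "real ((sg + (g - 1)) * (r + 1)) = real ((r - 1) * sg) + 2 * real sg + real ((g - 1) * r) + real (g - 1)"
    unfolding exponent_split by simp
  also have "\<dots> \<le> a / b * lk + 2 * sg + (lk + 1) + (b / a * sg + 1)" using 1 2 3 by linarith
  \<comment> \<open>The final 2, from rounding in \<open>g_r_le\<close> and \<open>g_le\<close>,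
    becomes the factor 4.\<close>
  also have "\<dots> = real lk * (1 + a / b) + real sg * (2 + b / a) + 2" by (simp add: algebra_simps)
  finally have E: "real ((sg + (g - 1)) * (r + 1)) \<le> real lk * (1 + a / b) + real sg * (2 + b / a) + 2" .
  have "real M \<le> real (2 ^ ((sg + (g - 1)) * (r + 1)))" using M_le by (simp only: of_nat_le_iff)
  also have "\<dots> = 2 powr real ((sg + (g - 1)) * (r + 1))" by (subst powr_realpow) simp_all
  also have "\<dots> \<le> 2 powr (real lk * (1 + a / b) + real sg * (2 + b / a) + 2)" using E by (intro powr_mono) auto
  also have "\<dots> = 4 * (2 ^ lk) powr (1 + a / b) * (2 ^ sg) powr (2 + b / a)"
    by (simp add: powr_add powr_powr[symmetric] powr_realpow)
  finally show ?thesis .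
qed

lemma L_le_ln: "real L \<le> 3 * ln (real n)"
proof (rule exponent_le_ln)
  have "2 ^ (L - 1) < n" using less_ceil_log[of "L - 1" n] L_pos by (simp add: L_def)
  then show "2 ^ (L - 1) < real n" by (metis of_nat_less_iff of_nat_numeral of_nat_power)
qed (use n in simp)

lemma lk_le_ln: "real lk \<le> 3 * ln (1 / \<epsilon>)"
  by (rule exponent_le_ln[OF two_pow_lk(3)]) (use eps in \<open>simp add: field_simps\<close>)

text \<open>The upper bound for \<open>a / b\<close> controls the exponent of
  \<open>1 / \<epsilon>\<close>, the lower one gives \<open>b / a <= 2 / \<alpha>\<close> for the
  logarithms. The 18 consists of a 2 from rounding \<open>sz\<close> up to a power of two and a 3
  from each of the two logarithms.\<close>

lemma space_bound:
  assumes ab: "\<alpha> / 2 \<le> a / b" "a / b \<le> \<alpha>"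
  shows "real M \<le> (4 * 2 powr (1 + \<alpha>) * (18 * c) powr (2 + 2 / \<alpha>)) *
     ((1 / \<epsilon>) powr (1 + \<alpha>) * (ln (1 / \<epsilon>) * ln (real n)) powr (2 + 2 / \<alpha>))"
proof -
  define X where "X = ln (1 / \<epsilon>) * ln (real n)"
  have pos: "real a > 0" "real b > 0" using abc by auto
  have "real a / real b > 0" using pos by simp
  then have al: "\<alpha> > 0" using ab(2) by linarith
  have ba: "b / a \<le> 2 / \<alpha>" using ab(1) pos al by (simp add: field_simps)
  have Xnn: "X \<ge> 0" unfolding X_def using eps n by (intro mult_nonneg_nonneg ln_ge_zero) (auto simp: field_simps)
  have k1: "(2::real) ^ lk \<le> 2 * (1 / \<epsilon>)" using two_pow_lk(2) eps by (simp add: field_simps)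
  have "(2 ^ lk) powr (1 + a / b) \<le> (2 ^ lk :: real) powr (1 + \<alpha>)" using ab(2) by (intro powr_mono) auto
  also have "\<dots> \<le> (2 * (1 / \<epsilon>)) powr (1 + \<alpha>)" using k1 al by (intro powr_mono2) auto
  also have "\<dots> = 2 powr (1 + \<alpha>) * (1 / \<epsilon>) powr (1 + \<alpha>)" by (rule powr_mult)
  finally have A: "(2 ^ lk) powr (1 + a / b) \<le> 2 powr (1 + \<alpha>) * (1 / \<epsilon>) powr (1 + \<alpha>)" .
  have s1: "(2::real) ^ sg \<le> 18 * c * X"
  proof -
    have "(2::real) ^ sg \<le> real (2 * sz)" using two_pow_sg by (metis of_nat_le_iff of_nat_numeral of_nat_power)
    also have "\<dots> = 2 * c * (real lk * real L)" by (simp add: sz_def)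
    also have "\<dots> \<le> 2 * c * ((3 * ln (1 / \<epsilon>)) * (3 * ln (real n)))"
      using L_le_ln lk_le_ln by (intro mult_left_mono mult_mono) (use order_trans[OF of_nat_0_le_iff lk_le_ln] in auto)
    finally show ?thesis by (simp add: X_def)
  qed
  have "(2 ^ sg) powr (2 + b / a) \<le> (2 ^ sg :: real) powr (2 + 2 / \<alpha>)" using ba by (intro powr_mono) auto
  also have "\<dots> \<le> (18 * c * X) powr (2 + 2 / \<alpha>)" using s1 al by (intro powr_mono2) auto
  also have "\<dots> = (18 * c) powr (2 + 2 / \<alpha>) * X powr (2 + 2 / \<alpha>)" by (rule powr_mult)
  finally have S: "(2 ^ sg) powr (2 + b / a) \<le> (18 * c) powr (2 + 2 / \<alpha>) * X powr (2 + 2 / \<alpha>)" .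
  have "real M \<le> 4 * (2 ^ lk) powr (1 + a / b) * (2 ^ sg) powr (2 + b / a)" by (rule M_le_powr)
  also have "\<dots> \<le> 4 * (2 powr (1 + \<alpha>) * (1 / \<epsilon>) powr (1 + \<alpha>)) * ((18 * c) powr (2 + 2 / \<alpha>) * X powr (2 + 2 / \<alpha>))"
    using A S by (intro mult_mono mult_left_mono) auto
  finally show ?thesis unfolding X_def by (simp only: mult_ac)
qed

section \<open>Running time and word size\<close>

definition hb :: nat where "hb = 2 * (2 * c * L ^ 2) ^ (b + 1)"

lemma sz_le: "sz \<le> c * L ^ 2"
  unfolding sz_def using lk_le_L by (simp add: power2_eq_square)

text \<open>From \<open>g - 1 <= b * sg + 1\<close> follows
  \<open>q <= 2 * (2 ^ sg) ^ (b + 1)\<close>, and \<open>2 ^ sg\<close> is at most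
  \<open>2 * c * L ^ 2\<close>. So \<open>q\<close>, and with it every other parameter, is
  polylogarithmic in \<open>n\<close> uniformly in \<open>\<epsilon>\<close>.\<close>

lemma param_le_hb: "q \<le> hb" "r \<le> hb" "L \<le> hb" "lk \<le> hb" "g \<le> hb" "sg \<le> hb" "1 \<le> hb"
proof -
  have g1: "g - 1 \<le> b * sg + 1"
  proof -
    have "b * sg + a \<le> a * (b * sg + 1)" using abc by simp
    then have "a * (g - 1) \<le> a * (b * sg + 1)" using g_le by linarith
    then show ?thesis using abc(1) by (simp only: mult_le_cancel1)
  qed
  have s2: "2 ^ sg \<le> 2 * c * L ^ 2" using two_pow_sg sz_le by simp
  have "q \<le> 2 ^ (sg + (b * sg + 1))"
    by (rule order_trans[OF q_le], rule power_increasing) (use g1 in auto)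
  also have "\<dots> = 2 * (2 ^ sg) ^ (b + 1)" by (simp add: power_add power_mult[symmetric] mult.commute)
  also have "\<dots> \<le> hb" unfolding hb_def using s2 by (intro mult_le_mono2 power_mono) auto
  finally show q: "q \<le> hb" .
  have "g < d" unfolding d_def by (rule less_exp)
  then show "r \<le> hb" "L \<le> hb" "lk \<le> hb" "g \<le> hb" "1 \<le> hb" using bounds_by_q q lk_le_L L_pos by linarith+
  have "2 * c * L ^ 2 \<ge> 1" using abc L_pos by (simp add: Suc_le_eq)
  have "sg < 2 ^ sg" by (rule less_exp)
  also note s2
  also have "2 * c * L ^ 2 = (2 * c * L ^ 2) ^ 1" by simp
  also have "\<dots> \<le> (2 * c * L ^ 2) ^ (b + 1)" using \<open>2 * c * L ^ 2 \<ge> 1\<close> by (intro power_increasing) auto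
  finally show "sg \<le> hb" unfolding hb_def by simp
qed

lemma hb_le: "real hb \<le> 2 * (18 * real c) ^ (b + 1) * ln (real n) ^ (2 * (b + 1))"
proof -
  have "real (2 * c * L ^ 2) \<le> 2 * c * (3 * ln (real n)) ^ 2"
  proof -
    have "(real L) ^ 2 \<le> (3 * ln (real n)) ^ 2" using L_le_ln by (intro power_mono) auto
    then have "(2 * real c) * (real L) ^ 2 \<le> (2 * real c) * (3 * ln (real n)) ^ 2" by (intro mult_left_mono) auto
    then show ?thesis by simp
  qed
  also have "\<dots> = 18 * c * ln (real n) ^ 2" by (simp add: power2_eq_square)
  finally have "real (2 * c * L ^ 2) ^ (b + 1) \<le> (18 * c * ln (real n) ^ 2) ^ (b + 1)" by (rule power_mono) simp
  then have "real hb \<le> 2 * (18 * c * ln (real n) ^ 2) ^ (b + 1)" unfolding hb_def by simp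
  also have "\<dots> = 2 * (18 * real c) ^ (b + 1) * ln (real n) ^ (2 * (b + 1))"
    unfolding power_mult by (subst power_mult_distrib) simp
  finally show ?thesis .
qed

lemma le_n_power: "x \<le> 2 ^ k \<Longrightarrow> x \<le> n ^ k"
  using power_mono[of 2 n k] n by simp

text \<open>Capping \<open>lk\<close> makes \<open>2 ^ lk\<close> at most \<open>n ^ 2\<close>
  however small \<open>\<epsilon>\<close> is, so \<open>M\<close> is polynomial in \<open>n\<close>.
  Each of the fourteen summands is at most \<open>n ^ wexp\<close>, and \<open>16 <= n ^ 4\<close>
  absorbs their number.\<close>

lemma word_bound: "2 * n + 2 * sz + a * lk + b * sg + a + b + c + lk + sg + r + M * q + q + M + 100 < n ^ (word_exp a b c + 4)"
proof -
  define wexp where "wexp = word_exp a b c"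
  define w1 where "w1 = 2 + 2 * (a + 1) + (c + 3) * (b + 2)"
  have n1: "n \<ge> 1" using n by simp
  have inc: "n ^ i \<le> n ^ j" if "i \<le> j" for i j using that n1 by (rule power_increasing)
  have two: "x * 2 \<le> n ^ Suc k" if "x \<le> n ^ k" for x k
    using mult_le_mono[OF that n] by (simp add: mult.commute)
  have c2: "2 * c \<le> n ^ (c + 1)" using le_n_power[of "2 * c" "c + 1"] less_exp[of c] by simp
  have szn: "2 * sz \<le> n ^ (c + 3)"
  proof -
    have "2 * sz \<le> 2 * c * n ^ 2" 
    proof -
      have "c * L ^ 2 \<le> c * n ^ 2" using L_le_n by (intro mult_le_mono2 power_mono) auto
      then show ?thesis using sz_le by linarith
    qed
    also have "\<dots> \<le> n ^ (c + 1) * n ^ 2" using c2 by (rule mult_le_mono1)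
    finally show ?thesis unfolding power_add[symmetric] by (simp add: numeral_eq_Suc)
  qed
  have sgn: "2 ^ sg \<le> n ^ (c + 3)" using two_pow_sg szn by linarith
  have lkn: "2 ^ lk \<le> n ^ 2" using order_trans[OF two_pow_lk(1) mult_le_mono1[OF n, of n]]
    by (simp only: power2_eq_square)
  have Mw: "M \<le> n ^ w1"
  proof -
    have g1: "g - 1 \<le> b * sg + 1"
    proof -
      have "b * sg + a \<le> a * (b * sg + 1)" using abc by simp
      then have "a * (g - 1) \<le> a * (b * sg + 1)" using g_le by linarith
      then show ?thesis using abc(1) by (simp only: mult_le_cancel1)
    qed
    have "(r - 1) * sg \<le> b * ((r - 1) * sg)" using abc by simp
    then have "(sg + (g - 1)) * (r + 1) \<le> a * lk + 2 * sg + (lk + 1) + (b * sg + 1)"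
      unfolding exponent_split using r_sg_le g_r_le g1 by linarith
    also have "\<dots> = lk * (a + 1) + sg * (b + 2) + 2" by (simp add: algebra_simps)
    finally have "M \<le> 2 ^ (lk * (a + 1) + sg * (b + 2) + 2)"
      by (intro order_trans[OF M_le] power_increasing) auto
    also have "\<dots> = (2 ^ lk) ^ (a + 1) * (2 ^ sg) ^ (b + 2) * 2 ^ 2" by (simp only: power_add power_mult)
    also have "\<dots> \<le> (n ^ 2) ^ (a + 1) * (n ^ (c + 3)) ^ (b + 2) * n ^ 2"
      using lkn sgn n by (intro mult_le_mono power_mono) auto
    also have "\<dots> = n ^ w1" by (simp only: w1_def power_mult[symmetric] power_add[symmetric]) (simp add: add_ac)
    finally show ?thesis .
  qed
  have W: "wexp = 2 * w1 + (a + b + c + 10)" by (simp add: wexp_def word_exp_def w1_def)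
  have self: "x \<le> n ^ x" for x using le_n_power[of x x] less_exp[of x] by simp
  have qM: "q \<le> n ^ w1" using q_le_M Mw by simp
  have sgn': "sg \<le> n ^ (c + 3)" using sgn less_exp[of sg] by linarith
  have lkn': "lk \<le> n ^ 1" using lk_le_L L_le_n by simp
  have t: "2 * n \<le> n ^ wexp" "2 * sz \<le> n ^ wexp" "a * lk \<le> n ^ wexp" "b * sg \<le> n ^ wexp" "a \<le> n ^ wexp"
    "b \<le> n ^ wexp" "c \<le> n ^ wexp" "lk \<le> n ^ wexp" "sg \<le> n ^ wexp" "r \<le> n ^ wexp" "M * q \<le> n ^ wexp"
    "q \<le> n ^ wexp" "M \<le> n ^ wexp" "100 \<le> n ^ wexp"
  proof -
    have "2 * n \<le> n ^ 2" using n by (simp add: power2_eq_square)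
    then show "2 * n \<le> n ^ wexp" using inc[of 2 wexp] W by linarith
    show "2 * sz \<le> n ^ wexp" using szn inc[of "c + 3" wexp] W by linarith
    have "a * lk \<le> n ^ (a + 1)" unfolding power_add by (intro mult_le_mono self lkn')
    then show "a * lk \<le> n ^ wexp" using inc[of "a + 1" wexp] W by linarith
    have "b * sg \<le> n ^ (b + (c + 3))" unfolding power_add[of n b] by (intro mult_le_mono self sgn')
    then show "b * sg \<le> n ^ wexp" using inc[of "b + (c + 3)" wexp] W by linarith
    show "a \<le> n ^ wexp" using self[of a] inc[of a wexp] W by linarith
    show "b \<le> n ^ wexp" using self[of b] inc[of b wexp] W by linarith
    show "c \<le> n ^ wexp" using self[of c] inc[of c wexp] W by linarith
    show "lk \<le> n ^ wexp" using lkn' inc[of 1 wexp] W by linarith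
    show "sg \<le> n ^ wexp" using sgn' inc[of "c + 3" wexp] W by linarith
    have "n ^ w1 \<le> n ^ wexp" using inc[of w1 wexp] W by linarith
    then show "q \<le> n ^ wexp" "M \<le> n ^ wexp" "r \<le> n ^ wexp" using qM Mw bounds_by_q by linarith+
    have "M * q \<le> n ^ (w1 + w1)" unfolding power_add by (intro mult_le_mono Mw qM)
    then show "M * q \<le> n ^ wexp" using inc[of "w1 + w1" wexp] W by linarith
    have "100 \<le> n ^ 7" by (rule le_n_power) simp
    then show "100 \<le> n ^ wexp" using inc[of 7 wexp] W by linarith
  qed
  have "n ^ wexp > 0" using n1 by simp
  then have "2 * n + 2 * sz + a * lk + b * sg + a + b + c + lk + sg + r + M * q + q + M + 100 < 16 * n ^ wexp"
    using t by linarith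
  also have "\<dots> \<le> n ^ 4 * n ^ wexp" using power_mono[OF n, of 4] by (intro mult_le_mono1) simp
  finally show ?thesis unfolding wexp_def by (simp add: power_add mult.commute)
qed

end

locale sketch_full = sketch_gap n a b c \<epsilon> C0 + sketch_machine n a b c \<epsilon> m B
  for n a b c :: nat and \<epsilon> :: real and C0 m B :: nat
begin

text \<open>The fourth power counts places \<open>y\<close>, digits of the bucket, bits of
  \<open>i\<close>, and multiplications for \<open>j ^ v\<close>; it also covers the quadratic cost
  of the prime search.\<close>

lemma time_bounds: "update_time \<le> 100 * hb ^ 4" "query_time \<le> n * (100 * hb ^ 4)"
proof -
  define h where "h = hb"
  note p = param_le_hb[folded h_def]
  have h1: "h \<le> h ^ 4" "h ^ 2 \<le> h ^ 4" "h ^ 3 \<le> h ^ 4" "1 \<le> h ^ 4"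
    using power_increasing[of _ 4 h] p(7) by (auto intro: self_le_power)
  have "q * (q + 1) + q \<le> h * (h + 1) + h" using p by (intro add_mono mult_mono) auto
  then have st: "setup_time \<le> 4 * h ^ 2 + 20 * h + 16"
    unfolding setup_time_def using p by (simp add: power2_eq_square algebra_simps)
  have bt: "bucket_time \<le> 3 * h ^ 3 + 8 * h ^ 2 + 8 * h + 3"
  proof -
    have "r * (L * (3 * r + 8) + 8) \<le> h * (h * (3 * h + 8) + 8)"
      using p by (intro mult_le_mono add_mono) auto
    then show ?thesis unfolding bucket_time_def by (simp add: power2_eq_square power3_eq_cube algebra_simps)
  qed
  have qb: "q * (bucket_time + j) \<le> 3 * h ^ 4 + 8 * h ^ 3 + 8 * h ^ 2 + (3 + j) * h" for j
  proof -
    have "q * (bucket_time + j) \<le> h * (3 * h ^ 3 + 8 * h ^ 2 + 8 * h + 3 + j)"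
      using p(1) bt by (intro mult_le_mono) auto
    then show ?thesis by (simp add: power2_eq_square power3_eq_cube power4_eq_xxxx algebra_simps)
  qed
  have qb3: "q * (bucket_time + 3) \<le> 25 * h ^ 4" using order_trans[OF qb[of 3]] h1 by simp
  have qb4: "q * (bucket_time + 4) \<le> 26 * h ^ 4" using order_trans[OF qb[of 4]] h1 by simp
  have st': "setup_time \<le> 40 * h ^ 4" using order_trans[OF st] h1 by simp
  have "setup_time + q * (bucket_time + 3) + 3 \<le> 40 * h ^ 4 + 25 * h ^ 4 + 3 * h ^ 4"
    using st' qb3 h1 by (intro add_mono) auto
  then show "update_time \<le> 100 * hb ^ 4"
    unfolding update_time_def h_def[symmetric] by simp
  have "q * (bucket_time + 4) + 7 \<le> 26 * h ^ 4 + 7 * h ^ 4" using qb4 h1 by (intro add_mono) auto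
  then have "n * (q * (bucket_time + 4) + 7) \<le> n * (33 * h ^ 4)"
    by (intro mult_le_mono2) simp
  moreover have "1 * (42 * h ^ 4) \<le> n * (42 * h ^ 4)" using n by (intro mult_le_mono1) simp
  then have "setup_time + 2 \<le> n * (42 * h ^ 4)" using st' h1 by linarith
  ultimately have "query_time \<le> n * (33 * h ^ 4) + n * (42 * h ^ 4)" unfolding query_time_def by linarith
  also have "\<dots> \<le> n * (100 * h ^ 4)" unfolding add_mult_distrib2[symmetric] by (intro mult_le_mono2) simp
  finally show "query_time \<le> n * (100 * hb ^ 4)" unfolding h_def .
qed

lemma hb4_le: "real (100 * hb ^ 4) \<le> 100 * (2 * (18 * real c) ^ (b + 1)) ^ 4 * ln (real n) ^ (8 * (b + 1))"
proof -
  have "real hb ^ 4 \<le> (2 * (18 * real c) ^ (b + 1) * ln (real n) ^ (2 * (b + 1))) ^ 4"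
    by (rule power_mono[OF hb_le]) simp
  moreover have "(x * y ^ (2 * j)) ^ 4 = x ^ 4 * y ^ (8 * j)" for x y :: real and j
    by (simp add: power_mult_distrib flip: power_mult)
  ultimately show ?thesis by (simp only: of_nat_mult of_nat_power of_nat_numeral)
qed

lemma sketch_correct:
  assumes "strict_turnstile n \<sigma>" "real update_time \<le> T1" "real query_time \<le> T2"
  shows "\<exists>s xs. processed m B T1 (update_prog a b c) (initial_state n \<epsilon> \<alpha>) \<sigma> s \<and>
     query_result m B T2 (query_prog a b c) s xs \<and> set xs \<subseteq> {..<n} \<and> real (length xs) \<le> 4 * (1 / \<epsilon>) \<and>
     (l1_norm n (stream_vec \<sigma>) > 0 \<longrightarrow> heavy_hitters n \<epsilon> (stream_vec \<sigma>) \<subseteq> set xs)"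
proof -
  let ?x = "stream_vec \<sigma>"
  let ?xs = "filter (\<lambda>i. 0 < (\<Sum>j<n. ?x j) \<and> i \<in> candidates ?x) [0..<n]"
  have nn: "\<And>i. i < n \<Longrightarrow> 0 \<le> ?x i" using strict_turnstile_nonneg[OF assms(1)] .
  obtain s where s: "processed m B T1 (update_prog a b c) (initial_state n \<epsilon> \<alpha>) \<sigma> s" "represents s ?x"
    using processed_update_prog[OF assms(1,2)] by blast
  \<comment> \<open>At most \<open>2 * 2 ^ lk\<close> candidates with
    \<open>2 ^ lk <= 2 / \<epsilon>\<close> give the 4; for the zero vector the list is
    empty.\<close>
  have len: "real (length ?xs) \<le> 4 * (1 / \<epsilon>)"
  proof (cases "0 < (\<Sum>j<n. ?x j)")
    case True
    have "length ?xs = card (set ?xs)" by (rule distinct_card[symmetric]) simp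
    also have "set ?xs = candidates ?x" using True by (auto simp: candidates_def)
    finally have "length ?xs \<le> 2 * 2 ^ lk" using card_candidates_le[OF nn True] by simp
    then have "real (length ?xs) \<le> real (2 * 2 ^ lk)" by (simp only: of_nat_le_iff)
    also have "\<dots> \<le> 4 * (1 / \<epsilon>)" using two_pow_lk(2) eps by (simp add: field_simps)
    finally show ?thesis .
  next
    case False
    then have "?xs = []" by simp
    then show ?thesis using eps by (simp only: list.size) simp
  qed
  have "l1_norm n ?x = (\<Sum>j<n. ?x j)" unfolding l1_norm_def using nn by (intro sum.cong) auto
  then have "l1_norm n ?x > 0 \<longrightarrow> heavy_hitters n \<epsilon> ?x \<subseteq> set ?xs"
    using heavy_subset_candidates[of ?x] nn by (auto simp: candidates_def)
  then show ?thesis using s(1) query_result_query_prog[OF s(2) assms(3)] len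
    by (intro exI[of _ s] exI[of _ ?xs]) auto
qed

end

text \<open>The factor in \<open>2 * m\<close> counts both memory banks. The zero vector is exempt
  from completeness because all its \<open>n\<close> coordinates satisfy the heavy hitter
  condition.\<close>

theorem theorem3:
  fixes \<alpha> :: real
  assumes "\<alpha> > 0"
  shows "\<exists>(upd :: com) (qry :: com) (C :: real) (k :: nat) (w :: nat).
    \<forall>(n :: nat) (\<epsilon> :: real). n \<ge> 2 \<and> 0 < \<epsilon> \<and> \<epsilon> \<le> 1 / 2 \<longrightarrow>
      (\<exists>m :: nat.
        real (2 * m) \<le> C * ((1 / \<epsilon>) powr (1 + \<alpha>) * (ln (1 / \<epsilon>) * ln (real n)) powr (2 + 2 / \<alpha>)) \<and>
        (\<forall>\<sigma> :: stream. strict_turnstile n \<sigma> \<longrightarrow>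
          (\<exists>s xs.
            processed m (n ^ w) (C * ln (real n) ^ k) upd (initial_state n \<epsilon> \<alpha>) \<sigma> s \<and>
            query_result m (n ^ w) (C * (real n * ln (real n) ^ k)) qry s xs \<and>
            set xs \<subseteq> {..<n} \<and>
            real (length xs) \<le> C * (1 / \<epsilon>) \<and>
            (l1_norm n (stream_vec \<sigma>) > 0 \<longrightarrow>
              heavy_hitters n \<epsilon> (stream_vec \<sigma>) \<subseteq> set xs))))"
proof -
  obtain C0 :: nat where C0: "C0 \<ge> 1" "\<And>x. x \<ge> 1 \<Longrightarrow> \<exists>p. prime p \<and> x < p \<and> p \<le> C0 * x"
    using exists_prime_linear_gap by blast
  \<comment> \<open>\<open>\<alpha> * b >= 2\<close> ensures that rounding down to \<open>a\<close>
    loses at most half, which puts \<open>a / b\<close> between \<open>\<alpha> / 2\<close> and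
    \<open>\<alpha>\<close>.\<close>
  define b where "b = nat \<lceil>2 / \<alpha>\<rceil>"
  define a where "a = nat \<lfloor>\<alpha> * b\<rfloor>"
  have b: "real b \<ge> 2 / \<alpha>" unfolding b_def by (rule of_nat_ceiling)
  have ab2: "\<alpha> * b \<ge> 2" using b assms by (simp add: field_simps)
  have bpos: "b \<ge> 1" using ab2 by (cases b) auto
  have "real a = real_of_int \<lfloor>\<alpha> * b\<rfloor>" unfolding a_def using ab2 by simp
  then have a: "real a \<le> \<alpha> * b" "\<alpha> * b - 1 \<le> real a" by linarith+
  have apos: "a \<ge> 1" using a(2) ab2 by (cases a) auto
  have ratio: "\<alpha> / 2 \<le> a / b" "a / b \<le> \<alpha>" using a ab2 bpos by (simp_all add: field_simps)
  define c where "c = 16 * a * C0"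
  have cge: "c \<ge> 2" unfolding c_def using mult_le_mono[OF apos C0(1)] by simp
  define K1 where "K1 = 4 * 2 powr (1 + \<alpha>) * (18 * c) powr (2 + 2 / \<alpha>)"
  \<comment> \<open>The value of the logarithmic factor at \<open>n = 2\<close> and
    \<open>\<epsilon> = 1 / 2\<close>, a positive lower bound for the space expression;
    \<open>40 / \<rho>\<close> pays for the 20 extra cells in both banks.\<close>
  define \<rho> where "\<rho> = (ln 2 * ln 2) powr (2 + 2 / \<alpha>)"
  define Ct where "Ct = 100 * (2 * (18 * real c) ^ (b + 1)) ^ 4"
  define C where "C = (2 * K1 + 40 / \<rho>) + Ct + 4"
  have \<rho>: "\<rho> > 0" unfolding \<rho>_def by simp
  have K1: "K1 \<ge> 0" and Ct: "Ct \<ge> 0" unfolding K1_def Ct_def by auto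
  have CC: "C \<ge> 2 * K1 + 40 / \<rho>" "C \<ge> Ct" "C \<ge> 4" using K1 Ct \<rho> by (auto simp: C_def)
  \<comment> \<open>Times are bounded by \<open>hb ^ 4\<close>, and \<open>hb\<close> is of degree
    \<open>2 * (b + 1)\<close> in \<open>ln n\<close>.\<close>
  define k where "k = 8 * (b + 1)"
  define w where "w = word_exp a b c + 4"
  have main: "\<exists>m :: nat.
        real (2 * m) \<le> C * ((1 / \<epsilon>) powr (1 + \<alpha>) * (ln (1 / \<epsilon>) * ln (real n)) powr (2 + 2 / \<alpha>)) \<and>
        (\<forall>\<sigma> :: stream. strict_turnstile n \<sigma> \<longrightarrow>
          (\<exists>s xs.
            processed m (n ^ w) (C * ln (real n) ^ k) (update_prog a b c) (initial_state n \<epsilon> \<alpha>) \<sigma> s \<and>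
            query_result m (n ^ w) (C * (real n * ln (real n) ^ k)) (query_prog a b c) s xs \<and>
            set xs \<subseteq> {..<n} \<and>
            real (length xs) \<le> C * (1 / \<epsilon>) \<and>
            (l1_norm n (stream_vec \<sigma>) > 0 \<longrightarrow>
              heavy_hitters n \<epsilon> (stream_vec \<sigma>) \<subseteq> set xs)))"
    if n: "n \<ge> 2" and eps: "0 < \<epsilon>" "\<epsilon> \<le> 1 / 2" for n :: nat and \<epsilon> :: real
  proof -
    interpret sketch_gap n a b c \<epsilon> C0
      by unfold_locales (use n eps apos bpos cge C0 c_def in auto)
    interpret sketch_full n a b c \<epsilon> C0 "M + 20" "n ^ w"
      by unfold_locales (use word_bound in \<open>auto simp: w_def\<close>)
    define R where "R = (1 / \<epsilon>) powr (1 + \<alpha>) * (ln (1 / \<epsilon>) * ln (real n)) powr (2 + 2 / \<alpha>)"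
    have "\<rho> \<le> (ln (1 / \<epsilon>) * ln (real n)) powr (2 + 2 / \<alpha>)"
      unfolding \<rho>_def using assms n eps by (intro powr_mono2 mult_mono) (auto simp: field_simps)
    moreover have "1 \<le> (1 / \<epsilon>) powr (1 + \<alpha>)" using assms eps by (intro ge_one_powr_ge_zero) (auto simp: field_simps)
    ultimately have "1 * \<rho> \<le> R" unfolding R_def using \<rho> by (intro mult_mono) auto
    then have R: "\<rho> \<le> R" "0 \<le> R" using \<rho> by auto
    have "real M \<le> K1 * R" unfolding K1_def R_def using space_bound[OF ratio] by simp
    moreover have "40 \<le> 40 / \<rho> * R" using R \<rho> by (simp add: field_simps)
    ultimately have "real (2 * (M + 20)) \<le> (2 * K1 + 40 / \<rho>) * R" by (simp add: algebra_simps)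
    also have "\<dots> \<le> C * R" using CC(1) R(2) by (rule mult_right_mono)
    finally have space: "real (2 * (M + 20)) \<le> C * R" .
    have lnn: "0 \<le> ln (real n) ^ k" using n by simp
    have hb4: "real (100 * hb ^ 4) \<le> C * ln (real n) ^ k"
      using order_trans[OF hb4_le[folded k_def] mult_right_mono[OF CC(2) lnn, unfolded Ct_def]] by simp
    have t1: "real update_time \<le> C * ln (real n) ^ k"
      using time_bounds(1) hb4 by (meson of_nat_mono order_trans)
    have "real query_time \<le> real n * real (100 * hb ^ 4)"
      using of_nat_mono[OF time_bounds(2), where 'a = real] by (simp only: of_nat_mult)
    also have "\<dots> \<le> real n * (C * ln (real n) ^ k)" using hb4 by (intro mult_left_mono) auto
    finally have t2: "real query_time \<le> C * (real n * ln (real n) ^ k)" by (simp only: mult_ac)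
    have len: "4 * (1 / \<epsilon>) \<le> C * (1 / \<epsilon>)" using CC(3) eps by (intro mult_right_mono) auto
    show ?thesis
    proof (intro exI[of _ "M + 20"] conjI allI impI)
      show "real (2 * (M + 20)) \<le> C * ((1 / \<epsilon>) powr (1 + \<alpha>) * (ln (1 / \<epsilon>) * ln (real n)) powr (2 + 2 / \<alpha>))"
        using space unfolding R_def .
    next
      fix \<sigma> assume "strict_turnstile n \<sigma>"
      from sketch_correct[OF this t1 t2, of \<alpha>]
      obtain s xs where *: "processed (M + 20) (n ^ w) (C * ln (real n) ^ k) (update_prog a b c) (initial_state n \<epsilon> \<alpha>) \<sigma> s"
        "query_result (M + 20) (n ^ w) (C * (real n * ln (real n) ^ k)) (query_prog a b c) s xs"
        "set xs \<subseteq> {..<n}" "real (length xs) \<le> 4 * (1 / \<epsilon>)"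
        "l1_norm n (stream_vec \<sigma>) > 0 \<longrightarrow> heavy_hitters n \<epsilon> (stream_vec \<sigma>) \<subseteq> set xs"
        by blast
      then show "\<exists>s xs.
            processed (M + 20) (n ^ w) (C * ln (real n) ^ k) (update_prog a b c) (initial_state n \<epsilon> \<alpha>) \<sigma> s \<and>
            query_result (M + 20) (n ^ w) (C * (real n * ln (real n) ^ k)) (query_prog a b c) s xs \<and>
            set xs \<subseteq> {..<n} \<and>
            real (length xs) \<le> C * (1 / \<epsilon>) \<and>
            (l1_norm n (stream_vec \<sigma>) > 0 \<longrightarrow>
              heavy_hitters n \<epsilon> (stream_vec \<sigma>) \<subseteq> set xs)"
        using order_trans[OF *(4) len] by blast
    qed
  qed
  show ?thesis
  proof (rule exI[of _ "update_prog a b c"], rule exI[of _ "query_prog a b c"], rule exI[of _ C],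
      rule exI[of _ k], rule exI[of _ w], intro allI impI)
    fix n :: nat and \<epsilon> :: real assume "n \<ge> 2 \<and> 0 < \<epsilon> \<and> \<epsilon> \<le> 1 / 2"
    then show "\<exists>m :: nat.
        real (2 * m) \<le> C * ((1 / \<epsilon>) powr (1 + \<alpha>) * (ln (1 / \<epsilon>) * ln (real n)) powr (2 + 2 / \<alpha>)) \<and>
        (\<forall>\<sigma> :: stream. strict_turnstile n \<sigma> \<longrightarrow>
          (\<exists>s xs.
            processed m (n ^ w) (C * ln (real n) ^ k) (update_prog a b c) (initial_state n \<epsilon> \<alpha>) \<sigma> s \<and>
            query_result m (n ^ w) (C * (real n * ln (real n) ^ k)) (query_prog a b c) s xs \<and>
            set xs \<subseteq> {..<n} \<and>
            real (length xs) \<le> C * (1 / \<epsilon>) \<and>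
            (l1_norm n (stream_vec \<sigma>) > 0 \<longrightarrow>
              heavy_hitters n \<epsilon> (stream_vec \<sigma>) \<subseteq> set xs)))"
      by (elim conjE) (rule main)
  qed
qed

end
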